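(* Let $\mathcal E,\mathcal G,\mathcal Y$ be Hilbert spaces and let $F,\Theta,G$ be free holomorphic functions on $[B(\mathcal H)^n]_1$ with coefficients in $B(\mathcal E,\mathcal G)$, $B(\mathcal Y,\mathcal G)$, and $B(\mathcal E,\mathcal Y)$, respectively, such that $$F(X)=\Theta(X)G(X),\qquad X\in[B(\mathcal H)^n]_1.$$ Assume that: (i) $\|F\|_\infty\le1$ and $\widetilde F\in\mathcal A_n\bar\otimes_{min}B(\mathcal E,\mathcal G)$; (ii) $\Theta$ is inner and $\widetilde\Theta\in\mathcal A_n\bar\otimes_{min}B(\mathcal Y,\mathcal G)$. Then $\|G\|_\infty\le1$, $\widetilde G\in\mathcal A_n\bar\otimes_{min}B(\mathcal E,\mathcal Y)$, and $$F(X)F(X)^*\le\Theta(X)\Theta(X)^*,\qquad X\in[B(\mathcal H)^n]_1.$$ If, in addition, $F$ is inner, then so is $G$.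
   Context: $\mathcal H$ is a separable infinite dimensional Hilbert space and $n\in\{1,2,\dots\}\cup\{\infty\}$. For $X=(X_1,\dots,X_n)\in B(\mathcal H)^n$, $\|X\|=\|\sum_iX_iX_i^*\|^{1/2}$, and $[B(\mathcal H)^n]_1=\{X:\|X\|<1\}$. $\mathbb F_n^+$ is the unital free semigroup on $g_1,\dots,g_n$; for $\alpha=g_{i_1}\cdots g_{i_k}$ put $|\alpha|=k$, $X_\alpha=X_{i_1}\cdots X_{i_k}$ ($X_\alpha=I$ for the neutral element, of length $0$). A free holomorphic function on $[B(\mathcal H)^n]_1$ with coefficients in $B(\mathcal E,\mathcal G)$ is a map $F(X)=\sum_{k=0}^\infty\sum_{|\alpha|=k}X_\alpha\otimes A_{(\alpha)}$ with $A_{(\alpha)}\in B(\mathcal E,\mathcal G)$, the series in $k$ converging in operator norm for all $X\in[B(\mathcal H)^n]_1$. The same series evaluates $F$ at strict row contractions on any Hilbert space. $\|F\|_\infty=\sup_{\|X\|<1}\|F(X)\|$; $F$ is bounded if this is finite. $S_i\varphi=e_i\otimes\varphi$ ($i=1,\dots,n$) are the left creation operators on the full Fock space $F^2(H_n)=\mathbb C1\oplus\bigoplus_{k\ge1}H_n^{\otimes k}$, where $H_n$ is an $n$-dimensional Hilbert space with orthonormal basis $e_1,\dots,e_n$. $\mathcal A_n$ (the noncommutative disc algebra) is the norm closed algebra generated by $S_1,\dots,S_n$ and $I$; $\bar\otimes_{min}$ is the spatial (norm closed) tensor product. The boundary function of a bounded free holomorphic function $F$ is $\widetilde F=\text{SOT-}\lim_{r\to1}F(rS_1,\dots,rS_n)$;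 $F$ is inner if it is bounded and $\widetilde F$ is an isometry. *)

theory Defs
  imports "HOL-Analysis.Analysis"
begin

section \<open>Complex Hilbert spaces\<close>

class complex_vector = real_vector +
  fixes scaleC :: "complex \<Rightarrow> 'a \<Rightarrow> 'a"  (infixr "*\<^sub>C" 75)
  assumes scaleC_add_right: "c *\<^sub>C (x + y) = c *\<^sub>C x + c *\<^sub>C y"
    and scaleC_add_left: "(c + d) *\<^sub>C x = c *\<^sub>C x + d *\<^sub>C x"
    and scaleC_scaleC: "c *\<^sub>C d *\<^sub>C x = (c * d) *\<^sub>C x"
    and scaleC_of_real: "complex_of_real r *\<^sub>C x = r *\<^sub>R x"

global_interpretation complex_vector: vector_space "scaleC :: complex \<Rightarrow> 'a \<Rightarrow> 'a::complex_vector"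
  defines cspan = complex_vector.span
  apply standard
     apply (rule scaleC_add_right scaleC_add_left scaleC_scaleC)+
  using scaleC_of_real[of 1] by simp

class complex_normed_vector = complex_vector + real_normed_vector +
  assumes norm_scaleC: "norm (c *\<^sub>C x) = cmod c * norm x"

text \<open>The inner product is linear in the second argument; its real part is the
  real inner product that induces norm and topology.\<close>

class chilbert_space = complex_vector + real_inner + complete_space +
  fixes cinner :: "'a \<Rightarrow> 'a \<Rightarrow> complex"
  assumes cinner_commute: "cinner x y = cnj (cinner y x)"
    and cinner_add_right: "cinner x (y + z) = cinner x y + cinner x z"
    and cinner_scaleC_right: "cinner x (c *\<^sub>C y) = c * cinner x y"
    and inner_eq_Re_cinner: "inner x y = Re (cinner x y)"
begin

lemma cinner_scaleC_left: "cinner (c *\<^sub>C x) y = cnj c * cinner x y"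
  by (metis cinner_commute cinner_scaleC_right complex_cnj_mult)

lemma cinner_add_left: "cinner (x + y) z = cinner x z + cinner y z"
  by (metis cinner_commute cinner_add_right complex_cnj_add)

lemma cinner_self: "cinner x x = complex_of_real ((norm x)\<^sup>2)"
proof (rule complex_eqI)
  show "Re (cinner x x) = Re (complex_of_real ((norm x)\<^sup>2))"
    by (simp add: inner_eq_Re_cinner[symmetric] power2_norm_eq_inner)
  have "Im (cinner x x) = - Im (cinner x x)"
    by (metis cinner_commute cnj.sel(2))
  then show "Im (cinner x x) = Im (complex_of_real ((norm x)\<^sup>2))"
    by simp
qed

subclass complex_normed_vector
proof
  fix c and x :: 'a
  have "complex_of_real ((norm (c *\<^sub>C x))\<^sup>2) = complex_of_real ((cmod c * norm x)\<^sup>2)"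
    unfolding cinner_self[symmetric] cinner_scaleC_right cinner_scaleC_left
    by (simp add: cinner_self power_mult_distrib mult.assoc[symmetric])
       (simp add: complex_norm_square[symmetric])
  then have "(norm (c *\<^sub>C x))\<^sup>2 = (cmod c * norm x)\<^sup>2"
    by (simp only: of_real_eq_iff)
  then show "norm (c *\<^sub>C x) = cmod c * norm x"
    by (simp add: power2_eq_iff_nonneg)
qed

subclass banach ..

end

lemma cmod_cinner_le: "cmod (cinner x y) \<le> norm x * norm (y::'a::chilbert_space)"
proof (cases "cinner x y = 0")
  case False
  let ?z = "cinner x y"
  let ?c = "cnj ?z / cmod ?z"
  have c: "cmod ?c = 1" using False by (simp add: norm_divide)
  have "?c * ?z = complex_of_real (cmod ?z)"
    using False by (simp add: complex_norm_square[symmetric] power2_eq_square mult.commute)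
  then have "cmod ?z = Re (cinner x (?c *\<^sub>C y))"
    by (simp add: cinner_scaleC_right)
  also have "\<dots> \<le> norm x * norm (?c *\<^sub>C y)"
    by (metis inner_eq_Re_cinner norm_cauchy_schwarz)
  also have "\<dots> = norm x * norm y" by (simp add: norm_scaleC c)
  finally show ?thesis .
qed auto

instantiation complex :: chilbert_space
begin
definition scaleC_complex :: "complex \<Rightarrow> complex \<Rightarrow> complex" where "scaleC_complex c x = c * x"
definition cinner_complex :: "complex \<Rightarrow> complex \<Rightarrow> complex" where "cinner_complex x y = cnj x * y"
instance
  by standard (auto simp: scaleC_complex_def cinner_complex_def algebra_simps scaleR_conv_of_real
      inner_complex_def)
end

instantiation blinfun :: (real_normed_vector, complex_normed_vector) complex_vector
begin
lift_definition scaleC_blinfun :: "complex \<Rightarrow> ('a \<Rightarrow>\<^sub>L 'b) \<Rightarrow> ('a \<Rightarrow>\<^sub>L 'b)" is "\<lambda>c T x. c *\<^sub>C T x"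
proof -
  fix c and T :: "'a \<Rightarrow> 'b" assume T: "bounded_linear T"
  then obtain K where K: "\<And>x. norm (T x) \<le> norm x * K" using bounded_linear.bounded by blast
  show "bounded_linear (\<lambda>x. c *\<^sub>C T x)"
  proof (rule bounded_linear_intro[where K="cmod c * K"])
    fix x y r
    show "c *\<^sub>C T (x + y) = c *\<^sub>C T x + c *\<^sub>C T y"
      using T by (simp add: linear_simps scaleC_add_right)
    show "c *\<^sub>C T (r *\<^sub>R x) = r *\<^sub>R (c *\<^sub>C T x)"
      using T by (simp add: linear_simps scaleC_scaleC mult.commute flip: scaleC_of_real)
    show "norm (c *\<^sub>C T x) \<le> norm x * (cmod c * K)"
      using mult_left_mono[OF K, of "cmod c" x] by (simp add: norm_scaleC algebra_simps)
  qed
qed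
instance
  by standard (transfer; auto simp: scaleC_add_right scaleC_add_left scaleC_scaleC scaleC_of_real)+
end

section \<open>Square-summable families\<close>

lemma l2_summable_add:
  fixes f g :: "'i \<Rightarrow> 'e::real_normed_vector"
  assumes "(\<lambda>i. (norm (f i))\<^sup>2) summable_on UNIV" "(\<lambda>i. (norm (g i))\<^sup>2) summable_on UNIV"
  shows "(\<lambda>i. (norm (f i + g i))\<^sup>2) summable_on UNIV"
proof (rule summable_on_comparison_test)
  show "(\<lambda>i. 2 * (norm (f i))\<^sup>2 + 2 * (norm (g i))\<^sup>2) summable_on UNIV"
    by (intro summable_on_add summable_on_cmult_right assms)
  show "(norm (f i + g i))\<^sup>2 \<le> 2 * (norm (f i))\<^sup>2 + 2 * (norm (g i))\<^sup>2" for i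
  proof -
    have "(norm (f i + g i))\<^sup>2 \<le> (norm (f i) + norm (g i))\<^sup>2"
      by (intro power_mono norm_triangle_ineq) auto
    also have "\<dots> \<le> 2 * (norm (f i))\<^sup>2 + 2 * (norm (g i))\<^sup>2"
      using sum_squares_bound[of "norm (f i)" "norm (g i)"] by (simp add: power2_sum)
    finally show ?thesis .
  qed
qed auto

typedef (overloaded) ('i, 'e) l2 = "{f :: 'i \<Rightarrow> 'e::chilbert_space. (\<lambda>i. (norm (f i))\<^sup>2) summable_on UNIV}"
  morphisms l2_nth Abs_l2
  by (rule exI[of _ "\<lambda>_. 0"]) simp

setup_lifting type_definition_l2

lemma l2_summable: "(\<lambda>i. (norm (l2_nth f i))\<^sup>2) summable_on UNIV"
  using l2_nth by auto

lemma l2_cinner_abs_summable: "(\<lambda>i. norm (cinner (l2_nth f i) (l2_nth g i))) summable_on UNIV"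
proof (rule summable_on_comparison_test)
  show "(\<lambda>i. (norm (l2_nth f i))\<^sup>2 + (norm (l2_nth g i))\<^sup>2) summable_on UNIV"
    by (intro summable_on_add l2_summable)
  fix i
  have "norm (cinner (l2_nth f i) (l2_nth g i)) \<le> norm (l2_nth f i) * norm (l2_nth g i)"
    by (rule cmod_cinner_le)
  also have "\<dots> \<le> (norm (l2_nth f i))\<^sup>2 + (norm (l2_nth g i))\<^sup>2"
    using sum_squares_bound[of "norm (l2_nth f i)" "norm (l2_nth g i)"]
      mult_nonneg_nonneg[OF norm_ge_zero[of "l2_nth f i"] norm_ge_zero[of "l2_nth g i"]] by linarith
  finally show "norm (cinner (l2_nth f i) (l2_nth g i)) \<le> \<dots>" .
qed auto

lemma l2_cinner_summable: "(\<lambda>i. cinner (l2_nth f i) (l2_nth g i)) summable_on UNIV"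
  by (rule abs_summable_summable[OF l2_cinner_abs_summable])

lemma l2_inner_summable: "(\<lambda>i. inner (l2_nth f i) (l2_nth g i)) summable_on UNIV"
  unfolding inner_eq_Re_cinner by (rule summable_on_Re[OF l2_cinner_summable])

instantiation l2 :: (type, chilbert_space) complex_vector
begin
lift_definition zero_l2 :: "('a, 'b) l2" is "\<lambda>_. 0" by simp
lift_definition plus_l2 :: "('a, 'b) l2 \<Rightarrow> ('a, 'b) l2 \<Rightarrow> ('a, 'b) l2" is "\<lambda>f g i. f i + g i"
  by (rule l2_summable_add)
lift_definition uminus_l2 :: "('a, 'b) l2 \<Rightarrow> ('a, 'b) l2" is "\<lambda>f i. - f i" by simp
lift_definition minus_l2 :: "('a, 'b) l2 \<Rightarrow> ('a, 'b) l2 \<Rightarrow> ('a, 'b) l2" is "\<lambda>f g i. f i - g i"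
  using l2_summable_add[of _ "\<lambda>i. - g i" for g] by fastforce
lift_definition scaleR_l2 :: "real \<Rightarrow> ('a, 'b) l2 \<Rightarrow> ('a, 'b) l2" is "\<lambda>r f i. r *\<^sub>R f i"
  by (simp add: power_mult_distrib summable_on_cmult_right)
lift_definition scaleC_l2 :: "complex \<Rightarrow> ('a, 'b) l2 \<Rightarrow> ('a, 'b) l2" is "\<lambda>c f i. c *\<^sub>C f i"
  by (simp add: norm_scaleC power_mult_distrib summable_on_cmult_right)
instance
  by standard (transfer; auto simp: algebra_simps scaleC_add_right scaleC_add_left scaleC_scaleC
      scaleC_of_real)+
end

instantiation l2 :: (type, chilbert_space) real_inner
begin
definition inner_l2 :: "('a, 'b) l2 \<Rightarrow> ('a, 'b) l2 \<Rightarrow> real" where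
  "inner_l2 f g = (\<Sum>\<^sub>\<infinity>i. inner (l2_nth f i) (l2_nth g i))"
definition norm_l2 :: "('a, 'b) l2 \<Rightarrow> real" where
  "norm_l2 f = sqrt (inner f f)"
definition dist_l2 :: "('a, 'b) l2 \<Rightarrow> ('a, 'b) l2 \<Rightarrow> real" where
  "dist_l2 f g = norm (f - g)"
definition sgn_l2 :: "('a, 'b) l2 \<Rightarrow> ('a, 'b) l2" where
  "sgn_l2 f = inverse (norm f) *\<^sub>R f"
definition uniformity_l2 :: "(('a, 'b) l2 \<times> ('a, 'b) l2) filter" where
  "uniformity_l2 = (INF e\<in>{0 <..}. principal {(x, y). dist x y < e})"
definition open_l2 :: "('a, 'b) l2 set \<Rightarrow> bool" where
  "open_l2 S = (\<forall>x\<in>S. \<forall>\<^sub>F (x', y) in uniformity. x' = x \<longrightarrow> y \<in> S)"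
instance
proof
  fix f g h :: "('a, 'b) l2" and r :: real
  show "inner f g = inner g f" by (simp add: inner_l2_def inner_commute)
  show "inner (f + g) h = inner f h + inner g h"
    unfolding inner_l2_def plus_l2.rep_eq inner_add_left
    by (intro infsum_add l2_inner_summable)
  show "inner (r *\<^sub>R f) g = r * inner f g"
    unfolding inner_l2_def scaleR_l2.rep_eq inner_scaleR_left
    by (intro infsum_cmult_right l2_inner_summable)
  show ge0: "0 \<le> inner f f" by (simp add: inner_l2_def infsum_nonneg)
  show "inner f f = 0 \<longleftrightarrow> f = 0"
  proof
    assume "inner f f = 0"
    then have "inner (l2_nth f i) (l2_nth f i) = 0" for i
      unfolding inner_l2_def by (intro nonneg_infsum_le_0D[where A=UNIV]) (auto intro: l2_inner_summable)
    then show "f = 0" by (intro l2_nth_inject[THEN iffD1]) (auto simp: zero_l2.rep_eq)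
  qed (simp add: inner_l2_def zero_l2.rep_eq)
  show "norm f = sqrt (inner f f)" by (rule norm_l2_def)
qed (simp_all only: dist_l2_def sgn_l2_def uniformity_l2_def open_l2_def)
end

lemma norm_l2_sq: "(norm f)\<^sup>2 = (\<Sum>\<^sub>\<infinity>i. (norm (l2_nth f i))\<^sup>2)"
  by (simp add: power2_norm_eq_inner inner_l2_def)

lemma norm_l2_nth_le: "norm (l2_nth f i) \<le> norm f"
proof -
  have "(norm (l2_nth f i))\<^sup>2 \<le> (norm f)\<^sup>2"
    using finite_sum_le_infsum[OF l2_summable[of f], of "{i}"] by (simp add: norm_l2_sq)
  then show ?thesis by (rule power2_le_imp_le) simp
qed

lemma l2_complete:
  fixes X :: "nat \<Rightarrow> ('i, 'e::chilbert_space) l2"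
  assumes "Cauchy X"
  shows "convergent X"
proof -
  have "Cauchy (\<lambda>n. l2_nth (X n) i)" for i
  proof (rule CauchyI)
    fix e :: real assume "0 < e"
    then obtain M where M: "\<And>m n. m \<ge> M \<Longrightarrow> n \<ge> M \<Longrightarrow> norm (X m - X n) < e"
      using CauchyD[OF assms] by blast
    have "norm (l2_nth (X m) i - l2_nth (X n) i) < e" if "m \<ge> M" "n \<ge> M" for m n
      using norm_l2_nth_le[of "X m - X n" i] M[OF that] by (simp add: minus_l2.rep_eq)
    then show "\<exists>M. \<forall>m\<ge>M. \<forall>n\<ge>M. norm (l2_nth (X m) i - l2_nth (X n) i) < e" by blast
  qed
  then have "\<forall>i. \<exists>l. (\<lambda>n. l2_nth (X n) i) \<longlonglongrightarrow> l"
    using Cauchy_convergent convergent_def by blast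
  then obtain L where L: "\<And>i. (\<lambda>n. l2_nth (X n) i) \<longlonglongrightarrow> L i" by metis
  have key: "\<exists>M. \<forall>n\<ge>M. \<forall>I. finite I \<longrightarrow> (\<Sum>i\<in>I. (norm (L i - l2_nth (X n) i))\<^sup>2) \<le> e\<^sup>2"
    if e: "0 < e" for e :: real
  proof -
    obtain M where M: "\<And>m n. m \<ge> M \<Longrightarrow> n \<ge> M \<Longrightarrow> norm (X m - X n) < e"
      using CauchyD[OF assms e] by blast
    have "(\<Sum>i\<in>I. (norm (L i - l2_nth (X n) i))\<^sup>2) \<le> e\<^sup>2" if "n \<ge> M" "finite I" for n I
    proof (rule tendsto_upperbound)
      show "(\<lambda>m. \<Sum>i\<in>I. (norm (l2_nth (X m) i - l2_nth (X n) i))\<^sup>2)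
          \<longlonglongrightarrow> (\<Sum>i\<in>I. (norm (L i - l2_nth (X n) i))\<^sup>2)"
        by (intro tendsto_intros L)
      show "\<forall>\<^sub>F m in sequentially. (\<Sum>i\<in>I. (norm (l2_nth (X m) i - l2_nth (X n) i))\<^sup>2) \<le> e\<^sup>2"
        unfolding eventually_sequentially
      proof (intro exI allI impI)
        fix m assume "M \<le> m"
        have "(\<Sum>i\<in>I. (norm (l2_nth (X m) i - l2_nth (X n) i))\<^sup>2) \<le> (norm (X m - X n))\<^sup>2"
          unfolding norm_l2_sq using finite_sum_le_infsum[OF l2_summable[of "X m - X n"] \<open>finite I\<close>]
          by (simp add: minus_l2.rep_eq)
        also have "\<dots> \<le> e\<^sup>2"
          using M[OF \<open>M \<le> m\<close> \<open>n \<ge> M\<close>] by (intro power_mono) auto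
        finally show "(\<Sum>i\<in>I. (norm (l2_nth (X m) i - l2_nth (X n) i))\<^sup>2) \<le> e\<^sup>2" .
      qed
    qed simp
    then show ?thesis by blast
  qed
  have l2: "(\<lambda>i. (norm (L i - l2_nth (X n) i))\<^sup>2) summable_on UNIV"
    if "\<forall>I. finite I \<longrightarrow> (\<Sum>i\<in>I. (norm (L i - l2_nth (X n) i))\<^sup>2) \<le> e\<^sup>2" for n e
    using that by (intro nonneg_bdd_above_summable_on) (auto simp: bdd_above_def)
  obtain N where "\<forall>I. finite I \<longrightarrow> (\<Sum>i\<in>I. (norm (L i - l2_nth (X N) i))\<^sup>2) \<le> 1\<^sup>2"
    using key[of 1] by auto
  from l2_summable_add[OF l2[OF this] l2_summable[of "X N"]]
  have LL: "l2_nth (Abs_l2 L) = L" by (intro Abs_l2_inverse) simp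
  have "X \<longlonglongrightarrow> Abs_l2 L"
  proof (rule LIMSEQ_I)
    fix e :: real assume "0 < e"
    then obtain M where M: "\<And>n I. n \<ge> M \<Longrightarrow> finite I \<Longrightarrow> (\<Sum>i\<in>I. (norm (L i - l2_nth (X n) i))\<^sup>2) \<le> (e/2)\<^sup>2"
      using key[of "e/2"] by auto
    have "norm (X n - Abs_l2 L) < e" if "n \<ge> M" for n
    proof -
      have "(norm (Abs_l2 L - X n))\<^sup>2 \<le> (e/2)\<^sup>2"
        unfolding norm_l2_sq minus_l2.rep_eq LL
      proof (rule infsum_le_finite_sums)
        show "(\<lambda>i. (norm (L i - l2_nth (X n) i))\<^sup>2) summable_on UNIV"
          by (rule l2) (use M[OF that] in blast)
      qed (rule M[OF that])
      then have "norm (Abs_l2 L - X n) \<le> e/2"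
        by (rule power2_le_imp_le) (use \<open>0 < e\<close> in simp)
      then show ?thesis using \<open>0 < e\<close> by (simp add: norm_minus_commute)
    qed
    then show "\<exists>M. \<forall>n\<ge>M. norm (X n - Abs_l2 L) < e" by blast
  qed
  then show ?thesis by (auto simp: convergent_def)
qed

instantiation l2 :: (type, chilbert_space) chilbert_space
begin
definition cinner_l2 :: "('a, 'b) l2 \<Rightarrow> ('a, 'b) l2 \<Rightarrow> complex" where
  "cinner_l2 f g = (\<Sum>\<^sub>\<infinity>i. cinner (l2_nth f i) (l2_nth g i))"
instance
proof
  fix f g h :: "('a, 'b) l2" and c :: complex
  show "cinner f g = cnj (cinner g f)"
    unfolding cinner_l2_def infsum_cnj[symmetric] 
    by (rule infsum_cong) (rule cinner_commute)
  show "cinner f (g + h) = cinner f g + cinner f h"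
    unfolding cinner_l2_def plus_l2.rep_eq cinner_add_right
    by (intro infsum_add l2_cinner_summable)
  show "cinner f (c *\<^sub>C g) = c * cinner f g"
    unfolding cinner_l2_def scaleC_l2.rep_eq cinner_scaleC_right
    by (intro infsum_cmult_right l2_cinner_summable)
  show "inner f g = Re (cinner f g)"
    unfolding cinner_l2_def inner_l2_def inner_eq_Re_cinner
    by (rule infsum_Re[OF l2_cinner_summable])
qed (rule l2_complete)
end

section \<open>Orthonormal bases\<close>

lemma bounded_linear_cinner_right: "bounded_linear (cinner (x::'a::chilbert_space))"
proof (rule bounded_linear_intro[where K="norm x"])
  show "cinner x (r *\<^sub>R y) = r *\<^sub>R cinner x y" for r y
    by (simp add: cinner_scaleC_right scaleR_conv_of_real flip: scaleC_of_real)
  show "norm (cinner x y) \<le> norm y * norm x" for y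
    using cmod_cinner_le[of x y] by (simp add: mult.commute)
qed (rule cinner_add_right)

lemma cinner_simps:
  fixes x :: "'a::chilbert_space"
  shows "cinner x 0 = 0" "cinner 0 x = 0"
    "cinner x (y - z) = cinner x y - cinner x z"
    "cinner (y - z) x = cinner y x - cinner z x"
    "cinner x (\<Sum>i\<in>I. f i) = (\<Sum>i\<in>I. cinner x (f i))"
proof -
  interpret bounded_linear "cinner x" by (rule bounded_linear_cinner_right)
  show 0: "cinner x 0 = 0" and d: "cinner x (y - z) = cinner x y - cinner x z"
    and "cinner x (\<Sum>i\<in>I. f i) = (\<Sum>i\<in>I. cinner x (f i))"
    by (fact zero diff sum)+
  show "cinner 0 x = 0" by (subst cinner_commute) (simp add: 0)
  show "cinner (y - z) x = cinner y x - cinner z x"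
    by (subst (1 2 3) cinner_commute) (simp add: d)
qed

definition orthonormal :: "'a::chilbert_space set \<Rightarrow> bool" where
  "orthonormal B \<longleftrightarrow> (\<forall>x\<in>B. \<forall>y\<in>B. cinner x y = (if x = y then 1 else 0))"

lemma orthonormal_subset: "orthonormal B \<Longrightarrow> F \<subseteq> B \<Longrightarrow> orthonormal F"
  unfolding orthonormal_def by blast

definition is_onb :: "'a::chilbert_space set \<Rightarrow> bool" where
  "is_onb B \<longleftrightarrow> orthonormal B \<and> closure (cspan B) = UNIV"

lemma orthonormal_proj_orth:
  assumes "orthonormal F" "finite F" "b \<in> F"
  shows "cinner b (x - (\<Sum>c\<in>F. cinner c x *\<^sub>C c)) = 0"
proof -
  have "(\<Sum>c\<in>F. cinner c x * cinner b c) = (\<Sum>c\<in>F. if c = b then cinner b x else 0)"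
    using assms by (intro sum.cong) (auto simp: orthonormal_def)
  also have "\<dots> = cinner b x" using assms by simp
  finally show ?thesis by (simp add: cinner_simps cinner_scaleC_right)
qed

lemma orthonormal_pythagoras:
  assumes "orthonormal F" "finite F"
  shows "(norm (x - (\<Sum>c\<in>F. r c *\<^sub>C c)))\<^sup>2
    = (norm (x - (\<Sum>c\<in>F. cinner c x *\<^sub>C c)))\<^sup>2 + (\<Sum>c\<in>F. (cmod (cinner c x - r c))\<^sup>2)"
proof -
  let ?P = "\<Sum>c\<in>F. cinner c x *\<^sub>C c" and ?s = "\<lambda>c. cinner c x - r c"
  let ?d = "\<Sum>c\<in>F. ?s c *\<^sub>C c"
  have d: "?d = ?P - (\<Sum>c\<in>F. r c *\<^sub>C c)"
    by (simp add: complex_vector.scale_left_diff_distrib sum_subtractf)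
  have "cinner (x - ?P) ?d = 0"
    unfolding cinner_simps(5) cinner_scaleC_right
    by (intro sum.neutral ballI, subst cinner_commute)
      (simp add: orthonormal_proj_orth[OF assms])
  then have orth: "inner (x - ?P) ?d = 0" by (simp add: inner_eq_Re_cinner)
  have coef: "cinner c ?d = ?s c" if "c \<in> F" for c
  proof -
    have "cinner c ?d = (\<Sum>e\<in>F. if e = c then ?s c else 0)"
      unfolding cinner_simps(5) cinner_scaleC_right
      using assms that by (intro sum.cong) (auto simp: orthonormal_def)
    also have "\<dots> = ?s c" using assms that by simp
    finally show ?thesis .
  qed
  have "cinner ?d ?d = (\<Sum>c\<in>F. ?s c * cnj (?s c))"
    unfolding cinner_simps(5)[of ?d] cinner_scaleC_right
    by (intro sum.cong refl, subst (2) cinner_commute) (simp add: coef)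
  also have "\<dots> = complex_of_real (\<Sum>c\<in>F. (cmod (?s c))\<^sup>2)"
    by (simp only: complex_norm_square of_real_sum)
  finally have nd: "(norm ?d)\<^sup>2 = (\<Sum>c\<in>F. (cmod (?s c))\<^sup>2)"
    unfolding cinner_self by (simp only: of_real_eq_iff)
  have "x - (\<Sum>c\<in>F. r c *\<^sub>C c) = (x - ?P) + ?d" by (simp add: d)
  then have "(norm (x - (\<Sum>c\<in>F. r c *\<^sub>C c)))\<^sup>2 = (norm (x - ?P))\<^sup>2 + (norm ?d)\<^sup>2"
    using norm_add_Pythagorean[of "x - ?P" ?d] orth by (simp only: orthogonal_def)
  then show ?thesis by (simp add: nd)
qed

lemma bessel:
  assumes "orthonormal B" "finite F" "F \<subseteq> B"
  shows "(\<Sum>c\<in>F. (cmod (cinner c x))\<^sup>2) \<le> (norm x)\<^sup>2"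
proof -
  have "orthonormal F" using assms orthonormal_subset by blast
  from orthonormal_pythagoras[OF this assms(2), of x "\<lambda>_. 0"] show ?thesis
    by simp
qed

lemma onb_expansion:
  assumes "is_onb B"
  shows "((\<lambda>b. cinner b x *\<^sub>C b) has_sum x) B"
  unfolding has_sum_def
proof (rule tendstoI)
  fix e :: real assume "0 < e"
  have "x \<in> closure (cspan B)" using assms by (simp add: is_onb_def)
  then obtain y where y: "y \<in> cspan B" "dist y x < e"
    using \<open>0 < e\<close> closure_approachable by blast
  then obtain F r where F: "finite F" "F \<subseteq> B" "y = (\<Sum>a\<in>F. r a *\<^sub>C a)"
    unfolding complex_vector.span_explicit by blast
  have "dist (\<Sum>b\<in>G. cinner b x *\<^sub>C b) x < e" if G: "finite G" "F \<subseteq> G" "G \<subseteq> B" for G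
  proof -
    let ?r = "\<lambda>a. if a \<in> F then r a else 0"
    have yG: "y = (\<Sum>a\<in>G. ?r a *\<^sub>C a)"
      unfolding F(3) using G F by (intro sum.mono_neutral_cong_left) auto
    have "orthonormal G" using assms G orthonormal_subset by (auto simp: is_onb_def)
    from orthonormal_pythagoras[OF this G(1), of x ?r]
    have "(norm (x - (\<Sum>b\<in>G. cinner b x *\<^sub>C b)))\<^sup>2 \<le> (norm (x - y))\<^sup>2"
      unfolding yG by (simp add: sum_nonneg)
    then have "norm (x - (\<Sum>b\<in>G. cinner b x *\<^sub>C b)) \<le> norm (x - y)"
      by (rule power2_le_imp_le) simp
    then show ?thesis using y by (simp add: dist_norm norm_minus_commute)
  qed
  then show "\<forall>\<^sub>F G in finite_subsets_at_top B. dist (\<Sum>b\<in>G. cinner b x *\<^sub>C b) x < e"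
    unfolding eventually_finite_subsets_at_top using F by blast
qed

lemma parseval:
  assumes "is_onb B"
  shows "((\<lambda>b. cnj (cinner b x) * cinner b y) has_sum cinner x y) B"
proof -
  have "((\<lambda>b. cinner x (cinner b y *\<^sub>C b)) has_sum cinner x y) B"
    by (rule has_sum_bounded_linear[OF bounded_linear_cinner_right onb_expansion[OF assms]])
  moreover have "cinner x (cinner b y *\<^sub>C b) = cnj (cinner b x) * cinner b y" for b
    by (simp add: cinner_scaleC_right cinner_commute[of x b])
  ultimately show ?thesis by simp
qed

lemma exists_onb: "\<exists>B::'a::chilbert_space set. is_onb B"
proof -
  let ?A = "{B::'a set. orthonormal B}"
  have "\<exists>M\<in>?A. \<forall>X\<in>?A. M \<subseteq> X \<longrightarrow> X = M"
  proof (rule subset_Zorn')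
    fix C assume C: "subset.chain ?A C"
    have "cinner x y = (if x = y then 1 else 0)" if "x \<in> \<Union>C" "y \<in> \<Union>C" for x y
    proof -
      obtain X Y where "X \<in> C" "Y \<in> C" "x \<in> X" "y \<in> Y" using \<open>x \<in> \<Union>C\<close> \<open>y \<in> \<Union>C\<close> by blast
      moreover have "X \<subseteq> Y \<or> Y \<subseteq> X" using C \<open>X \<in> C\<close> \<open>Y \<in> C\<close> by (auto simp: subset_chain_def)
      ultimately obtain Z where "Z \<in> C" "x \<in> Z" "y \<in> Z" by blast
      moreover have "orthonormal Z" using C \<open>Z \<in> C\<close> by (auto simp: subset_chain_def)
      ultimately show ?thesis by (simp add: orthonormal_def)
    qed
    then show "\<Union>C \<in> ?A" by (simp add: orthonormal_def)
  qed
  then obtain B :: "'a set" where B: "orthonormal B" and max: "\<And>X. orthonormal X \<Longrightarrow> B \<subseteq> X \<Longrightarrow> X = B" by blast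
  let ?S = "cspan B"
  have "x \<in> closure ?S" for x
  proof (rule ccontr)
    assume x: "x \<notin> closure ?S"
    have ne: "?S \<noteq> {}" using complex_vector.span_zero by blast
    let ?d = "infdist x ?S"
    have d0: "0 \<le> ?d" by (rule infdist_nonneg)
    have "\<exists>p\<in>?S. dist x p < ?d + 1 / Suc n" for n
    proof (rule ccontr)
      assume "\<not> ?thesis"
      then have "?d + 1 / Suc n \<le> ?d"
        unfolding infdist_notempty[OF ne] by (intro cINF_greatest[OF ne]) (auto simp: not_less)
      then show False by simp
    qed
    then obtain p where p: "\<And>n. p n \<in> ?S" "\<And>n. dist x (p n) < ?d + 1 / Suc n" by metis
    have lim_d: "(\<lambda>n. dist x (p n)) \<longlonglongrightarrow> ?d"
    proof (rule tendsto_sandwich[of "\<lambda>_. ?d" _ _ "\<lambda>n. ?d + 1 / Suc n"])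
      show "(\<lambda>n. ?d + 1 / Suc n) \<longlonglongrightarrow> ?d"
        using tendsto_add[OF tendsto_const LIMSEQ_inverse_real_of_nat, of ?d]
        by (simp add: inverse_eq_divide)
      show "\<forall>\<^sub>F n in sequentially. ?d \<le> dist x (p n)"
        by (intro always_eventually allI infdist_le p)
      show "\<forall>\<^sub>F n in sequentially. dist x (p n) \<le> ?d + 1 / Suc n"
        by (intro always_eventually allI less_imp_le p)
    qed simp
    have par: "(dist (p m) (p n))\<^sup>2 \<le> 2 * (dist x (p m))\<^sup>2 + 2 * (dist x (p n))\<^sup>2 - 4 * ?d\<^sup>2" for m n
    proof -
      let ?q = "(1/2) *\<^sub>R (p m + p n)"
      have "?q = complex_of_real (1/2) *\<^sub>C (p m + p n)" by (rule scaleC_of_real[symmetric])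
      also have "\<dots> \<in> ?S" by (intro complex_vector.span_scale complex_vector.span_add p)
      finally have "?d \<le> norm (x - ?q)" by (metis infdist_le dist_norm)
      then have "4 * ?d\<^sup>2 \<le> 4 * (norm (x - ?q))\<^sup>2" using d0 by (simp add: power_mono)
      moreover have "(norm (p m - p n))\<^sup>2 =
          2 * (norm (x - p m))\<^sup>2 + 2 * (norm (x - p n))\<^sup>2 - 4 * (norm (x - ?q))\<^sup>2"
        by (simp add: power2_norm_eq_inner inner_diff_left inner_diff_right inner_add_left
            inner_add_right inner_commute algebra_simps)
      ultimately show ?thesis by (simp add: dist_norm)
    qed
    have "Cauchy p"
    proof (rule metric_CauchyI)
      fix e :: real assume "0 < e"
      have "(\<lambda>n. (dist x (p n))\<^sup>2) \<longlonglongrightarrow> ?d\<^sup>2" by (intro tendsto_intros lim_d)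
      moreover have "?d\<^sup>2 < ?d\<^sup>2 + e\<^sup>2 / 4" using \<open>0 < e\<close> by simp
      ultimately have "\<forall>\<^sub>F n in sequentially. (dist x (p n))\<^sup>2 < ?d\<^sup>2 + e\<^sup>2 / 4" by (rule order_tendstoD)
      then obtain M where M: "\<And>n. n \<ge> M \<Longrightarrow> (dist x (p n))\<^sup>2 < ?d\<^sup>2 + e\<^sup>2 / 4"
        unfolding eventually_sequentially by blast
      have "dist (p m) (p n) < e" if "m \<ge> M" "n \<ge> M" for m n
      proof (rule power_less_imp_less_base)
        show "(dist (p m) (p n))\<^sup>2 < e\<^sup>2" using par[of m n] M[OF that(1)] M[OF that(2)] by linarith
      qed (use \<open>0 < e\<close> in simp)
      then show "\<exists>M. \<forall>m\<ge>M. \<forall>n\<ge>M. dist (p m) (p n) < e" by blast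
    qed
    then obtain q where q: "p \<longlonglongrightarrow> q" using Cauchy_convergent convergent_def by blast
    have qS: "q \<in> closure ?S" using q p closure_sequential by blast
    have dq: "dist x q = ?d"
      by (rule LIMSEQ_unique[OF _ lim_d]) (intro tendsto_intros q)
    let ?y = "x - q"
    have y0: "?y \<noteq> 0" using x qS by auto
    have orth: "cinner b ?y = 0" if b: "b \<in> B" for b
    proof -
      have "?d \<le> dist x (p n + cinner b ?y *\<^sub>C b)" for n
        by (intro infdist_le complex_vector.span_add complex_vector.span_scale p
            complex_vector.span_base b)
      then have "?d \<le> dist x (q + cinner b ?y *\<^sub>C b)"
        by (intro tendsto_lowerbound[of "\<lambda>n. dist x (p n + cinner b ?y *\<^sub>C b)"])
          (auto intro!: tendsto_intros q always_eventually)
      then have le: "(norm ?y)\<^sup>2 \<le> (norm (?y - cinner b ?y *\<^sub>C b))\<^sup>2"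
        using d0 dq by (intro power_mono) (auto simp: dist_norm algebra_simps)
      have "orthonormal {b}" using B b by (simp add: orthonormal_def)
      from orthonormal_pythagoras[OF this, of ?y "\<lambda>_. 0"]
      have "(norm ?y)\<^sup>2 = (norm (?y - cinner b ?y *\<^sub>C b))\<^sup>2 + (cmod (cinner b ?y))\<^sup>2" by simp
      then show ?thesis using le by simp
    qed
    let ?u = "complex_of_real (1 / norm ?y) *\<^sub>C ?y"
    have u: "cinner b ?u = 0" "cinner ?u b = 0" if "b \<in> B" for b
    proof -
      show "cinner b ?u = 0" by (simp only: cinner_scaleC_right orth[OF that] mult_zero_right)
      then show "cinner ?u b = 0" by (subst cinner_commute) simp
    qed
    have "norm ?u = 1" unfolding norm_scaleC norm_of_real using y0 by simp
    then have uu: "cinner ?u ?u = 1" unfolding cinner_self by simp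
    have "orthonormal (insert ?u B)"
      using B u uu unfolding orthonormal_def by (metis insert_iff zero_neq_one)
    then have "?u \<in> B" using max by blast
    then show False using u uu by simp
  qed
  then show ?thesis using B by (auto simp: is_onb_def)
qed

section \<open>Hilbert space tensor product\<close>

definition some_onb :: "'a::chilbert_space set" where
  "some_onb = (SOME B. is_onb B)"

lemma some_onb: "is_onb some_onb"
  unfolding some_onb_def by (rule someI_ex[OF exists_onb])

text \<open>For an orthonormal basis \<open>B\<close> of the first factor, the tensor product is modelled as
  the Hilbert sum of copies of the second factor indexed by \<open>B\<close>; the elementary tensor of
  \<open>x\<close> and \<open>y\<close> has the coordinates \<open>\<langle>b, x\<rangle> y\<close>. The lemmas \<open>cinner_tensor\<close> and
  \<open>tensor_dense\<close> below determine the tensor product up to a unique unitary compatible with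
  elementary tensors, so that nothing depends on the choice of \<open>B\<close>.\<close>

typedef (overloaded) ('a, 'b) htensor =
  "{f :: ('a::chilbert_space, 'b::chilbert_space) l2. \<forall>x. x \<notin> some_onb \<longrightarrow> l2_nth f x = 0}"
  by (rule exI[of _ 0]) (simp add: zero_l2.rep_eq)

setup_lifting type_definition_htensor

instantiation htensor :: (chilbert_space, chilbert_space) complex_vector
begin
lift_definition zero_htensor :: "('a, 'b) htensor" is 0 by (simp add: zero_l2.rep_eq)
lift_definition plus_htensor :: "('a, 'b) htensor \<Rightarrow> ('a, 'b) htensor \<Rightarrow> ('a, 'b) htensor" is "(+)"
  by (simp add: plus_l2.rep_eq)
lift_definition uminus_htensor :: "('a, 'b) htensor \<Rightarrow> ('a, 'b) htensor" is uminus
  by (simp add: uminus_l2.rep_eq)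
lift_definition minus_htensor :: "('a, 'b) htensor \<Rightarrow> ('a, 'b) htensor \<Rightarrow> ('a, 'b) htensor" is "(-)"
  by (simp add: minus_l2.rep_eq)
lift_definition scaleR_htensor :: "real \<Rightarrow> ('a, 'b) htensor \<Rightarrow> ('a, 'b) htensor" is "(*\<^sub>R)"
  by (simp add: scaleR_l2.rep_eq)
lift_definition scaleC_htensor :: "complex \<Rightarrow> ('a, 'b) htensor \<Rightarrow> ('a, 'b) htensor" is "(*\<^sub>C)"
  by (simp add: scaleC_l2.rep_eq)
instance
  by standard (transfer; simp add: algebra_simps scaleC_add_right scaleC_add_left scaleC_scaleC
      scaleC_of_real)+
end

instantiation htensor :: (chilbert_space, chilbert_space) real_inner
begin
lift_definition inner_htensor :: "('a, 'b) htensor \<Rightarrow> ('a, 'b) htensor \<Rightarrow> real" is inner .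
lift_definition norm_htensor :: "('a, 'b) htensor \<Rightarrow> real" is norm .
definition dist_htensor :: "('a, 'b) htensor \<Rightarrow> ('a, 'b) htensor \<Rightarrow> real" where
  "dist_htensor f g = norm (f - g)"
definition sgn_htensor :: "('a, 'b) htensor \<Rightarrow> ('a, 'b) htensor" where
  "sgn_htensor f = inverse (norm f) *\<^sub>R f"
definition uniformity_htensor :: "(('a, 'b) htensor \<times> ('a, 'b) htensor) filter" where
  "uniformity_htensor = (INF e\<in>{0 <..}. principal {(x, y). dist x y < e})"
definition open_htensor :: "('a, 'b) htensor set \<Rightarrow> bool" where
  "open_htensor S = (\<forall>x\<in>S. \<forall>\<^sub>F (x', y) in uniformity. x' = x \<longrightarrow> y \<in> S)"
instance
proof
  fix f g h :: "('a, 'b) htensor" and r :: real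
  show "inner f g = inner g f" by transfer (rule inner_commute)
  show "inner (f + g) h = inner f h + inner g h" by transfer (rule inner_add_left)
  show "inner (r *\<^sub>R f) g = r * inner f g" by transfer (rule inner_scaleR_left)
  show "0 \<le> inner f f" by transfer (rule inner_ge_zero)
  show "inner f f = 0 \<longleftrightarrow> f = 0" by transfer (rule inner_eq_zero_iff)
  show "norm f = sqrt (inner f f)" by transfer (rule norm_eq_sqrt_inner)
qed (simp_all only: dist_htensor_def sgn_htensor_def uniformity_htensor_def open_htensor_def)
end

lemma htensor_complete:
  fixes X :: "nat \<Rightarrow> ('a::chilbert_space, 'b::chilbert_space) htensor"
  assumes "Cauchy X"
  shows "convergent X"
proof -
  have d: "dist f g = dist (Rep_htensor f) (Rep_htensor g)" for f g :: "('a, 'b) htensor"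
    by (simp add: dist_norm norm_htensor.rep_eq minus_htensor.rep_eq)
  have "Cauchy (\<lambda>n. Rep_htensor (X n))" using assms by (simp add: Cauchy_def d)
  then obtain L where L: "(\<lambda>n. Rep_htensor (X n)) \<longlonglongrightarrow> L"
    using Cauchy_convergent convergent_def by blast
  have "l2_nth L x = 0" if "x \<notin> some_onb" for x
  proof -
    have "norm (l2_nth L x) \<le> norm (Rep_htensor (X n) - L)" for n
      using norm_l2_nth_le[of "Rep_htensor (X n) - L" x] Rep_htensor[of "X n"] that
      by (simp add: minus_l2.rep_eq)
    moreover have "(\<lambda>n. norm (Rep_htensor (X n) - L)) \<longlonglongrightarrow> 0"
      using L by (simp add: tendsto_norm_zero LIM_zero)
    ultimately have "norm (l2_nth L x) \<le> 0"
      by (intro tendsto_lowerbound) (auto intro: always_eventually)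
    then show ?thesis by simp
  qed
  then have RL: "Rep_htensor (Abs_htensor L) = L" by (intro Abs_htensor_inverse) simp
  have "X \<longlonglongrightarrow> Abs_htensor L"
    using L unfolding tendsto_iff d RL .
  then show ?thesis by (auto simp: convergent_def)
qed

instantiation htensor :: (chilbert_space, chilbert_space) chilbert_space
begin
lift_definition cinner_htensor :: "('a, 'b) htensor \<Rightarrow> ('a, 'b) htensor \<Rightarrow> complex" is cinner .
instance
proof
  fix f g h :: "('a, 'b) htensor" and c :: complex
  show "cinner f g = cnj (cinner g f)" by transfer (rule cinner_commute)
  show "cinner f (g + h) = cinner f g + cinner f h" by transfer (rule cinner_add_right)
  show "cinner f (c *\<^sub>C g) = c * cinner f g" by transfer (rule cinner_scaleC_right)
  show "inner f g = Re (cinner f g)" by transfer (rule inner_eq_Re_cinner)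
qed (rule htensor_complete)
end

lemma tensor_l2_summable:
  fixes x :: "'a::chilbert_space" and y :: "'b::chilbert_space"
  shows "(\<lambda>b. (norm (if b \<in> some_onb then cinner b x *\<^sub>C y else 0))\<^sup>2) summable_on UNIV"
proof (rule nonneg_bdd_above_summable_on)
  have "(\<Sum>b\<in>I. (norm (if b \<in> some_onb then cinner b x *\<^sub>C y else 0))\<^sup>2)
      \<le> (norm x)\<^sup>2 * (norm y)\<^sup>2" if "finite I" for I
  proof -
    have "(\<Sum>b\<in>I. (norm (if b \<in> some_onb then cinner b x *\<^sub>C y else 0))\<^sup>2)
        = (\<Sum>b\<in>I \<inter> some_onb. (cmod (cinner b x))\<^sup>2) * (norm y)\<^sup>2"
      unfolding sum_distrib_right using that
      by (intro sum.mono_neutral_cong_right) (auto simp: norm_scaleC power_mult_distrib)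
    also have "\<dots> \<le> (norm x)\<^sup>2 * (norm y)\<^sup>2"
      using some_onb that by (intro mult_right_mono bessel) (auto simp: is_onb_def)
    finally show ?thesis .
  qed
  then show "bdd_above (sum (\<lambda>b. (norm (if b \<in> some_onb then cinner b x *\<^sub>C y else 0))\<^sup>2)
      ` {F. F \<subseteq> UNIV \<and> finite F})"
    by (intro bdd_aboveI2[where M="(norm x)\<^sup>2 * (norm y)\<^sup>2"]) blast
qed simp

lift_definition tensor :: "'a::chilbert_space \<Rightarrow> 'b::chilbert_space \<Rightarrow> ('a, 'b) htensor"
    (infixr "\<otimes>" 70)
  is "\<lambda>x y. Abs_l2 (\<lambda>b. if b \<in> some_onb then cinner b x *\<^sub>C y else 0)"
  by (simp add: Abs_l2_inverse tensor_l2_summable)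

lemma tensor_nth:
  "l2_nth (Rep_htensor (x \<otimes> y)) b = (if b \<in> some_onb then cinner b x *\<^sub>C y else 0)"
  by (simp add: tensor.rep_eq Abs_l2_inverse tensor_l2_summable)

lemma cinner_tensor: "cinner (x \<otimes> y) (x' \<otimes> y') = cinner x x' * cinner y y'"
proof -
  have "cinner (x \<otimes> y) (x' \<otimes> y')
      = (\<Sum>\<^sub>\<infinity>b\<in>some_onb. (cnj (cinner b x) * cinner b x') * cinner y y')"
    unfolding cinner_htensor.rep_eq cinner_l2_def tensor_nth
    by (rule infsum_cong_neutral)
      (auto simp: cinner_scaleC_left cinner_scaleC_right cinner_simps)
  also have "\<dots> = cinner x x' * cinner y y'"
    by (rule infsumI) (rule has_sum_cmult_left[OF parseval[OF some_onb]])
  finally show ?thesis .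
qed

lemma tensor_dense: "closure (cspan {x \<otimes> y |x y. True}) = (UNIV :: ('a::chilbert_space, 'b::chilbert_space) htensor set)"
proof -
  have "\<exists>s\<in>cspan {x \<otimes> y |x y. True}. dist s t < e" if "0 < e" for t :: "('a, 'b) htensor" and e
  proof -
    let ?f = "l2_nth (Rep_htensor t)"
    have f0: "?f b = 0" if "b \<notin> some_onb" for b using Rep_htensor[of t] that by simp
    obtain I where I: "finite I"
      and dI: "dist (\<Sum>b\<in>I. (norm (?f b))\<^sup>2) (\<Sum>\<^sub>\<infinity>b. (norm (?f b))\<^sup>2) \<le> e\<^sup>2 / 2"
      using infsum_finite_approximation[OF l2_summable[of "Rep_htensor t"], of "e\<^sup>2 / 2"] \<open>0 < e\<close>
      by auto
    let ?s = "\<Sum>b\<in>I \<inter> some_onb. b \<otimes> ?f b"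
    have s: "l2_nth (Rep_htensor ?s) b = (if b \<in> I then ?f b else 0)" for b
    proof -
      have *: "l2_nth (Rep_htensor (\<Sum>c\<in>J. c \<otimes> ?f c)) b
          = (\<Sum>c\<in>J. l2_nth (Rep_htensor (c \<otimes> ?f c)) b)" for J
        by (induction J rule: infinite_finite_induct)
          (simp_all add: zero_htensor.rep_eq plus_htensor.rep_eq zero_l2.rep_eq plus_l2.rep_eq)
      have "l2_nth (Rep_htensor ?s) b = (\<Sum>c\<in>I \<inter> some_onb. if c = b then ?f b else 0)"
        unfolding * using some_onb f0
        by (intro sum.cong) (auto simp: tensor_nth is_onb_def orthonormal_def)
      then show ?thesis using I f0 by auto
    qed
    have "(norm (t - ?s))\<^sup>2 = (\<Sum>\<^sub>\<infinity>b\<in>-I. (norm (?f b))\<^sup>2)"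
      unfolding norm_htensor.rep_eq norm_l2_sq minus_htensor.rep_eq minus_l2.rep_eq s
      by (rule infsum_cong_neutral) auto
    moreover have "(\<Sum>\<^sub>\<infinity>b. (norm (?f b))\<^sup>2) = (\<Sum>b\<in>I. (norm (?f b))\<^sup>2) + (\<Sum>\<^sub>\<infinity>b\<in>-I. (norm (?f b))\<^sup>2)"
    proof -
      have "(\<Sum>\<^sub>\<infinity>b\<in>I \<union> -I. (norm (?f b))\<^sup>2) = (\<Sum>\<^sub>\<infinity>b\<in>I. (norm (?f b))\<^sup>2) + (\<Sum>\<^sub>\<infinity>b\<in>-I. (norm (?f b))\<^sup>2)"
        by (intro infsum_Un_disjoint summable_on_subset_banach[OF l2_summable]) auto
      then show ?thesis using I by simp
    qed
    ultimately have "(norm (t - ?s))\<^sup>2 \<le> e\<^sup>2 / 2" using dI by (simp add: dist_real_def)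
    also have "\<dots> < e\<^sup>2" using \<open>0 < e\<close> by simp
    finally have "norm (t - ?s) < e" using \<open>0 < e\<close> by (intro power_less_imp_less_base[of _ 2 e]) auto
    moreover have "?s \<in> cspan {x \<otimes> y |x y. True}"
      by (intro complex_vector.span_sum complex_vector.span_base) blast
    ultimately show ?thesis
      by (intro bexI[of _ ?s]) (simp_all add: dist_norm norm_minus_commute)
  qed
  then have "t \<in> closure (cspan {x \<otimes> y |x y. True})" for t :: "('a, 'b) htensor"
    by (rule closure_approachable[THEN iffD2, OF allI, OF impI])
  then show ?thesis by blast
qed

section \<open>Bounded operators\<close>

text \<open>Library operators of type \<open>blinfun\<close> are only real-linear; this is the set of the
  complex-linear ones.\<close>

definition cops :: "('a::chilbert_space \<Rightarrow>\<^sub>L 'b::chilbert_space) set" where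
  "cops = {T :: 'a \<Rightarrow>\<^sub>L 'b. \<forall>c x. T (c *\<^sub>C x) = c *\<^sub>C T x}"

definition adj :: "('a::chilbert_space \<Rightarrow>\<^sub>L 'b::chilbert_space) \<Rightarrow> ('b \<Rightarrow>\<^sub>L 'a)" where
  "adj T = (THE S :: 'b \<Rightarrow>\<^sub>L 'a. \<forall>x y. cinner (T x) y = cinner x (S y))"

definition op_le :: "('a::chilbert_space \<Rightarrow>\<^sub>L 'a) \<Rightarrow> ('a \<Rightarrow>\<^sub>L 'a) \<Rightarrow> bool" where
  "op_le S T \<longleftrightarrow> (\<forall>x. cinner x ((T - S) x) \<in> \<real>\<^sub>\<ge>\<^sub>0)"

definition isometry_op :: "('a::chilbert_space \<Rightarrow>\<^sub>L 'b::chilbert_space) \<Rightarrow> bool" where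
  "isometry_op T \<longleftrightarrow> (\<forall>x. norm (T x) = norm x)"

definition tensor_op :: "('a::chilbert_space \<Rightarrow>\<^sub>L 'b::chilbert_space) \<Rightarrow> ('c::chilbert_space \<Rightarrow>\<^sub>L 'd::chilbert_space)
    \<Rightarrow> (('a, 'c) htensor \<Rightarrow>\<^sub>L ('b, 'd) htensor)"  (infixr "\<otimes>\<^sub>o" 70) where
  "X \<otimes>\<^sub>o A = (THE T :: ('a, 'c) htensor \<Rightarrow>\<^sub>L ('b, 'd) htensor. \<forall>x y. T (x \<otimes> y) = X x \<otimes> A y)"

text \<open>Sums of operator families in the strong operator topology (unordered, so that they make
  sense for infinite index sets; over a finite set this is the ordinary sum).\<close>

definition has_sot_sum :: "('i \<Rightarrow> ('a::chilbert_space \<Rightarrow>\<^sub>L 'b::chilbert_space)) \<Rightarrow> 'i set \<Rightarrow> ('a \<Rightarrow>\<^sub>L 'b) \<Rightarrow> bool" where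
  "has_sot_sum f I T \<longleftrightarrow> (\<forall>x. ((\<lambda>i. f i x) has_sum T x) I)"

definition spatial_tensor :: "('a::chilbert_space \<Rightarrow>\<^sub>L 'b::chilbert_space) set \<Rightarrow> ('c::chilbert_space \<Rightarrow>\<^sub>L 'd::chilbert_space) set
    \<Rightarrow> (('a, 'c) htensor \<Rightarrow>\<^sub>L ('b, 'd) htensor) set"  (infixr "\<otimes>\<^sub>m\<^sub>i\<^sub>n" 70) where
  "M \<otimes>\<^sub>m\<^sub>i\<^sub>n N = closure (cspan {a \<otimes>\<^sub>o b |a b. a \<in> M \<and> b \<in> N})"

section \<open>The noncommutative ball and free holomorphic functions\<close>

text \<open>The number of variables \<open>n \<in> {1, 2, \<dots>} \<union> {\<infinity>}\<close> is the cardinality of a countable index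
  type \<open>'n\<close> (types are nonempty). An \<open>n\<close>-tuple is a function on \<open>'n\<close>, and the free semigroup on
  \<open>n\<close> generators is \<open>'n list\<close>.\<close>

definition row_ball :: "('n \<Rightarrow> ('h::chilbert_space \<Rightarrow>\<^sub>L 'h)) set" where
  "row_ball = {X. range X \<subseteq> cops \<and>
     (\<exists>Q. has_sot_sum (\<lambda>i. X i o\<^sub>L adj (X i)) UNIV Q \<and> sqrt (norm Q) < 1)}"

primrec word_op :: "('n \<Rightarrow> ('h::chilbert_space \<Rightarrow>\<^sub>L 'h)) \<Rightarrow> 'n list \<Rightarrow> ('h \<Rightarrow>\<^sub>L 'h)" where
  "word_op X [] = id_blinfun"
| "word_op X (i # \<alpha>) = X i o\<^sub>L word_op X \<alpha>"

text \<open>\<open>fh_sums A X T\<close>: the power series with coefficient family \<open>A\<close>, evaluated at \<open>X\<close>,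
  has the value \<open>T\<close>. The homogeneous parts are summed in the strong operator topology (a finite
  sum for finite \<open>'n\<close>), the series of homogeneous parts in operator norm.\<close>

definition fh_sums :: "('n list \<Rightarrow> ('e::chilbert_space \<Rightarrow>\<^sub>L 'g::chilbert_space)) \<Rightarrow> ('n \<Rightarrow> ('k::chilbert_space \<Rightarrow>\<^sub>L 'k))
    \<Rightarrow> (('k, 'e) htensor \<Rightarrow>\<^sub>L ('k, 'g) htensor) \<Rightarrow> bool" where
  "fh_sums A X T \<longleftrightarrow> (\<exists>P. (\<forall>k. has_sot_sum (\<lambda>\<alpha>. word_op X \<alpha> \<otimes>\<^sub>o A \<alpha>) {\<alpha>. length \<alpha> = k} (P k)) \<and> P sums T)"

type_synonym ('n, 'h, 'e, 'g) ball_map =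
  "('n \<Rightarrow> ('h \<Rightarrow>\<^sub>L 'h)) \<Rightarrow> (('h, 'e) htensor \<Rightarrow>\<^sub>L ('h, 'g) htensor)"

text \<open>Only the restriction of a \<open>ball_map\<close> to \<open>row_ball\<close> is relevant.\<close>

definition fh_expansion :: "('n, 'h::chilbert_space, 'e::chilbert_space, 'g::chilbert_space) ball_map
    \<Rightarrow> ('n list \<Rightarrow> ('e \<Rightarrow>\<^sub>L 'g)) \<Rightarrow> bool" where
  "fh_expansion F A \<longleftrightarrow> range A \<subseteq> cops \<and> (\<forall>X\<in>row_ball. fh_sums A X (F X))"

definition free_holomorphic :: "('n, 'h::chilbert_space, 'e::chilbert_space, 'g::chilbert_space) ball_map \<Rightarrow> bool" where
  "free_holomorphic F \<longleftrightarrow> (\<exists>A. fh_expansion F A)"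

text \<open>For infinite-dimensional \<open>'h\<close> the coefficients are determined by \<open>F\<close>.\<close>

definition fh_coeff :: "('n, 'h::chilbert_space, 'e::chilbert_space, 'g::chilbert_space) ball_map
    \<Rightarrow> 'n list \<Rightarrow> ('e \<Rightarrow>\<^sub>L 'g)" where
  "fh_coeff F = (SOME A. fh_expansion F A)"

text \<open>Evaluation of the series of \<open>F\<close> at tuples on an arbitrary Hilbert space \<open>'k\<close>.\<close>

definition fh_eval :: "('n, 'h::chilbert_space, 'e::chilbert_space, 'g::chilbert_space) ball_map
    \<Rightarrow> ('n, 'k::chilbert_space, 'e, 'g) ball_map" where
  "fh_eval F X = (THE T. fh_sums (fh_coeff F) X T)"

definition fh_norm :: "('n, 'h::chilbert_space, 'e::chilbert_space, 'g::chilbert_space) ball_map \<Rightarrow> ereal" where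
  "fh_norm F = (SUP X\<in>row_ball. ereal (norm (F X)))"

definition fh_bounded :: "('n, 'h::chilbert_space, 'e::chilbert_space, 'g::chilbert_space) ball_map \<Rightarrow> bool" where
  "fh_bounded F \<longleftrightarrow> fh_norm F < \<infinity>"

section \<open>The Fock space, the noncommutative disc algebra and inner functions\<close>

text \<open>The full Fock space over a Hilbert space with orthonormal basis \<open>(e\<^sub>i)\<close>, in coordinates with
  respect to the orthonormal basis of all \<open>e\<^sub>i\<^sub>1 \<otimes> \<dots> \<otimes> e\<^sub>i\<^sub>k\<close>, indexed by the words
  \<open>[i\<^sub>1, \<dots>, i\<^sub>k]\<close>. Tensoring with \<open>e\<^sub>i\<close> from the left prepends the letter \<open>i\<close>.\<close>

type_synonym 'n fock = "('n list, complex) l2"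

lift_definition fock_shift :: "'n \<Rightarrow> 'n fock \<Rightarrow> 'n fock"
  is "\<lambda>i \<phi> w. case w of [] \<Rightarrow> 0 | j # u \<Rightarrow> if j = i then \<phi> u else 0"
proof -
  fix i :: 'n and \<phi> :: "'n list \<Rightarrow> complex"
  let ?g = "\<lambda>w. (norm (case w of [] \<Rightarrow> 0 | j # u \<Rightarrow> if j = i then \<phi> u else 0))\<^sup>2"
  assume "(\<lambda>u. (norm (\<phi> u))\<^sup>2) summable_on UNIV"
  then have "?g summable_on range (Cons i)"
    by (subst summable_on_reindex) (auto simp: o_def)
  then show "?g summable_on UNIV"
    by (rule summable_on_cong_neutral[THEN iffD1, rotated -1])
      (auto split: list.splits simp: image_iff)
qed

lemma norm_fock_shift: "norm (fock_shift i \<phi>) = norm \<phi>"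
proof -
  have "(norm (fock_shift i \<phi>))\<^sup>2 = (\<Sum>\<^sub>\<infinity>w\<in>range (Cons i). (norm (l2_nth (fock_shift i \<phi>) w))\<^sup>2)"
    unfolding norm_l2_sq
    by (rule infsum_cong_neutral) (auto simp: fock_shift.rep_eq image_iff split: list.splits)
  also have "\<dots> = (norm \<phi>)\<^sup>2"
    unfolding norm_l2_sq by (subst infsum_reindex) (auto simp: o_def fock_shift.rep_eq)
  finally show ?thesis by simp
qed

lift_definition creation :: "'n \<Rightarrow> ('n fock \<Rightarrow>\<^sub>L 'n fock)" is fock_shift
proof (rule bounded_linear_intro[where K=1])
  fix i :: 'n and \<phi> \<psi> :: "'n fock" and r :: real
  show "fock_shift i (\<phi> + \<psi>) = fock_shift i \<phi> + fock_shift i \<psi>"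
    by transfer (auto simp: fun_eq_iff split: list.splits)
  show "fock_shift i (r *\<^sub>R \<phi>) = r *\<^sub>R fock_shift i \<phi>"
    by transfer (auto simp: fun_eq_iff split: list.splits)
  show "norm (fock_shift i \<phi>) \<le> norm \<phi> * 1"
    by (simp add: norm_fock_shift)
qed

definition closed_algebra :: "('a::chilbert_space \<Rightarrow>\<^sub>L 'a) set \<Rightarrow> bool" where
  "closed_algebra M \<longleftrightarrow> closed M \<and> complex_vector.subspace M \<and> (\<forall>S\<in>M. \<forall>T\<in>M. S o\<^sub>L T \<in> M)"

definition disc_algebra :: "('n fock \<Rightarrow>\<^sub>L 'n fock) set" where
  "disc_algebra = closed_algebra hull (insert id_blinfun (range creation))"

definition has_boundary :: "('n, 'h::chilbert_space, 'e::chilbert_space, 'g::chilbert_space) ball_map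
    \<Rightarrow> (('n fock, 'e) htensor \<Rightarrow>\<^sub>L ('n fock, 'g) htensor) \<Rightarrow> bool" where
  "has_boundary F T \<longleftrightarrow> (\<forall>v. ((\<lambda>r. fh_eval F (\<lambda>i. r *\<^sub>R creation i) v) \<longlongrightarrow> T v) (at_left (1::real)))"

definition inner_fun :: "('n, 'h::chilbert_space, 'e::chilbert_space, 'g::chilbert_space) ball_map \<Rightarrow> bool" where
  "inner_fun F \<longleftrightarrow> fh_bounded F \<and> (\<exists>T. has_boundary F T \<and> isometry_op T)"

end

theory Submission
  imports Defs
begin

text \<open>Write \<open>S\<close> for the tuple of creation operators, \<open>f\<close>, \<open>\<theta>\<close>, \<open>g\<close> for the values of \<open>F\<close>, \<open>\<Theta>\<close>, \<open>G\<close> at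
\<open>r S\<close>, \<open>0 < r < 1\<close>, and \<open>F~\<close>, \<open>\<Theta>~\<close>, \<open>G~\<close> for the boundary functions. Once the boundary functions of
\<open>F\<close> and \<open>\<Theta>\<close> are known to be limits in operator norm, everything happens near the boundary: there \<open>\<theta>\<close>
is almost an isometry, so \<open>f = \<theta> g\<close> bounds \<open>g\<close>, and \<open>\<Theta>~\<^sup>* f - g = \<Theta>~\<^sup>* (\<theta> - \<Theta>~) g\<close> tends to 0. Hence
\<open>g\<close> converges in norm to \<open>G~ = \<Theta>~\<^sup>* F~\<close>, which is a contraction, and an isometry if \<open>F~\<close> is one, because
\<open>\<Theta>~ G~ = F~\<close>. The operator inequality is \<open>\<Theta>(X) (I - G(X) G(X)\<^sup>*) \<Theta>(X)\<^sup>* \<ge> 0\<close>.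

The four ingredients are the following.

\<^item> \<^bold>\<open>Passing from the ball to the Fock space.\<close> An infinite orthonormal set in the given space yields an
isometry \<open>W\<close> from the Fock space; \<open>W r S W\<^sup>*\<close> is a point of the ball whose compression is \<open>r S\<close>
(\<open>fock_model\<close>). So the series converge at \<open>r S\<close> and \<open>f = \<theta> g\<close> (\<open>fh_eval_fock\<close>, \<open>fh_eval_fock_mult\<close>).

\<^item> \<^bold>\<open>The noncommutative von Neumann inequality.\<close> The Poisson kernel of a strict row contraction \<open>X\<close> is
sliced into operators \<open>p\<^sub>d\<close> into the Fock space, one for each basis vector \<open>d\<close>, such that
\<open>X\<^sub>i p\<^sub>d\<^sup>* = p\<^sub>d\<^sup>* S\<^sub>i\<close> and \<open>\<Sum>\<^sub>d p\<^sub>d\<^sup>* p\<^sub>d = I\<close> (\<open>poisson_kernel\<close>). A power series inherits the intertwining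
relations, whence its norm at \<open>r X\<close> is at most its norm at \<open>r S\<close> (\<open>von_neumann_series\<close>). This
bounds \<open>G(X)\<close> by \<open>G~\<close>.

\<^item> \<^bold>\<open>Norm convergence to the boundary function.\<close> The spatial tensor product with the disc algebra is the
closure of the operator polynomials \<open>\<Sum> S\<^sub>\<alpha> \<otimes> D\<^sub>\<alpha>\<close> (\<open>spatial_tensor_disc_algebra\<close>). Subtracting a polynomial
close to \<open>F~\<close> and applying the von Neumann inequality, in the limit form
\<open>fock_series_norm_le_boundary\<close>, to the difference gives \<open>boundary_norm_limit\<close>.

\<^item> \<^bold>\<open>Membership of \<open>G~\<close>.\<close> With infinitely many variables the homogeneous parts of \<open>G\<close> are infinite sums and
not visibly limits of polynomials. But \<open>G~\<close> is a norm limit of operators \<open>C\<^sup>* D\<close> with polynomials \<open>C\<close>, \<open>D\<close>,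
and such an operator maps \<open>\<Omega> \<otimes> y\<close>, where \<open>\<Omega>\<close> is the vacuum vector, to a vector with finitely many nonzero
coordinates. As the norm of a homogeneous operator is the norm of its restriction to the vectors
\<open>\<Omega> \<otimes> y\<close> (\<open>norm_homogeneous_le_column\<close>), polynomials built from these coordinates approximate the
homogeneous parts of \<open>G\<close> (\<open>homogeneous_part_in_closure_polys\<close>).\<close>

section \<open>Inner products and series\<close>

lemma cinner_add_simps:
  fixes x :: "'a::chilbert_space"
  shows "cinner (x + y) z = cinner x z + cinner y z" "cinner z (x + y) = cinner z x + cinner z y"
    "cinner (c *\<^sub>C x) y = cnj c * cinner x y" "cinner x (c *\<^sub>C y) = c * cinner x y"
    "cinner (r *\<^sub>R x) y = r * cinner x y" "cinner x (r *\<^sub>R y) = r * cinner x y"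
  by (simp_all add: cinner_add_left cinner_add_right cinner_scaleC_left cinner_scaleC_right
      flip: scaleC_of_real)

lemma cinner_sum_left: "cinner (\<Sum>i\<in>I. f i) x = (\<Sum>i\<in>I. cinner (f i) (x::'a::chilbert_space))"
  by (induction I rule: infinite_finite_induct) (auto simp: cinner_simps cinner_add_left)

lemma cinner_ext:
  fixes y z :: "'a::chilbert_space"
  assumes "\<And>x. cinner x y = cinner x z"
  shows "y = z"
proof -
  have "cinner (y - z) (y - z) = 0" using assms by (simp add: cinner_simps)
  then show ?thesis by (simp add: cinner_self)
qed

lemma norm_sq_cinner: "(norm x)\<^sup>2 = Re (cinner x (x::'a::chilbert_space))"
  by (simp add: cinner_self)

lemma Re_cinner_le: "Re (cinner x y) \<le> norm x * norm (y::'a::chilbert_space)"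
  using norm_cauchy_schwarz[of x y] by (simp add: inner_eq_Re_cinner)

lemma bounded_linear_scaleC: "bounded_linear (\<lambda>x::'a::complex_normed_vector. c *\<^sub>C x)"
  by (rule bounded_linear_intro[where K="cmod c"])
    (auto simp: scaleC_add_right norm_scaleC scaleC_scaleC mult.commute simp flip: scaleC_of_real)

lemma tendsto_cinner_left:
  assumes "(f \<longlongrightarrow> l) F"
  shows "((\<lambda>x. cinner (f x) y) \<longlongrightarrow> cinner l (y::'a::chilbert_space)) F"
proof -
  have "((\<lambda>x. cnj (cinner y (f x))) \<longlongrightarrow> cnj (cinner y l)) F"
    by (intro tendsto_cnj bounded_linear.tendsto[OF bounded_linear_cinner_right] assms)
  then show ?thesis by (simp flip: cinner_commute)
qed

lemma has_sum_cinner_right: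
  "(f has_sum l) A \<Longrightarrow> ((\<lambda>i. cinner (y::'a::chilbert_space) (f i)) has_sum cinner y l) A"
  by (rule has_sum_bounded_linear[OF bounded_linear_cinner_right])

lemma has_sum_cinner_left:
  assumes "(f has_sum l) A"
  shows "((\<lambda>i. cinner (f i) (y::'a::chilbert_space)) has_sum cinner l y) A"
  using tendsto_cinner_left[OF assms[unfolded has_sum_def], of y]
  unfolding has_sum_def by (simp add: cinner_sum_left)

section \<open>Orthogonal series and the Riesz representation theorem\<close>

text \<open>In a Hilbert space a series of orthogonal vectors converges unordered as soon as its squared norms
are summable, although it need not converge absolutely: the bound makes the finite partial sums a
Cauchy net.\<close>

lemma summable_on_norm_sq_bound:
  fixes f :: "'i \<Rightarrow> 'a::banach" and g :: "'i \<Rightarrow> real"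
  assumes bound: "\<And>J. finite J \<Longrightarrow> J \<subseteq> A \<Longrightarrow> (norm (sum f J))\<^sup>2 \<le> sum g J"
    and g: "g summable_on A"
  shows "f summable_on A"
proof -
  obtain L where L: "(g has_sum L) A" using g by (auto simp: summable_on_def)
  have "\<exists>P. eventually P (finite_subsets_at_top A) \<and>
      (\<forall>F F'. P F \<and> P F' \<longrightarrow> dist (sum f F) (sum f F') < e)" if "e > 0" for e
  proof -
    have "\<forall>\<^sub>F F in finite_subsets_at_top A. dist (sum g F) L < e\<^sup>2 / 8"
      using tendstoD[OF L[unfolded has_sum_def], of "e\<^sup>2 / 8"] \<open>e > 0\<close> by simp
    then obtain J where J: "finite J" "J \<subseteq> A"
      and *: "\<forall>F. finite F \<and> J \<subseteq> F \<and> F \<subseteq> A \<longrightarrow> dist (sum g F) L < e\<^sup>2 / 8"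
      unfolding eventually_finite_subsets_at_top by (elim exE conjE) (rule that)
    then have L_near: "\<bar>sum g F - L\<bar> < e\<^sup>2 / 8" if "finite F" "J \<subseteq> F" "F \<subseteq> A" for F
      using that by (simp add: dist_real_def)
    define P where "P F \<longleftrightarrow> finite F \<and> J \<subseteq> F \<and> F \<subseteq> A" for F
    have near: "norm (sum f F - sum f J) < e / 2" if "P F" for F
    proof -
      have F: "finite F" "J \<subseteq> F" "F \<subseteq> A" using that by (auto simp: P_def)
      have "(norm (sum f F - sum f J))\<^sup>2 = (norm (sum f (F - J)))\<^sup>2"
        using F by (simp add: sum_diff)
      also have "\<dots> \<le> sum g (F - J)" using F by (intro bound) auto
      also have "\<dots> = sum g F - sum g J" using F by (simp add: sum_diff)
      also have "\<dots> < (e / 2)\<^sup>2"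
        using abs_less_iff[THEN iffD1, OF L_near[OF F]] abs_less_iff[THEN iffD1, OF L_near[OF J(1) order_refl J(2)]]
        by (simp add: power_divide)
      finally show ?thesis using \<open>e > 0\<close> by (intro power_less_imp_less_base[of _ 2 "e/2"]) auto
    qed
    have "dist (sum f F) (sum f F') < e" if "P F" "P F'" for F F'
      using norm_triangle_ineq4[of "sum f F - sum f J" "sum f F' - sum f J"]
        near[OF that(1)] near[OF that(2)] by (simp add: dist_norm)
    moreover have "eventually P (finite_subsets_at_top A)"
      unfolding eventually_finite_subsets_at_top P_def using J by blast
    ultimately show ?thesis by blast
  qed
  then have "cauchy_filter (filtermap (sum f) (finite_subsets_at_top A))"
    by (simp add: cauchy_filter_metric_filtermap)
  moreover have "complete (UNIV :: 'a set)"
    by (meson Cauchy_convergent UNIV_I complete_def convergent_def)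
  ultimately obtain L' where "(sum f \<longlongrightarrow> L') (finite_subsets_at_top A)"
    using complete_uniform[where S=UNIV] by (force simp add: filterlim_def)
  then show ?thesis using summable_on_def has_sum_def by blast
qed

lemma norm_sq_sum_orthogonal:
  fixes f :: "'i \<Rightarrow> 'a::real_inner"
  assumes "\<And>i k. i \<in> J \<Longrightarrow> k \<in> J \<Longrightarrow> i \<noteq> k \<Longrightarrow> inner (f i) (f k) = 0" "finite J"
  shows "(norm (sum f J))\<^sup>2 = (\<Sum>i\<in>J. (norm (f i))\<^sup>2)"
  using assms(2,1)
proof (induction rule: finite_induct)
  case (insert i J)
  have "orthogonal (f i) (sum f J)"
    unfolding orthogonal_def inner_sum_right using insert by (intro sum.neutral) auto
  then show ?case using insert by (simp add: norm_add_Pythagorean)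
qed simp

lemma has_sum_norm_sq_orthogonal:
  fixes f :: "'i \<Rightarrow> 'a::real_inner"
  assumes "\<And>i k. i \<in> A \<Longrightarrow> k \<in> A \<Longrightarrow> i \<noteq> k \<Longrightarrow> inner (f i) (f k) = 0" "(f has_sum t) A"
  shows "((\<lambda>i. (norm (f i))\<^sup>2) has_sum (norm t)\<^sup>2) A"
proof -
  have "((\<lambda>J. (norm (sum f J))\<^sup>2) \<longlongrightarrow> (norm t)\<^sup>2) (finite_subsets_at_top A)"
    using assms(2) unfolding has_sum_def by (intro tendsto_intros)
  moreover have "\<forall>\<^sub>F J in finite_subsets_at_top A. (norm (sum f J))\<^sup>2 = (\<Sum>i\<in>J. (norm (f i))\<^sup>2)"
    by (rule eventually_finite_subsets_at_top_weakI)
      (intro norm_sq_sum_orthogonal, use assms(1) in blast)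
  ultimately show ?thesis unfolding has_sum_def by (rule Lim_transform_eventually)
qed

text \<open>The representing vector is \<open>\<Sum>\<^sub>b cnj (f b) b\<close> over an orthonormal basis. Evaluating \<open>f\<close> at a finite partial
sum \<open>v\<close> gives \<open>\<parallel>v\<parallel>\<^sup>2 \<le> K \<parallel>v\<parallel>\<close>, so the squared coefficients are summable.\<close>

lemma riesz_representation:
  fixes f :: "'a::chilbert_space \<Rightarrow> complex"
  assumes f: "bounded_linear f" and fC: "\<And>c x. f (c *\<^sub>C x) = c * f x"
  shows "\<exists>z. \<forall>x. f x = cinner z x"
proof -
  interpret f: bounded_linear f by (rule f)
  obtain K where K: "K > 0" "\<And>x. norm (f x) \<le> norm x * K" using f.pos_bounded by blast
  let ?B = "some_onb :: 'a set" and ?v = "\<lambda>b. cnj (f b) *\<^sub>C b"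
  have B: "\<And>b c. b \<in> ?B \<Longrightarrow> c \<in> ?B \<Longrightarrow> cinner b c = (if b = c then 1 else 0)"
    using some_onb[where 'a='a] by (auto simp: is_onb_def orthonormal_def)
  have nv: "norm (?v b) = cmod (f b)" if "b \<in> ?B" for b
  proof -
    have "(norm b)\<^sup>2 = 1" unfolding norm_sq_cinner using B[OF that that] by simp
    then show ?thesis using norm_ge_zero[of b] by (auto simp: norm_scaleC power2_eq_1_iff)
  qed
  have orth: "inner (?v b) (?v c) = 0" if "b \<in> ?B" "c \<in> ?B" "b \<noteq> c" for b c
    unfolding inner_eq_Re_cinner using B[OF that(1,2)] that
    by (simp add: cinner_add_simps)
  have nsum: "(norm (sum ?v J))\<^sup>2 = (\<Sum>b\<in>J. (cmod (f b))\<^sup>2)" if "finite J" "J \<subseteq> ?B" for J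
  proof -
    have "(norm (sum ?v J))\<^sup>2 = (\<Sum>b\<in>J. (norm (?v b))\<^sup>2)"
      using that orth by (intro norm_sq_sum_orthogonal) blast+
    also have "\<dots> = (\<Sum>b\<in>J. (cmod (f b))\<^sup>2)"
      using that nv by (intro sum.cong) auto
    finally show ?thesis .
  qed
  have bound: "(\<Sum>b\<in>J. (cmod (f b))\<^sup>2) \<le> K\<^sup>2" if J: "finite J" "J \<subseteq> ?B" for J
  proof -
    let ?s = "\<Sum>b\<in>J. (cmod (f b))\<^sup>2"
    have s0: "?s \<ge> 0" by (simp add: sum_nonneg)
    have "f (sum ?v J) = (\<Sum>b\<in>J. cnj (f b) * f b)" by (simp add: f.sum fC)
    also have "\<dots> = complex_of_real ?s"
      unfolding of_real_sum by (intro sum.cong refl) (simp only: complex_norm_square mult.commute)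
    finally have "cmod (f (sum ?v J)) = ?s" using s0 by (simp only: norm_of_real abs_of_nonneg)
    with K(2)[of "sum ?v J"] have "?s \<le> norm (sum ?v J) * K" by simp
    then have "?s\<^sup>2 \<le> (norm (sum ?v J) * K)\<^sup>2" using s0 by (rule power_mono)
    also have "\<dots> = ?s * K\<^sup>2" unfolding power_mult_distrib nsum[OF J] ..
    finally have "?s * ?s \<le> ?s * K\<^sup>2" by (simp add: power2_eq_square)
    then show ?thesis using s0 zero_le_power2[of K]
      by (cases "?s = 0") (linarith | metis mult_left_le_imp_le order_le_less)+
  qed
  have "(\<lambda>b. (cmod (f b))\<^sup>2) summable_on ?B"
    by (intro nonneg_bdd_above_summable_on bdd_aboveI2[where M="K\<^sup>2"]) (auto intro: bound)
  then have "?v summable_on ?B"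
    by (rule summable_on_norm_sq_bound[rotated]) (simp add: nsum)
  then obtain z where z: "(?v has_sum z) ?B" by (auto simp: summable_on_def)
  have zb: "cinner z b = f b" if b: "b \<in> ?B" for b
  proof -
    have "((\<lambda>c. cinner (?v c) b) has_sum cinner z b) ?B" by (rule has_sum_cinner_left[OF z])
    moreover have "((\<lambda>c. cinner (?v c) b) has_sum f b) ?B"
      using B b by (intro has_sum_finite_neutralI[of "{b}"]) (auto simp: cinner_add_simps)
    ultimately show ?thesis by (rule has_sum_unique)
  qed
  have "f x = cinner z x" for x
  proof -
    have x: "((\<lambda>b. cinner b x *\<^sub>C b) has_sum x) ?B" by (rule onb_expansion[OF some_onb])
    have "((\<lambda>b. f (cinner b x *\<^sub>C b)) has_sum f x) ?B" by (rule has_sum_bounded_linear[OF f x])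
    moreover have "((\<lambda>b. cinner z (cinner b x *\<^sub>C b)) has_sum cinner z x) ?B"
      by (rule has_sum_cinner_right[OF x])
    then have "((\<lambda>b. f (cinner b x *\<^sub>C b)) has_sum cinner z x) ?B"
      by (rule has_sum_cong[THEN iffD1, rotated]) (simp add: cinner_add_simps fC zb)
    ultimately show ?thesis by (rule has_sum_unique)
  qed
  then show ?thesis by blast
qed

section \<open>Complex-linear operators and adjoints\<close>

lemma copsD: "T \<in> cops \<Longrightarrow> T (c *\<^sub>C x) = c *\<^sub>C T x"
  by (simp add: cops_def)

lemma cops_id [simp]: "id_blinfun \<in> cops" by (simp add: cops_def)
lemma cops_zero [simp]: "0 \<in> cops" by (simp add: cops_def)
lemma cops_compose: "S \<in> cops \<Longrightarrow> T \<in> cops \<Longrightarrow> S o\<^sub>L T \<in> cops" by (simp add: cops_def)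
lemma cops_add: "S \<in> cops \<Longrightarrow> T \<in> cops \<Longrightarrow> S + T \<in> cops"
  by (simp add: cops_def blinfun.add_left scaleC_add_right)
lemma cops_diff: "S \<in> cops \<Longrightarrow> T \<in> cops \<Longrightarrow> S - T \<in> cops"
  by (simp add: cops_def blinfun.diff_left complex_vector.scale_right_diff_distrib)
lemma cops_scaleC: "T \<in> cops \<Longrightarrow> c *\<^sub>C T \<in> cops"
  by (simp add: cops_def scaleC_blinfun.rep_eq scaleC_scaleC mult.commute)
lemma cops_scaleR: "T \<in> cops \<Longrightarrow> r *\<^sub>R T \<in> cops"
  using cops_scaleC[of T "complex_of_real r"] by (simp add: scaleC_of_real)

lemma cops_tendsto:
  fixes T :: "'i \<Rightarrow> ('a::chilbert_space \<Rightarrow>\<^sub>L 'b::chilbert_space)" and T' :: "'a \<Rightarrow>\<^sub>L 'b"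
  assumes "\<And>v. ((\<lambda>i. T i v) \<longlongrightarrow> T' v) F" "F \<noteq> bot" "\<forall>\<^sub>F i in F. T i \<in> cops"
  shows "T' \<in> cops"
  unfolding cops_def
proof (intro CollectI allI)
  fix c x
  have "((\<lambda>i. c *\<^sub>C T i x) \<longlongrightarrow> c *\<^sub>C T' x) F"
    by (rule bounded_linear.tendsto[OF bounded_linear_scaleC assms(1)])
  then have "((\<lambda>i. T i (c *\<^sub>C x)) \<longlongrightarrow> c *\<^sub>C T' x) F"
    by (rule Lim_transform_eventually) (use assms(3) in eventually_elim, simp add: copsD)
  then show "T' (c *\<^sub>C x) = c *\<^sub>C T' x"
    using assms(1,2) tendsto_unique by blast
qed

lemma cops_sum: "(\<And>i. i \<in> I \<Longrightarrow> T i \<in> cops) \<Longrightarrow> (\<Sum>i\<in>I. T i) \<in> cops"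
  by (induction I rule: infinite_finite_induct) (auto simp: cops_add)

lemma blinfun_sum_left: "blinfun_apply (\<Sum>i\<in>I. T i) x = (\<Sum>i\<in>I. blinfun_apply (T i) x)"
  by (induction I rule: infinite_finite_induct) (auto simp: blinfun.add_left)

lemma cops_has_sum:
  fixes T :: "'i \<Rightarrow> ('a::chilbert_space \<Rightarrow>\<^sub>L 'b::chilbert_space)" and T' :: "'a \<Rightarrow>\<^sub>L 'b"
  assumes "\<And>v. ((\<lambda>i. T i v) has_sum T' v) A" "\<And>i. i \<in> A \<Longrightarrow> T i \<in> cops"
  shows "T' \<in> cops"
proof (rule cops_tendsto)
  show "((\<lambda>J. (\<Sum>i\<in>J. T i) v) \<longlongrightarrow> T' v) (finite_subsets_at_top A)" for v
    using assms(1)[of v] unfolding has_sum_def by (simp add: blinfun_sum_left)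
  show "\<forall>\<^sub>F J in finite_subsets_at_top A. (\<Sum>i\<in>J. T i) \<in> cops"
    by (intro eventually_finite_subsets_at_top_weakI cops_sum) (use assms(2) in blast)
qed simp

lemma cops_closed: "closed (cops :: ('a::chilbert_space \<Rightarrow>\<^sub>L 'b::chilbert_space) set)"
  unfolding closed_sequential_limits
proof (intro allI impI, elim conjE)
  fix x :: "nat \<Rightarrow> 'a \<Rightarrow>\<^sub>L 'b" and l assume x: "\<forall>n. x n \<in> cops" and l: "x \<longlonglongrightarrow> l"
  show "l \<in> cops"
    by (rule cops_tendsto[where F=sequentially and T=x]) (use x l in \<open>auto intro!: blinfun.tendsto\<close>)
qed

lemma cops_subspace: "complex_vector.subspace cops"
  unfolding complex_vector.subspace_def by (auto intro: cops_add cops_scaleC)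

text \<open>Real linearity and boundedness follow from complex linearity and the norm estimate, so these three
conditions suffice to define a complex-linear operator.\<close>

lemma clinear_blinfun_exists:
  assumes add: "\<And>x y. f (x + y) = f x + f y" and scale: "\<And>c x. f (c *\<^sub>C x) = c *\<^sub>C f x"
    and bound: "\<And>x. norm (f x) \<le> K * norm x"
  shows "\<exists>T::'a::chilbert_space \<Rightarrow>\<^sub>L 'b::chilbert_space. T \<in> cops \<and> (\<forall>x. T x = f x)"
proof -
  have "bounded_linear f"
    by (rule bounded_linear_intro[where K=K])
      (auto simp: add bound mult.commute[of _ K] simp flip: scaleC_of_real simp: scale)
  then have "blinfun_apply (Blinfun f) = f" by (rule bounded_linear_Blinfun_apply)
  then show ?thesis using scale by (intro exI[of _ "Blinfun f"]) (auto simp: cops_def)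
qed

lemma adjoint_exists:
  fixes T :: "'a::chilbert_space \<Rightarrow>\<^sub>L 'b::chilbert_space"
  assumes T: "T \<in> cops"
  shows "\<exists>S\<in>cops. \<forall>x y. cinner (T x) y = cinner x (S y)"
proof -
  have "\<exists>z. \<forall>x. cinner (T x) y = cinner x z" for y
  proof -
    have "\<exists>z. \<forall>x. cinner y (T x) = cinner z x"
    proof (rule riesz_representation)
      show "bounded_linear (\<lambda>x. cinner y (T x))"
        by (rule bounded_linear_compose[OF bounded_linear_cinner_right blinfun.bounded_linear_right])
      show "cinner y (T (c *\<^sub>C x)) = c * cinner y (T x)" for c x
        by (simp add: copsD[OF T] cinner_add_simps)
    qed
    then obtain z where z: "\<And>x. cinner y (T x) = cinner z x" by blast
    have "cinner (T x) y = cinner x z" for x by (metis cinner_commute z)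
    then show ?thesis by blast
  qed
  then obtain f where f: "\<And>x y. cinner (T x) y = cinner x (f y)" by metis
  have "norm (f y) \<le> norm T * norm y" for y
  proof -
    have "(norm (f y))\<^sup>2 = Re (cinner (T (f y)) y)" by (simp add: norm_sq_cinner f)
    also have "\<dots> \<le> norm (T (f y)) * norm y"
      by (rule Re_cinner_le)
    also have "\<dots> \<le> (norm T * norm (f y)) * norm y"
      by (intro mult_right_mono norm_blinfun) auto
    finally show ?thesis
      by (cases "f y = 0") (auto simp: power2_eq_square mult.assoc mult.left_commute[of "norm T"])
  qed
  moreover have "f (x + y) = f x + f y" for x y
    by (rule cinner_ext) (simp add: cinner_add_simps flip: f)
  moreover have "f (c *\<^sub>C x) = c *\<^sub>C f x" for c x
    by (rule cinner_ext) (simp add: cinner_add_simps flip: f)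
  ultimately obtain S where "S \<in> cops" "\<And>x. blinfun_apply S x = f x"
    using clinear_blinfun_exists[of f "norm T"] by blast
  then show ?thesis by (intro bexI[of _ S]) (simp_all add: f)
qed

text \<open>The adjoint is a definite description, so every computation of an adjoint goes through this rule.\<close>

lemma adj_unique:
  fixes T :: "'a::chilbert_space \<Rightarrow>\<^sub>L 'b::chilbert_space" and S :: "'b \<Rightarrow>\<^sub>L 'a"
  assumes "\<And>x y. cinner (T x) y = cinner x (S y)"
  shows "adj T = S"
  unfolding adj_def
proof (rule the_equality)
  fix S' assume "\<forall>x y. cinner (T x) y = cinner x (blinfun_apply S' y)"
  then have "cinner x (S' y) = cinner x (S y)" for x y by (simp flip: assms)
  then have "blinfun_apply S' y = S y" for y by (rule cinner_ext)
  then show "S' = S" by (rule blinfun_eqI)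
qed (simp add: assms)

lemma cinner_adj_right: "T \<in> cops \<Longrightarrow> cinner x (adj T y) = cinner (T x) y"
  using adjoint_exists[of T] adj_unique[of T] by metis

lemma cinner_adj_left: "T \<in> cops \<Longrightarrow> cinner (adj T y) x = cinner y (T x)"
  by (metis cinner_adj_right cinner_commute)

lemma adj_cops [simp]: "T \<in> cops \<Longrightarrow> adj T \<in> cops"
  using adjoint_exists[of T] adj_unique[of T] by metis

lemma adj_adj: "T \<in> cops \<Longrightarrow> adj (adj T) = T"
  by (rule adj_unique) (simp add: cinner_adj_left)

lemma adj_id: "adj id_blinfun = id_blinfun"
  by (rule adj_unique) simp

lemma adj_compose: "S \<in> cops \<Longrightarrow> T \<in> cops \<Longrightarrow> adj (S o\<^sub>L T) = adj T o\<^sub>L adj S"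
  by (rule adj_unique) (simp add: cinner_adj_right)

lemma adj_scaleR: "T \<in> cops \<Longrightarrow> adj (r *\<^sub>R T) = r *\<^sub>R adj T"
  by (rule adj_unique) (simp add: cinner_adj_right cinner_add_simps blinfun.scaleR_left)

lemma adj_diff: "S \<in> cops \<Longrightarrow> T \<in> cops \<Longrightarrow> adj (S - T) = adj S - adj T"
  by (rule adj_unique) (simp add: cinner_adj_right cinner_simps blinfun.diff_left)

lemma norm_adj_le:
  assumes T: "T \<in> cops"
  shows "norm (adj T) \<le> norm T"
proof (rule norm_blinfun_bound)
  fix y
  have "(norm (adj T y))\<^sup>2 = Re (cinner (T (adj T y)) y)" 
    by (simp add: norm_sq_cinner cinner_adj_right T)
  also have "\<dots> \<le> norm (T (adj T y)) * norm y"
    by (rule Re_cinner_le)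
  also have "\<dots> \<le> (norm T * norm (adj T y)) * norm y"
    by (intro mult_right_mono norm_blinfun) auto
  finally show "norm (adj T y) \<le> norm T * norm y"
    by (cases "adj T y = 0") (auto simp: power2_eq_square mult.assoc mult.left_commute[of "norm T"])
qed simp

lemma norm_adj: "T \<in> cops \<Longrightarrow> norm (adj T) = norm T"
  by (metis norm_adj_le adj_adj adj_cops antisym)

lemma cinner_polar: "cinner x y = Complex (inner x y) (inner (\<i> *\<^sub>C x) (y::'a::chilbert_space))"
  by (rule complex_eqI) (simp_all add: inner_eq_Re_cinner cinner_add_simps)

text \<open>By polarization; the imaginary part of the complex inner product is a real inner product with
\<open>\<i> x\<close>.\<close>

lemma isometry_cinner:
  fixes T :: "'a::chilbert_space \<Rightarrow>\<^sub>L 'b::chilbert_space"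
  assumes T: "T \<in> cops" and iso: "isometry_op T"
  shows "cinner (T x) (T y) = cinner x y"
proof -
  have "inner (T x) (T y) = inner x y" for x y
    using iso norm_add_Pythagorean[of x y]
    unfolding isometry_op_def dot_norm by (simp flip: blinfun.add_right)
  then show ?thesis by (simp add: cinner_polar[of x] cinner_polar[of "T x"] flip: copsD[OF T])
qed

lemma adj_isometry:
  fixes T :: "'a::chilbert_space \<Rightarrow>\<^sub>L 'b::chilbert_space"
  assumes "T \<in> cops" "isometry_op T"
  shows "adj T (T x) = x"
  by (rule cinner_ext) (simp add: cinner_adj_right isometry_cinner assms)

text \<open>With the complex scalar multiplication the operators form a complex normed space, which makes closures
of complex subspaces available for operators as well as for vectors.\<close>

lemma norm_scaleC_blinfun_le:
  fixes T :: "'a::real_normed_vector \<Rightarrow>\<^sub>L 'b::complex_normed_vector"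
  shows "norm (c *\<^sub>C T) \<le> cmod c * norm T"
proof (rule norm_blinfun_bound)
  show "norm ((c *\<^sub>C T) x) \<le> cmod c * norm T * norm x" for x
    using mult_left_mono[OF norm_blinfun[of T x], of "cmod c"]
    by (simp add: scaleC_blinfun.rep_eq norm_scaleC mult.assoc)
qed simp

instance blinfun :: (real_normed_vector, complex_normed_vector) complex_normed_vector
proof
  fix c and T :: "'a \<Rightarrow>\<^sub>L 'b"
  show "norm (c *\<^sub>C T) = cmod c * norm T"
  proof (cases "c = 0")
    case False
    have "norm T = norm (inverse c *\<^sub>C c *\<^sub>C T)" using False by (simp add: scaleC_scaleC)
    also have "\<dots> \<le> cmod (inverse c) * norm (c *\<^sub>C T)" by (rule norm_scaleC_blinfun_le)
    finally have "cmod c * norm T \<le> cmod c * (cmod (inverse c) * norm (c *\<^sub>C T))"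
      by (rule mult_left_mono) simp
    also have "\<dots> = norm (c *\<^sub>C T)" using False by (simp add: norm_inverse)
    finally have "cmod c * norm T \<le> norm (c *\<^sub>C T)" .
    then show ?thesis using norm_scaleC_blinfun_le[of c T] by linarith
  qed simp
qed

section \<open>Families of isometries with orthogonal ranges\<close>

text \<open>An orthonormal family of embeddings \<open>J\<^sub>i\<close> of a common space, that is \<open>J\<^sub>i\<^sup>* J\<^sub>k = \<delta>\<^sub>i\<^sub>k I\<close>. Orthonormal vectors
(embedding the scalars), the creation operators, and tensoring with the members of an orthonormal
set are all of this kind.\<close>

definition isom_family :: "'i set \<Rightarrow> ('i \<Rightarrow> ('a::chilbert_space \<Rightarrow>\<^sub>L 'b::chilbert_space)) \<Rightarrow> bool" where
  "isom_family I J \<longleftrightarrow> (\<forall>i\<in>I. J i \<in> cops) \<and>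
    (\<forall>i\<in>I. \<forall>k\<in>I. \<forall>x y. cinner (J i x) (J k y) = (if i = k then cinner x y else 0))"

lemma isom_familyD:
  assumes "isom_family I J" "i \<in> I"
  shows "J i \<in> cops" "k \<in> I \<Longrightarrow> cinner (J i x) (J k y) = (if i = k then cinner x y else 0)"
    "norm (J i x) = norm x" "k \<in> I \<Longrightarrow> adj (J i) (J k y) = (if i = k then y else 0)"
    "k \<in> I \<Longrightarrow> i \<noteq> k \<Longrightarrow> inner (J i x) (J k z) = 0"
proof -
  have o: "cinner (J i x) (J k y) = (if i = k then cinner x y else 0)" if "k \<in> I" for k x y
    using assms that by (auto simp: isom_family_def)
  show c: "J i \<in> cops" using assms by (auto simp: isom_family_def)
  show "cinner (J i x) (J k y) = (if i = k then cinner x y else 0)" if "k \<in> I"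
    by (rule o[OF that])
  have "(norm (J i x))\<^sup>2 = (norm x)\<^sup>2" unfolding norm_sq_cinner using o[OF assms(2)] by simp
  then show "norm (J i x) = norm x" by simp
  show "adj (J i) (J k y) = (if i = k then y else 0)" if "k \<in> I"
    by (rule cinner_ext) (simp add: cinner_adj_right c assms(2) o that cinner_simps)
  show "inner (J i x) (J k z) = 0" if "k \<in> I" "i \<noteq> k"
    unfolding inner_eq_Re_cinner using o that by simp
qed

text \<open>The projection onto the span of finitely many ranges is a contraction because
\<open>\<parallel>P t\<parallel>\<^sup>2 = \<langle>t, P t\<rangle> \<le> \<parallel>t\<parallel> \<parallel>P t\<parallel>\<close>.\<close>

lemma isom_family_bessel:
  assumes J: "isom_family I J" and F: "finite F" "F \<subseteq> I"
  shows "(norm (\<Sum>i\<in>F. J i (adj (J i) t)))\<^sup>2 = (\<Sum>i\<in>F. (norm (adj (J i) t))\<^sup>2)"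
    "(\<Sum>i\<in>F. (norm (adj (J i) t))\<^sup>2) \<le> (norm t)\<^sup>2"
    "norm (\<Sum>i\<in>F. J i (adj (J i) t)) \<le> norm t"
proof -
  let ?p = "\<Sum>i\<in>F. J i (adj (J i) t)" and ?s = "\<Sum>i\<in>F. (norm (adj (J i) t))\<^sup>2"
  have n: "norm (J i x) = norm x" if "i \<in> F" for i x
    using isom_familyD(3)[OF J] F(2) that by blast
  have "inner (J i (adj (J i) t)) (J k (adj (J k) t)) = 0" if "i \<in> F" "k \<in> F" "i \<noteq> k" for i k
    using isom_familyD(5)[OF J] F(2) that by blast
  from norm_sq_sum_orthogonal[OF this F(1)]
  show 1: "(norm ?p)\<^sup>2 = ?s" by (simp add: n)
  have "inner t (J i (adj (J i) t)) = (norm (adj (J i) t))\<^sup>2" if "i \<in> F" for i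
    using that F isom_familyD(1)[OF J]
    by (auto simp: inner_eq_Re_cinner norm_sq_cinner cinner_adj_left)
  then have "?s = inner t ?p" by (simp add: inner_sum_right)
  also have "\<dots> \<le> norm t * norm ?p" by (rule norm_cauchy_schwarz)
  finally have "norm ?p * norm ?p \<le> norm t * norm ?p"
    using 1 by (simp add: power2_eq_square)
  then show 3: "norm ?p \<le> norm t" by (cases "norm ?p = 0") (auto simp: mult_le_cancel_right)
  show "?s \<le> (norm t)\<^sup>2" unfolding 1[symmetric] using 3 by (intro power_mono) auto
qed

lemma isom_family_summable:
  assumes J: "isom_family I J"
  shows "(\<lambda>i. (norm (adj (J i) t))\<^sup>2) summable_on I" "(\<Sum>\<^sub>\<infinity>i\<in>I. (norm (adj (J i) t))\<^sup>2) \<le> (norm t)\<^sup>2"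
proof -
  show "(\<lambda>i. (norm (adj (J i) t))\<^sup>2) summable_on I"
    by (intro nonneg_bdd_above_summable_on bdd_aboveI2[where M="(norm t)\<^sup>2"])
      (auto intro: isom_family_bessel(2)[OF J])
  then show "(\<Sum>\<^sub>\<infinity>i\<in>I. (norm (adj (J i) t))\<^sup>2) \<le> (norm t)\<^sup>2"
    by (intro infsum_le_finite_sums) (auto intro: isom_family_bessel(2)[OF J])
qed

text \<open>The finite partial sums are contractions that eventually fix every element of the span of the
ranges; hence they converge to the identity on its closure.\<close>

lemma isom_family_expansion:
  assumes J: "isom_family I J" and t: "t \<in> closure (cspan (\<Union>i\<in>I. range (J i)))"
  shows "((\<lambda>i. J i (adj (J i) t)) has_sum t) I" "((\<lambda>i. (norm (adj (J i) t))\<^sup>2) has_sum (norm t)\<^sup>2) I"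
proof -
  let ?P = "\<lambda>G t. \<Sum>i\<in>G. J i (adj (J i) t)"
  \<comment> \<open>Partial sums fix y from the finite index set F on.\<close>
  define stable where "stable y F \<longleftrightarrow> finite F \<and> F \<subseteq> I \<and>
      (\<forall>G. finite G \<longrightarrow> F \<subseteq> G \<longrightarrow> G \<subseteq> I \<longrightarrow> ?P G y = y)" for y F
  have fixed: "\<exists>F. stable y F"
    if "y \<in> cspan (\<Union>i\<in>I. range (J i))" for y
    using that
  proof (induction rule: complex_vector.span_induct_alt)
    case base
    have "stable 0 {}" by (auto simp: stable_def blinfun.zero_right)
    then show ?case ..
  next
    case (step c x y)
    obtain k z where k: "k \<in> I" "x = J k z" using step(1) by auto
    obtain F where "stable y F" using step.IH by (rule exE)
    then have F: "finite F" "F \<subseteq> I" "\<And>G. finite G \<Longrightarrow> F \<subseteq> G \<Longrightarrow> G \<subseteq> I \<Longrightarrow> ?P G y = y"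
      by (simp_all add: stable_def)
    have "?P G (c *\<^sub>C x + y) = c *\<^sub>C x + y" if G: "finite G" "insert k F \<subseteq> G" "G \<subseteq> I" for G
    proof -
      have "J i (adj (J i) (c *\<^sub>C x + y)) = c *\<^sub>C J i (adj (J i) x) + J i (adj (J i) y)" if "i \<in> G" for i
        using isom_familyD(1)[OF J, of i] that G by (auto simp: blinfun.add_right copsD)
      moreover have "?P G x = (\<Sum>i\<in>G. if i = k then x else 0)"
        using isom_familyD(4)[OF J] G k by (intro sum.cong) (auto simp: blinfun.zero_right)
      ultimately show ?thesis using G F(3)[of G]
        by (simp add: sum.distrib complex_vector.scale_sum_right[symmetric])
    qed
    then have "stable (c *\<^sub>C x + y) (insert k F)" using k F by (simp add: stable_def)
    then show ?case ..
  qed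
  show "((\<lambda>i. J i (adj (J i) t)) has_sum t) I"
    unfolding has_sum_def
  proof (rule tendstoI)
    fix e :: real assume "0 < e"
    then obtain y where y: "y \<in> cspan (\<Union>i\<in>I. range (J i))" "dist y t < e / 2"
      using t closure_approachable half_gt_zero by metis
    then obtain F where "stable y F" using fixed by blast
    then have F: "finite F" "F \<subseteq> I" "\<And>G. finite G \<Longrightarrow> F \<subseteq> G \<Longrightarrow> G \<subseteq> I \<Longrightarrow> ?P G y = y"
      by (simp_all add: stable_def)
    have "dist (?P G t) t < e" if G: "finite G" "F \<subseteq> G" "G \<subseteq> I" for G
    proof -
      have eq: "?P G t - t = ?P G (t - y) + (y - t)"
        using F(3)[OF G] by (simp add: blinfun.diff_right sum_subtractf)
      have "norm (?P G t - t) \<le> norm (?P G (t - y)) + norm (y - t)"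
        unfolding eq by (rule norm_triangle_ineq)
      also have "\<dots> \<le> norm (t - y) + norm (y - t)"
        by (rule add_right_mono[OF isom_family_bessel(3)[OF J G(1,3)]])
      finally have "norm (?P G t - t) \<le> norm (t - y) + norm (y - t)" .
      then show ?thesis using y by (simp add: dist_norm norm_minus_commute)
    qed
    then show "\<forall>\<^sub>F G in finite_subsets_at_top I. dist (?P G t) t < e"
      unfolding eventually_finite_subsets_at_top using F by blast
  qed
  from has_sum_norm_sq_orthogonal[OF _ this] 
  have "((\<lambda>i. (norm (J i (adj (J i) t)))\<^sup>2) has_sum (norm t)\<^sup>2) I"
    using isom_familyD(5)[OF J] by blast
  then show "((\<lambda>i. (norm (adj (J i) t))\<^sup>2) has_sum (norm t)\<^sup>2) I"
    by (rule has_sum_cong[THEN iffD1, rotated]) (simp add: isom_familyD(3)[OF J])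
qed

text \<open>The operator \<open>\<Sum>\<^sub>i J'\<^sub>i A J\<^sub>i\<^sup>*\<close> acts as \<open>A\<close> from each range of the first family to the corresponding range of
the second. It supplies the factors \<open>X \<otimes> I\<close> and \<open>I \<otimes> A\<close> of tensor products of operators, the operator
\<open>\<Sum>\<^sub>i S\<^sub>i S\<^sub>i\<^sup>*\<close>, and the isometry from the Fock space into an infinite-dimensional space.\<close>

lemma isom_family_transport:
  fixes A :: "'a::chilbert_space \<Rightarrow>\<^sub>L 'b::chilbert_space"
  assumes J: "isom_family I J" and J': "isom_family I J'" and A: "A \<in> cops"
  obtains T where "T \<in> cops" "norm T \<le> norm A"
    "\<And>t. ((\<lambda>i. J' i (A (adj (J i) t))) has_sum T t) I"
    "\<And>i x. i \<in> I \<Longrightarrow> T (J i x) = J' i (A x)"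
proof -
  let ?v = "\<lambda>t i. J' i (A (adj (J i) t))"
  have n: "norm (?v t i) = norm (A (adj (J i) t))" if "i \<in> I" for t i
    using isom_familyD(3)[OF J' that] by simp
  have nA: "(norm (A x))\<^sup>2 \<le> (norm A)\<^sup>2 * (norm x)\<^sup>2" for x
    unfolding power_mult_distrib[symmetric] by (intro power_mono norm_blinfun) auto
  have orth: "inner (?v t i) (?v t k) = 0" if "i \<in> I" "k \<in> I" "i \<noteq> k" for t i k
    using isom_familyD(5)[OF J'] that by blast
  have summable: "(\<lambda>i. (norm A)\<^sup>2 * (norm (adj (J i) t))\<^sup>2) summable_on I" for t
    by (intro summable_on_cmult_right isom_family_summable J)
  have "?v t summable_on I" for t
  proof (rule summable_on_norm_sq_bound[OF _ summable[of t]])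
    fix F assume F: "finite F" "F \<subseteq> I"
    have "(norm (sum (?v t) F))\<^sup>2 = (\<Sum>i\<in>F. (norm (?v t i))\<^sup>2)"
      using orth F by (intro norm_sq_sum_orthogonal) blast+
    also have "\<dots> \<le> (\<Sum>i\<in>F. (norm A)\<^sup>2 * (norm (adj (J i) t))\<^sup>2)"
      using n nA F by (intro sum_mono) (metis subsetD)
    finally show "(norm (sum (?v t) F))\<^sup>2 \<le> (\<Sum>i\<in>F. (norm A)\<^sup>2 * (norm (adj (J i) t))\<^sup>2)" .
  qed
  then have sums: "(?v t has_sum infsum (?v t) I) I" for t by simp
  let ?T = "\<lambda>t. infsum (?v t) I"
  have bound: "norm (?T t) \<le> norm A * norm t" for t
  proof (rule power2_le_imp_le)
    have "((\<lambda>i. (norm (?v t i))\<^sup>2) has_sum (norm (?T t))\<^sup>2) I"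
      using orth by (intro has_sum_norm_sq_orthogonal sums)
    then have "(norm (?T t))\<^sup>2 \<le> (\<Sum>\<^sub>\<infinity>i\<in>I. (norm A)\<^sup>2 * (norm (adj (J i) t))\<^sup>2)"
      by (rule has_sum_mono[OF _ has_sum_infsum[OF summable]]) (simp add: n nA)
    also have "\<dots> = (norm A)\<^sup>2 * (\<Sum>\<^sub>\<infinity>i\<in>I. (norm (adj (J i) t))\<^sup>2)"
      by (intro infsum_cmult_right isom_family_summable J)
    also have "\<dots> \<le> (norm A * norm t)\<^sup>2" unfolding power_mult_distrib
      by (intro mult_left_mono isom_family_summable J) auto
    finally show "(norm (?T t))\<^sup>2 \<le> (norm A * norm t)\<^sup>2" .
  qed simp
  have lin: "?v (x + y) i = ?v x i + ?v y i" "i \<in> I \<Longrightarrow> ?v (c *\<^sub>C x) i = c *\<^sub>C ?v x i" for x y c i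
    using isom_familyD(1)[OF J] isom_familyD(1)[OF J'] A by (auto simp: blinfun.add_right copsD)
  have "?T (x + y) = ?T x + ?T y" for x y
    by (rule infsumI) (use has_sum_add[OF sums[of x] sums[of y]] in \<open>simp add: lin(1)\<close>)
  moreover have "?T (c *\<^sub>C x) = c *\<^sub>C ?T x" for x c
  proof (rule infsumI)
    have "((\<lambda>i. c *\<^sub>C ?v x i) has_sum c *\<^sub>C ?T x) I"
      by (rule has_sum_bounded_linear[OF bounded_linear_scaleC sums])
    then show "(?v (c *\<^sub>C x) has_sum c *\<^sub>C ?T x) I"
      by (rule has_sum_cong[THEN iffD1, rotated]) (use lin(2) in simp)
  qed
  ultimately obtain T where T: "T \<in> cops" "\<And>x. blinfun_apply T x = ?T x"
    using clinear_blinfun_exists[of ?T "norm A"] bound by blast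
  have TJ: "T (J i x) = J' i (A x)" if "i \<in> I" for i x
  proof (rule has_sum_unique)
    show "(?v (J i x) has_sum T (J i x)) I" using sums by (simp add: T(2))
    show "(?v (J i x) has_sum J' i (A x)) I"
      using that by (intro has_sum_finite_neutralI[of "{i}"])
        (auto simp: isom_familyD(4)[OF J] blinfun.zero_right)
  qed
  show ?thesis
  proof (rule that[OF T(1)])
    show "norm T \<le> norm A" by (rule norm_blinfun_bound) (auto simp: T(2) bound)
  qed (use T(2) sums TJ in auto)
qed

lemma blinfun_eq_on_dense:
  fixes S T :: "'a::chilbert_space \<Rightarrow>\<^sub>L 'b::chilbert_space"
  assumes "S \<in> cops" "T \<in> cops" "\<And>x. x \<in> B \<Longrightarrow> S x = T x" "closure (cspan B) = UNIV"
  shows "S = T"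
proof (rule blinfun_eqI)
  fix x
  have "S y = T y" if "y \<in> cspan B" for y
    using that by (induction rule: complex_vector.span_induct_alt)
      (auto simp: blinfun.zero_right blinfun.add_right assms copsD)
  moreover have "closed {y. S y = T y}" by (intro closed_Collect_eq continuous_intros)
  ultimately have "closure (cspan B) \<subseteq> {y. S y = T y}" by (intro closure_minimal) auto
  then show "S x = T x" using assms(4) by auto
qed

section \<open>Operators on tensor products\<close>

lemma htensor_eqI:
  assumes "\<And>b. l2_nth (Rep_htensor s) b = l2_nth (Rep_htensor t) b"
  shows "s = t"
  by (metis Rep_htensor_inject l2_nth_inject assms ext)

lemma tensor_add_left: "(x + y) \<otimes> z = x \<otimes> z + y \<otimes> z"
  and tensor_add_right: "z' \<otimes> (x' + y') = z' \<otimes> x' + z' \<otimes> y'"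
  and tensor_scaleC_left: "(c *\<^sub>C x) \<otimes> z = c *\<^sub>C (x \<otimes> z)"
  and tensor_scaleC_right: "x \<otimes> (c *\<^sub>C z) = c *\<^sub>C (x \<otimes> z)"
  by (rule htensor_eqI; simp add: tensor_nth plus_htensor.rep_eq plus_l2.rep_eq
      scaleC_htensor.rep_eq scaleC_l2.rep_eq cinner_add_simps scaleC_add_left scaleC_add_right
      scaleC_scaleC mult.commute)+

lemma tensor_diff_left: "(x - y) \<otimes> z = x \<otimes> z - y \<otimes> z"
  and tensor_diff_right: "z' \<otimes> (x' - y') = z' \<otimes> x' - z' \<otimes> y'"
  using tensor_add_left[of "x - y" y z] tensor_add_right[of z' "x' - y'" y'] by simp_all

lemma norm_tensor: "norm (x \<otimes> y) = norm x * norm y"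
proof -
  have "complex_of_real ((norm (x \<otimes> y))\<^sup>2) = complex_of_real ((norm x * norm y)\<^sup>2)"
    unfolding cinner_self[symmetric] cinner_tensor by (simp add: cinner_self power_mult_distrib)
  then have "(norm (x \<otimes> y))\<^sup>2 = (norm x * norm y)\<^sup>2" by (simp only: of_real_eq_iff)
  then show ?thesis by (simp add: power2_eq_iff_nonneg)
qed

lemma tensor_left_exists: "\<exists>T. T \<in> cops \<and> (\<forall>y. blinfun_apply T y = x \<otimes> y)"
  by (rule clinear_blinfun_exists[of _ "norm x"])
    (auto simp: tensor_add_right tensor_scaleC_right norm_tensor)

lemma tensor_right_exists: "\<exists>T. T \<in> cops \<and> (\<forall>x. blinfun_apply T x = x \<otimes> y)"
  by (rule clinear_blinfun_exists[of _ "norm y"])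
    (auto simp: tensor_add_left tensor_scaleC_left norm_tensor)

definition tensor_left :: "'a::chilbert_space \<Rightarrow> ('b::chilbert_space \<Rightarrow>\<^sub>L ('a, 'b) htensor)" where
  "tensor_left x = (SOME T. T \<in> cops \<and> (\<forall>y. blinfun_apply T y = x \<otimes> y))"

definition tensor_right :: "'b::chilbert_space \<Rightarrow> ('a::chilbert_space \<Rightarrow>\<^sub>L ('a, 'b) htensor)" where
  "tensor_right y = (SOME T. T \<in> cops \<and> (\<forall>x. blinfun_apply T x = x \<otimes> y))"

lemma tensor_left_cops [simp]: "tensor_left x \<in> cops" and tensor_left_apply [simp]: "tensor_left x y = x \<otimes> y"
  using someI_ex[OF tensor_left_exists[of x]] by (auto simp: tensor_left_def)

lemma tensor_right_cops [simp]: "tensor_right y \<in> cops" and tensor_right_apply [simp]: "tensor_right y x = x \<otimes> y"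
  using someI_ex[OF tensor_right_exists[of y]] by (auto simp: tensor_right_def)

lemma orthonormal_some_onb: "orthonormal some_onb"
  by (rule some_onb[unfolded is_onb_def, THEN conjunct1])

lemma isom_family_tensor_left: "orthonormal B \<Longrightarrow> isom_family B tensor_left"
  by (auto simp: isom_family_def cinner_tensor orthonormal_def)

lemma isom_family_tensor_right: "orthonormal B \<Longrightarrow> isom_family B tensor_right"
  by (auto simp: isom_family_def cinner_tensor orthonormal_def)

lemma subspace_closure:
  assumes S: "complex_vector.subspace (S :: 'a::complex_normed_vector set)"
  shows "complex_vector.subspace (closure S)"
proof (rule complex_vector.subspaceI)
  show "0 \<in> closure S"
    using complex_vector.subspace_0[OF S] closure_subset by blast
next
  fix x y assume "x \<in> closure S" "y \<in> closure S"
  then obtain f g where fg: "\<And>n. f n \<in> S" "\<And>n. g n \<in> S" "f \<longlonglongrightarrow> x" "g \<longlonglongrightarrow> y"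
    unfolding closure_sequential by metis
  have "(\<lambda>n. f n + g n) \<longlonglongrightarrow> x + y" using fg by (intro tendsto_add)
  then show "x + y \<in> closure S"
    unfolding closure_sequential using complex_vector.subspace_add[OF S] fg
    by (intro exI[of _ "\<lambda>n. f n + g n"]) simp
next
  fix c x assume "x \<in> closure S"
  then obtain f where f: "\<And>n. f n \<in> S" "f \<longlonglongrightarrow> x" unfolding closure_sequential by metis
  have "(\<lambda>n. c *\<^sub>C f n) \<longlonglongrightarrow> c *\<^sub>C x"
    by (rule bounded_linear.tendsto[OF bounded_linear_scaleC f(2)])
  then show "c *\<^sub>C x \<in> closure S"
    unfolding closure_sequential using complex_vector.subspace_scale[OF S] f
    by (intro exI[of _ "\<lambda>n. c *\<^sub>C f n"]) simp
qed

lemmas subspace_closure_cspan = subspace_closure[OF complex_vector.subspace_span]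

lemma has_sum_in_closed_subspace:
  assumes "(f has_sum x) A" "\<And>i. i \<in> A \<Longrightarrow> f i \<in> S" "complex_vector.subspace S" "closed S"
  shows "x \<in> S"
proof (rule Lim_in_closed_set[OF assms(4) _ _ assms(1)[unfolded has_sum_def]])
  show "\<forall>\<^sub>F J in finite_subsets_at_top A. sum f J \<in> S"
    using assms(2,3) by (intro eventually_finite_subsets_at_top_weakI complex_vector.subspace_sum) auto
qed simp

lemma closure_cspan_minimal:
  fixes B C :: "'a::complex_normed_vector set"
  assumes "B \<subseteq> closure (cspan C)"
  shows "closure (cspan B) \<subseteq> closure (cspan C)"
  by (intro closure_minimal complex_vector.span_minimal assms subspace_closure_cspan closed_closure)

lemma tensor_left_total:
  assumes "is_onb B"
  shows "closure (cspan (\<Union>b\<in>B. range (blinfun_apply (tensor_left b)))) = (UNIV :: ('a::chilbert_space, 'b::chilbert_space) htensor set)"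
proof -
  let ?S = "cspan (\<Union>b\<in>B. range (blinfun_apply (tensor_left b :: 'b \<Rightarrow>\<^sub>L ('a, 'b) htensor)))"
  have "x \<otimes> y \<in> closure ?S" for x :: 'a and y :: 'b
  proof (rule has_sum_in_closed_subspace[OF _ _ subspace_closure_cspan closed_closure])
    show "((\<lambda>b. tensor_right y (cinner b x *\<^sub>C b)) has_sum x \<otimes> y) B"
      using has_sum_bounded_linear[OF blinfun.bounded_linear_right onb_expansion[OF assms], of "tensor_right y" x]
      by simp
    fix b assume "b \<in> B"
    moreover have "b \<otimes> y \<in> range (tensor_left b)" by (metis rangeI tensor_left_apply)
    ultimately have "b \<otimes> y \<in> ?S" by (intro complex_vector.span_base UN_I)
    then have "cinner b x *\<^sub>C (b \<otimes> y) \<in> ?S" by (rule complex_vector.span_scale)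
    then show "tensor_right y (cinner b x *\<^sub>C b) \<in> closure ?S"
      using closure_subset by (auto simp: tensor_scaleC_left)
  qed
  then have "{x \<otimes> y |x y. True} \<subseteq> closure ?S" by blast
  from closure_cspan_minimal[OF this] show ?thesis unfolding tensor_dense by (rule top_le)
qed

lemma tensor_right_total:
  assumes "is_onb B"
  shows "closure (cspan (\<Union>b\<in>B. range (blinfun_apply (tensor_right b)))) = (UNIV :: ('a::chilbert_space, 'b::chilbert_space) htensor set)"
proof -
  let ?S = "cspan (\<Union>b\<in>B. range (blinfun_apply (tensor_right b :: 'a \<Rightarrow>\<^sub>L ('a, 'b) htensor)))"
  have "x \<otimes> y \<in> closure ?S" for x :: 'a and y :: 'b
  proof (rule has_sum_in_closed_subspace[OF _ _ subspace_closure_cspan closed_closure])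
    show "((\<lambda>b. tensor_left x (cinner b y *\<^sub>C b)) has_sum x \<otimes> y) B"
      using has_sum_bounded_linear[OF blinfun.bounded_linear_right onb_expansion[OF assms], of "tensor_left x" y]
      by simp
    fix b assume "b \<in> B"
    moreover have "x \<otimes> b \<in> range (tensor_right b)" by (metis rangeI tensor_right_apply)
    ultimately have "x \<otimes> b \<in> ?S" by (intro complex_vector.span_base UN_I)
    then have "cinner b y *\<^sub>C (x \<otimes> b) \<in> ?S" by (rule complex_vector.span_scale)
    then show "tensor_left x (cinner b y *\<^sub>C b) \<in> closure ?S"
      using closure_subset by (auto simp: tensor_scaleC_right)
  qed
  then have "{x \<otimes> y |x y. True} \<subseteq> closure ?S" by blast
  from closure_cspan_minimal[OF this] show ?thesis unfolding tensor_dense by (rule top_le)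
qed

lemma tensor_right_expansion:
  assumes "is_onb B"
  shows "((\<lambda>b. adj (tensor_right b) t \<otimes> b) has_sum t) B"
    "((\<lambda>b. (norm (adj (tensor_right b) t))\<^sup>2) has_sum (norm t)\<^sup>2) B"
proof -
  have fam: "isom_family B tensor_right" using assms by (simp add: isom_family_tensor_right is_onb_def)
  note * = isom_family_expansion[OF fam, unfolded tensor_right_total[OF assms], OF UNIV_I]
  show "((\<lambda>b. adj (tensor_right b) t \<otimes> b) has_sum t) B"
    "((\<lambda>b. (norm (adj (tensor_right b) t))\<^sup>2) has_sum (norm t)\<^sup>2) B"
    using *[of t] by simp_all
qed

text \<open>The set of elementary tensors absorbs complex scalars, so its real span is already its complex span.
Hence even a merely real-linear operator is determined by its values on elementary tensors, which is
the uniqueness behind the definite description in the definition of \<open>\<otimes>\<^sub>o\<close>.\<close>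

lemma tensor_ops_eqI:
  fixes S T :: "('a::chilbert_space, 'b::chilbert_space) htensor \<Rightarrow>\<^sub>L 'c::chilbert_space"
  assumes "\<And>x y. S (x \<otimes> y) = T (x \<otimes> y)"
  shows "S = T"
proof (rule blinfun_eqI)
  fix t
  have "S t = T t" if "t \<in> cspan {x \<otimes> y |x y. True}" for t
    using that
  proof (induction rule: complex_vector.span_induct_alt)
    case (step c x y)
    then show ?case using assms by (auto simp: blinfun.add_right simp flip: tensor_scaleC_left)
  qed (simp add: blinfun.zero_right)
  moreover have "closed {t. S t = T t}" by (intro closed_Collect_eq continuous_intros)
  ultimately have "closure (cspan {x \<otimes> y |x y. True}) \<subseteq> {y. S y = T y}"
    by (intro closure_minimal) auto
  then show "S t = T t" unfolding tensor_dense by blast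
qed

text \<open>The construction is \<open>(I \<otimes> A) (X \<otimes> I)\<close>. Each factor acts as one fixed operator along an orthonormal family of
embeddings, \<open>X\<close> along \<open>x \<mapsto> x \<otimes> c\<close> and \<open>A\<close> along \<open>y \<mapsto> b \<otimes> y\<close>, for \<open>c\<close> and \<open>b\<close> in orthonormal bases.\<close>

lemma tensor_op_exists:
  fixes X :: "'a::chilbert_space \<Rightarrow>\<^sub>L 'b::chilbert_space" and A :: "'c::chilbert_space \<Rightarrow>\<^sub>L 'd::chilbert_space"
  assumes X: "X \<in> cops" and A: "A \<in> cops"
  shows "\<exists>T :: ('a, 'c) htensor \<Rightarrow>\<^sub>L ('b, 'd) htensor.
    T \<in> cops \<and> norm T \<le> norm X * norm A \<and> (\<forall>x y. T (x \<otimes> y) = X x \<otimes> A y)"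
proof -
  obtain T1 :: "('a, 'c) htensor \<Rightarrow>\<^sub>L ('b, 'c) htensor" where T1: "T1 \<in> cops" "norm T1 \<le> norm X"
    "\<And>b x. b \<in> some_onb \<Longrightarrow> T1 (tensor_right b x) = tensor_right b (X x)"
    using isom_family_transport[OF isom_family_tensor_right[OF orthonormal_some_onb] isom_family_tensor_right[OF orthonormal_some_onb] X]
    by metis
  obtain T2 :: "('b, 'c) htensor \<Rightarrow>\<^sub>L ('b, 'd) htensor" where T2: "T2 \<in> cops" "norm T2 \<le> norm A"
    "\<And>b x. b \<in> some_onb \<Longrightarrow> T2 (tensor_left b x) = tensor_left b (A x)"
    using isom_family_transport[OF isom_family_tensor_left[OF orthonormal_some_onb] isom_family_tensor_left[OF orthonormal_some_onb] A]
    by metis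
  have "T1 (x \<otimes> y) = X x \<otimes> y" for x y
  proof -
    have "T1 o\<^sub>L tensor_left x = tensor_left (X x)"
      by (rule blinfun_eq_on_dense[of _ _ some_onb])
        (use T1 some_onb[where 'a='c] in \<open>auto simp: cops_compose is_onb_def\<close>)
    from arg_cong[OF this, of "\<lambda>S. blinfun_apply S y"] show ?thesis by simp
  qed
  moreover have "T2 (x \<otimes> y) = x \<otimes> A y" for x y
  proof -
    have "T2 o\<^sub>L tensor_right y = tensor_right (A y)"
      by (rule blinfun_eq_on_dense[of _ _ some_onb])
        (use T2 some_onb[where 'a='b] in \<open>auto simp: cops_compose is_onb_def\<close>)
    from arg_cong[OF this, of "\<lambda>S. blinfun_apply S x"] show ?thesis by simp
  qed
  moreover have "norm (T2 o\<^sub>L T1) \<le> norm X * norm A"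
    using norm_blinfun_compose[of T2 T1] mult_mono[OF T2(2) T1(2)] by (simp add: mult.commute)
  ultimately show ?thesis using T1(1) T2(1) by (intro exI[of _ "T2 o\<^sub>L T1"]) (simp add: cops_compose)
qed

lemma tensor_op:
  assumes "X \<in> cops" "A \<in> cops"
  shows tensor_op_cops: "X \<otimes>\<^sub>o A \<in> cops" and tensor_op_apply: "(X \<otimes>\<^sub>o A) (x \<otimes> y) = X x \<otimes> A y"
    and norm_tensor_op_le: "norm (X \<otimes>\<^sub>o A) \<le> norm X * norm A"
proof -
  obtain T where T: "T \<in> cops" "norm T \<le> norm X * norm A" "\<And>x y. blinfun_apply T (x \<otimes> y) = X x \<otimes> A y"
    using tensor_op_exists[OF assms] by blast
  have "X \<otimes>\<^sub>o A = T"
    unfolding tensor_op_def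
  proof (rule the_equality)
    show "T' = T" if "\<forall>x y. blinfun_apply T' (x \<otimes> y) = X x \<otimes> A y" for T'
      by (rule tensor_ops_eqI) (simp add: that T)
  qed (simp add: T)
  then show "X \<otimes>\<^sub>o A \<in> cops" "(X \<otimes>\<^sub>o A) (x \<otimes> y) = X x \<otimes> A y" "norm (X \<otimes>\<^sub>o A) \<le> norm X * norm A"
    using T by auto
qed

lemma tensor_op_compose:
  assumes "X \<in> cops" "A \<in> cops" "Y \<in> cops" "B \<in> cops"
  shows "(X \<otimes>\<^sub>o A) o\<^sub>L (Y \<otimes>\<^sub>o B) = (X o\<^sub>L Y) \<otimes>\<^sub>o (A o\<^sub>L B)"
  by (rule tensor_ops_eqI) (simp add: tensor_op_apply assms cops_compose)

lemma tensor_op_id: "id_blinfun \<otimes>\<^sub>o id_blinfun = id_blinfun"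
  by (rule tensor_ops_eqI) (simp add: tensor_op_apply)

lemma tensor_op_diff_left:
  "X \<in> cops \<Longrightarrow> Y \<in> cops \<Longrightarrow> A \<in> cops \<Longrightarrow> (X - Y) \<otimes>\<^sub>o A = X \<otimes>\<^sub>o A - Y \<otimes>\<^sub>o A"
  by (rule tensor_ops_eqI)
    (simp add: tensor_op_apply cops_diff blinfun.diff_left tensor_diff_left)

lemma tensor_op_add_left:
  "X \<in> cops \<Longrightarrow> Y \<in> cops \<Longrightarrow> A \<in> cops \<Longrightarrow> (X + Y) \<otimes>\<^sub>o A = X \<otimes>\<^sub>o A + Y \<otimes>\<^sub>o A"
  by (rule tensor_ops_eqI) (simp add: tensor_op_apply cops_add blinfun.add_left tensor_add_left)

lemma tensor_op_diff_right:
  "X \<in> cops \<Longrightarrow> A \<in> cops \<Longrightarrow> B \<in> cops \<Longrightarrow> X \<otimes>\<^sub>o (A - B) = X \<otimes>\<^sub>o A - X \<otimes>\<^sub>o B"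
  by (rule tensor_ops_eqI)
    (simp add: tensor_op_apply cops_diff blinfun.diff_left tensor_diff_right)

lemma tensor_op_zero_right: "X \<in> cops \<Longrightarrow> X \<otimes>\<^sub>o 0 = 0"
  using tensor_op_diff_right[of X 0 0] by simp

lemma tensor_op_zero_left: "A \<in> cops \<Longrightarrow> 0 \<otimes>\<^sub>o A = 0"
  using tensor_op_diff_left[of 0 0 A] by simp

lemma tensor_op_scaleC_left: "X \<in> cops \<Longrightarrow> A \<in> cops \<Longrightarrow> (c *\<^sub>C X) \<otimes>\<^sub>o A = c *\<^sub>C (X \<otimes>\<^sub>o A)"
  by (rule tensor_ops_eqI)
    (simp add: tensor_op_apply cops_scaleC scaleC_blinfun.rep_eq tensor_scaleC_left)

lemma tensor_op_scaleR_left: "X \<in> cops \<Longrightarrow> A \<in> cops \<Longrightarrow> (r *\<^sub>R X) \<otimes>\<^sub>o A = r *\<^sub>R (X \<otimes>\<^sub>o A)"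
  using tensor_op_scaleC_left[of X A "complex_of_real r"] by (simp add: scaleC_of_real)

lemma tensor_op_scaleC_right: "X \<in> cops \<Longrightarrow> A \<in> cops \<Longrightarrow> X \<otimes>\<^sub>o (c *\<^sub>C A) = c *\<^sub>C (X \<otimes>\<^sub>o A)"
  by (rule tensor_ops_eqI)
    (simp add: tensor_op_apply cops_scaleC scaleC_blinfun.rep_eq tensor_scaleC_right)

lemma tensor_op_add_right:
  "X \<in> cops \<Longrightarrow> A \<in> cops \<Longrightarrow> B \<in> cops \<Longrightarrow> X \<otimes>\<^sub>o (A + B) = X \<otimes>\<^sub>o A + X \<otimes>\<^sub>o B"
  by (rule tensor_ops_eqI) (simp add: tensor_op_apply cops_add blinfun.add_left tensor_add_right)

lemma adj_tensor_op:
  assumes "X \<in> cops" "A \<in> cops"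
  shows "adj (X \<otimes>\<^sub>o A) = adj X \<otimes>\<^sub>o adj A"
proof -
  have "adj (X \<otimes>\<^sub>o A) (x \<otimes> y) = adj X x \<otimes> adj A y" for x y
  proof -
    let ?u = "adj (X \<otimes>\<^sub>o A) (x \<otimes> y)" and ?v = "adj X x \<otimes> adj A y"
    have eq: "cinner (?u - ?v) (x' \<otimes> y') = 0" for x' y'
      by (simp add: cinner_simps cinner_adj_left tensor_op_cops tensor_op_apply cinner_tensor assms)
    have "cinner (?u - ?v) t = 0" for t
    proof -
      have "t \<in> closure (cspan {x \<otimes> y |x y. True})" unfolding tensor_dense by (rule UNIV_I)
      moreover have "closure (cspan {x \<otimes> y |x y. True}) \<subseteq> {t. cinner (?u - ?v) t = 0}"
      proof (rule closure_minimal)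
        show "cspan {x \<otimes> y |x y. True} \<subseteq> {t. cinner (?u - ?v) t = 0}"
          by (rule complex_vector.span_minimal)
            (auto simp: eq complex_vector.subspace_def cinner_add_simps cinner_simps(1))
        have "continuous_on UNIV (\<lambda>t. cinner (?u - ?v) t)"
          by (rule linear_continuous_on[OF bounded_linear_cinner_right])
        then show "closed {t. cinner (?u - ?v) t = 0}" by (intro closed_Collect_eq) auto
      qed
      ultimately show ?thesis by blast
    qed
    from this[of "?u - ?v"] show ?thesis by (simp add: cinner_self)
  qed
  then show ?thesis by (intro tensor_ops_eqI) (simp add: tensor_op_apply assms)
qed

text \<open>Tonelli's theorem for unordered sums.\<close>

lemma has_sum_swap_nonneg:
  fixes g :: "'a \<Rightarrow> 'b \<Rightarrow> real"
  assumes rows: "\<And>x. x \<in> A \<Longrightarrow> ((\<lambda>y. g x y) has_sum f x) B" and "(f has_sum S) A"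
    and cols: "\<And>y. y \<in> B \<Longrightarrow> ((\<lambda>x. g x y) has_sum h y) A"
    and nonneg: "\<And>x y. x \<in> A \<Longrightarrow> y \<in> B \<Longrightarrow> 0 \<le> g x y"
  shows "(h has_sum S) B"
proof -
  have "(\<lambda>(x,y). g x y) summable_on A \<times> B"
    using assms by (intro summable_on_SigmaI[where g=f]) (auto simp: summable_on_def)
  then have "((\<lambda>(x,y). g x y) has_sum S) (A \<times> B)"
    using assms by (intro has_sum_SigmaI[where g=f]) auto
  then have "((\<lambda>(y,x). g x y) has_sum S) (B \<times> A)" by (subst (asm) has_sum_swap) simp
  then show ?thesis by (rule has_sum_SigmaD) (use cols in auto)
qed

lemma adj_tensor_right_tensor_op:
  assumes p: "p \<in> cops"
  shows "adj (tensor_right c) ((p \<otimes>\<^sub>o id_blinfun) t) = p (adj (tensor_right c) t)"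
proof -
  have "(adj p \<otimes>\<^sub>o id_blinfun) o\<^sub>L tensor_right c = tensor_right c o\<^sub>L adj p"
    by (rule blinfun_eqI) (simp add: tensor_op_apply p)
  then have eq: "(adj p \<otimes>\<^sub>o id_blinfun) (x \<otimes> c) = adj p x \<otimes> c" for x
    by (simp add: tensor_op_apply p)
  have *: "p \<otimes>\<^sub>o id_blinfun = adj (adj p \<otimes>\<^sub>o id_blinfun)"
    by (simp add: adj_tensor_op p adj_adj adj_id)
  show ?thesis
  proof (rule cinner_ext)
    fix x
    have "cinner x (adj (tensor_right c) ((p \<otimes>\<^sub>o id_blinfun) t)) = cinner (adj p x \<otimes> c) t"
      by (simp add: * cinner_adj_right tensor_op_cops p eq)
    also have "\<dots> = cinner (adj p x) (adj (tensor_right c) t)" by (simp add: cinner_adj_right)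
    also have "\<dots> = cinner x (p (adj (tensor_right c) t))" by (simp add: cinner_adj_left p)
    finally show "cinner x (adj (tensor_right c) ((p \<otimes>\<^sub>o id_blinfun) t)) = cinner x (p (adj (tensor_right c) t))" .
  qed
qed

text \<open>A decomposition \<open>\<Sum>\<^sub>d p\<^sub>d\<^sup>* p\<^sub>d = I\<close> survives tensoring with the identity. In coordinates with respect to a basis
of the second factor, \<open>p\<^sub>d \<otimes> I\<close> is \<open>p\<^sub>d\<close> applied to each coordinate, and the two sums may be exchanged.\<close>

lemma norm_sq_tensor_partition:
  assumes p: "\<And>d. d \<in> D \<Longrightarrow> p d \<in> cops"
    and sum: "\<And>h. ((\<lambda>d. (norm (p d h))\<^sup>2) has_sum (norm h)\<^sup>2) D"
  shows "((\<lambda>d. (norm ((p d \<otimes>\<^sub>o id_blinfun) t))\<^sup>2) has_sum (norm t)\<^sup>2) D"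
proof (rule has_sum_swap_nonneg)
  let ?R = "\<lambda>c. adj (tensor_right c) t"
  show "((\<lambda>d. (norm (p d (?R c)))\<^sup>2) has_sum (norm (?R c))\<^sup>2) D" for c by (rule sum)
  show "((\<lambda>c. (norm (?R c))\<^sup>2) has_sum (norm t)\<^sup>2) some_onb"
    by (rule tensor_right_expansion(2)[OF some_onb])
  show "((\<lambda>c. (norm (p d (?R c)))\<^sup>2) has_sum (norm ((p d \<otimes>\<^sub>o id_blinfun) t))\<^sup>2) some_onb"
    if "d \<in> D" for d
    using tensor_right_expansion(2)[OF some_onb, of "(p d \<otimes>\<^sub>o id_blinfun) t"]
    by (simp add: adj_tensor_right_tensor_op p that)
qed simp

section \<open>The Fock space and creation operators\<close>

lemma l2_eqI: "(\<And>i. l2_nth f i = l2_nth g i) \<Longrightarrow> f = g"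
  by (metis l2_nth_inject ext)

lift_definition fock_basis :: "'n list \<Rightarrow> 'n fock" is "\<lambda>w u. if u = w then 1 else 0"
proof -
  fix w :: "'n list"
  show "(\<lambda>u. (norm (if u = w then 1 else 0 :: complex))\<^sup>2) summable_on UNIV"
    by (rule finite_nonzero_values_imp_summable_on) simp
qed

lemma cinner_fock_basis: "cinner (fock_basis w) \<phi> = l2_nth \<phi> w"
proof -
  have "((\<lambda>u. cinner (l2_nth (fock_basis w) u) (l2_nth \<phi> u)) has_sum l2_nth \<phi> w) UNIV"
    by (rule has_sum_finite_neutralI[of "{w}"]) (auto simp: fock_basis.rep_eq cinner_complex_def)
  then show ?thesis unfolding cinner_l2_def by (rule infsumI)
qed

lemma cinner_fock_basis_basis: "cinner (fock_basis u) (fock_basis w) = (if u = w then 1 else 0)"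
  by (simp add: cinner_fock_basis fock_basis.rep_eq)

lemma fock_basis_inj: "fock_basis u = fock_basis w \<longleftrightarrow> u = w"
  by (metis cinner_fock_basis_basis zero_neq_one)

lemma norm_fock_basis: "norm (fock_basis w) = 1"
proof -
  have "(norm (fock_basis w))\<^sup>2 = 1" unfolding norm_sq_cinner cinner_fock_basis_basis by simp
  then show ?thesis using norm_ge_zero[of "fock_basis w"] by (auto simp: power2_eq_1_iff)
qed

text \<open>The expansion of a vector in the basis converges by orthogonality, and its sum has the same
coordinates as the vector.\<close>

lemma fock_basis_total: "closure (cspan (range fock_basis)) = UNIV"
proof -
  have "\<phi> \<in> closure (cspan (range fock_basis))" for \<phi> :: "'n fock"
  proof -
    let ?v = "\<lambda>w. l2_nth \<phi> w *\<^sub>C fock_basis w"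
    have n: "norm (?v w) = norm (l2_nth \<phi> w)" for w by (simp add: norm_scaleC norm_fock_basis)
    have "?v summable_on UNIV"
    proof (rule summable_on_norm_sq_bound[OF _ l2_summable[of \<phi>]])
      fix J :: "'n list set" assume J: "finite J" "J \<subseteq> UNIV"
      have "(norm (sum ?v J))\<^sup>2 = (\<Sum>w\<in>J. (norm (?v w))\<^sup>2)"
        by (rule norm_sq_sum_orthogonal[OF _ J(1)])
          (simp add: inner_eq_Re_cinner cinner_add_simps cinner_fock_basis_basis)
      then show "(norm (sum ?v J))\<^sup>2 \<le> (\<Sum>w\<in>J. (norm (l2_nth \<phi> w))\<^sup>2)" by (simp add: n)
    qed
    then obtain \<psi> where \<psi>: "(?v has_sum \<psi>) UNIV" by (auto simp: summable_on_def)
    have "l2_nth \<psi> u = l2_nth \<phi> u" for u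
    proof (rule has_sum_unique)
      show "((\<lambda>w. cinner (fock_basis u) (?v w)) has_sum l2_nth \<psi> u) UNIV"
        using has_sum_cinner_right[OF \<psi>, of "fock_basis u"] by (simp add: cinner_fock_basis)
      show "((\<lambda>w. cinner (fock_basis u) (?v w)) has_sum l2_nth \<phi> u) UNIV"
        by (rule has_sum_finite_neutralI[of "{u}"])
          (auto simp: cinner_add_simps cinner_fock_basis_basis)
    qed
    then have "\<psi> = \<phi>" by (rule l2_eqI)
    have "\<psi> \<in> closure (cspan (range fock_basis))"
    proof (rule has_sum_in_closed_subspace[OF \<psi> _ subspace_closure_cspan closed_closure])
      fix w
      have "?v w \<in> cspan (range fock_basis)"
        by (intro complex_vector.span_scale complex_vector.span_base rangeI)
      then show "?v w \<in> closure (cspan (range fock_basis))" using closure_subset by blast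
    qed
    then show ?thesis using \<open>\<psi> = \<phi>\<close> by simp
  qed
  then show ?thesis by blast
qed

lemma fock_basis_onb: "is_onb (range fock_basis)"
  by (auto simp: is_onb_def orthonormal_def fock_basis_total cinner_fock_basis_basis fock_basis_inj)

lemma creation_cops [simp]: "creation i \<in> cops"
  unfolding cops_def
proof (intro CollectI allI)
  show "creation i (c *\<^sub>C x) = c *\<^sub>C creation i x" for c x
    unfolding creation.rep_eq
    by (rule l2_eqI) (simp add: fock_shift.rep_eq scaleC_l2.rep_eq scaleC_complex_def split: list.split)
qed

lemma creation_fock_basis: "creation i (fock_basis w) = fock_basis (i # w)"
  unfolding creation.rep_eq
  by (rule l2_eqI) (simp add: fock_shift.rep_eq fock_basis.rep_eq split: list.split)

lemma creation_isom_family: "isom_family (UNIV :: 'n set) creation"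
proof -
  have ii: "cinner (creation i x) (creation i y) = cinner x y" for i :: 'n and x y
    by (rule isometry_cinner) (simp_all add: isometry_op_def creation.rep_eq norm_fock_shift)
  moreover have "cinner (creation i x) (creation k y) = 0" if "i \<noteq> k" for i k :: 'n and x y
    unfolding cinner_l2_def creation.rep_eq fock_shift.rep_eq using that
    by (intro infsum_0) (simp add: cinner_simps split: list.split)
  ultimately show ?thesis by (simp add: isom_family_def)
qed

section \<open>Row contractions and words\<close>

lemma word_op_cops: "range X \<subseteq> cops \<Longrightarrow> word_op X \<alpha> \<in> cops"
  by (induction \<alpha>) (auto intro!: cops_compose)

lemma word_op_scaleR: "word_op (\<lambda>i. r *\<^sub>R X i) \<alpha> = r ^ length \<alpha> *\<^sub>R word_op X \<alpha>"
  by (induction \<alpha>)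
    (auto intro!: blinfun_eqI simp: blinfun.scaleR_left blinfun.scaleR_right)

lemma word_op_creation: "word_op creation \<alpha> (fock_basis w) = fock_basis (\<alpha> @ w)"
  by (induction \<alpha>) (simp_all add: creation_fock_basis)

lemma word_op_intertwine:
  fixes q :: "'a::chilbert_space \<Rightarrow>\<^sub>L 'b::chilbert_space"
  assumes "\<And>i. X2 i o\<^sub>L q = q o\<^sub>L X1 i"
  shows "word_op X2 \<alpha> o\<^sub>L q = q o\<^sub>L word_op X1 \<alpha>"
proof (induction \<alpha>)
  case (Cons i \<alpha>)
  have "X2 i (q x) = q (X1 i x)" for i x using arg_cong[OF assms, of "\<lambda>S. blinfun_apply S x"] by simp
  moreover have "word_op X2 \<alpha> (q x) = q (word_op X1 \<alpha> x)" for x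
    using arg_cong[OF Cons, of "\<lambda>S. blinfun_apply S x"] by simp
  ultimately show ?case by (intro blinfun_eqI) simp
qed (auto intro: blinfun_eqI)

lemma row_ballD:
  fixes X :: "'n \<Rightarrow> ('h::chilbert_space \<Rightarrow>\<^sub>L 'h)"
  assumes "X \<in> row_ball"
  obtains Q :: "'h \<Rightarrow>\<^sub>L 'h" where "range X \<subseteq> cops" "\<And>h. ((\<lambda>i. X i (adj (X i) h)) has_sum Q h) UNIV" "norm Q < 1"
  using assms by (auto simp: row_ball_def has_sot_sum_def real_sqrt_lt_1_iff)

lemma row_ballI:
  fixes X :: "'n \<Rightarrow> ('h::chilbert_space \<Rightarrow>\<^sub>L 'h)" and Q :: "'h \<Rightarrow>\<^sub>L 'h"
  assumes "range X \<subseteq> cops" "\<And>h. ((\<lambda>i. X i (adj (X i) h)) has_sum Q h) UNIV" "norm Q < 1"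
  shows "X \<in> row_ball"
  using assms by (auto simp: row_ball_def has_sot_sum_def real_sqrt_lt_1_iff)

text \<open>\<open>\<Sum>\<^sub>i S\<^sub>i S\<^sub>i\<^sup>*\<close> is the projection onto the complement of the vacuum vector, hence a contraction.\<close>

lemma creation_row_ball:
  assumes r: "0 \<le> r" "r < 1"
  shows "(\<lambda>i. r *\<^sub>R creation i) \<in> (row_ball :: ('n \<Rightarrow> ('n fock \<Rightarrow>\<^sub>L 'n fock)) set)"
proof -
  obtain T :: "'n fock \<Rightarrow>\<^sub>L 'n fock" where T: "norm T \<le> norm (id_blinfun :: 'n fock \<Rightarrow>\<^sub>L 'n fock)"
    "\<And>t. ((\<lambda>i. creation i (id_blinfun (adj (creation i) t))) has_sum T t) UNIV"
    by (rule isom_family_transport[OF creation_isom_family creation_isom_family cops_id])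
      (rule that; assumption)
  have "norm T \<le> 1" using T(1) norm_blinfun_id_le order_trans by blast
  then have "norm (r\<^sup>2 *\<^sub>R T) \<le> r\<^sup>2" using mult_left_mono[of "norm T" 1 "r\<^sup>2"] by simp
  also have "r\<^sup>2 < 1" using r by (simp add: power_less_one_iff abs_square_less_1)
  finally have n: "norm (r\<^sup>2 *\<^sub>R T) < 1" .
  show ?thesis
  proof (rule row_ballI[OF _ _ n])
    show "range (\<lambda>i::'n. r *\<^sub>R creation i) \<subseteq> cops" by (auto intro: cops_scaleR)
    show "((\<lambda>i. (r *\<^sub>R creation i) (adj (r *\<^sub>R creation i) h)) has_sum (r\<^sup>2 *\<^sub>R T) h) UNIV" for h
      using has_sum_bounded_linear[OF bounded_linear_scaleR_right T(2)[of h], of "r\<^sup>2"]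
      by (simp add: adj_scaleR blinfun.scaleR_left blinfun.scaleR_right power2_eq_square)
  qed
qed

lemma row_ball_conj:
  fixes W :: "'k::chilbert_space \<Rightarrow>\<^sub>L 'h::chilbert_space"
  assumes X: "X \<in> row_ball" and W: "W \<in> cops" "isometry_op W"
  shows "(\<lambda>i. W o\<^sub>L X i o\<^sub>L adj W) \<in> row_ball"
proof -
  obtain Q :: "'k \<Rightarrow>\<^sub>L 'k" where Q: "range X \<subseteq> cops" "\<And>h. ((\<lambda>i. X i (adj (X i) h)) has_sum Q h) UNIV" "norm Q < 1"
    by (rule row_ballD[OF X]) (rule that; assumption)
  have Xc: "X i \<in> cops" for i using Q(1) by auto
  have nW: "norm W \<le> 1" using W(2) by (intro norm_blinfun_bound) (auto simp: isometry_op_def)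
  have "norm (W o\<^sub>L Q o\<^sub>L adj W) \<le> norm (W o\<^sub>L Q) * norm (adj W)" by (rule norm_blinfun_compose)
  also have "\<dots> \<le> (norm W * norm Q) * norm W"
    unfolding norm_adj[OF W(1)] by (intro mult_right_mono norm_blinfun_compose) simp
  also have "\<dots> \<le> (1 * norm Q) * 1" by (intro mult_mono nW) auto
  finally have n: "norm (W o\<^sub>L Q o\<^sub>L adj W) < 1" using Q(3) by simp
  show ?thesis
  proof (rule row_ballI[OF _ _ n])
    show "range (\<lambda>i. W o\<^sub>L X i o\<^sub>L adj W) \<subseteq> cops" using W Xc by (auto intro!: cops_compose)
    show "((\<lambda>i. (W o\<^sub>L X i o\<^sub>L adj W) (adj (W o\<^sub>L X i o\<^sub>L adj W) h)) has_sum (W o\<^sub>L Q o\<^sub>L adj W) h) UNIV" for h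
      using has_sum_bounded_linear[OF blinfun.bounded_linear_right Q(2)[of "adj W h"], of W]
      by (simp add: adj_compose W Xc cops_compose adj_adj adj_isometry)
  qed
qed

section \<open>Evaluating power series and intertwining\<close>

lemma fh_sumsE:
  assumes "fh_sums A X T"
  obtains P where "\<And>k. has_sot_sum (\<lambda>\<alpha>. word_op X \<alpha> \<otimes>\<^sub>o A \<alpha>) {\<alpha>. length \<alpha> = k} (P k)" "P sums T"
  using assms unfolding fh_sums_def by blast

lemma fh_sums_unique:
  assumes "fh_sums A X T" "fh_sums A X T'"
  shows "T = T'"
proof -
  obtain P where P: "\<And>k. has_sot_sum (\<lambda>\<alpha>. word_op X \<alpha> \<otimes>\<^sub>o A \<alpha>) {\<alpha>. length \<alpha> = k} (P k)" "P sums T"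
    by (rule fh_sumsE[OF assms(1)]) (rule that; assumption)
  obtain P' where P': "\<And>k. has_sot_sum (\<lambda>\<alpha>. word_op X \<alpha> \<otimes>\<^sub>o A \<alpha>) {\<alpha>. length \<alpha> = k} (P' k)" "P' sums T'"
    by (rule fh_sumsE[OF assms(2)]) (rule that; assumption)
  have "P = P'"
    by (rule ext, rule blinfun_eqI, rule has_sum_unique)
      (rule P(1)[unfolded has_sot_sum_def, rule_format], rule P'(1)[unfolded has_sot_sum_def, rule_format])
  then show ?thesis using P(2) P'(2) sums_unique2 by blast
qed

lemma fh_sums_cops:
  assumes "fh_sums A X T" "range A \<subseteq> cops" "range X \<subseteq> cops"
  shows "T \<in> cops"
proof -
  obtain P where P: "\<And>k. has_sot_sum (\<lambda>\<alpha>. word_op X \<alpha> \<otimes>\<^sub>o A \<alpha>) {\<alpha>. length \<alpha> = k} (P k)" "P sums T"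
    by (rule fh_sumsE[OF assms(1)]) (rule that; assumption)
  have "A \<alpha> \<in> cops" for \<alpha> using assms(2) by auto
  then have "P k \<in> cops" for k
    by (intro cops_has_sum[OF P(1)[of k, unfolded has_sot_sum_def, rule_format]] tensor_op_cops
        word_op_cops assms)
  then have "sum P {..<n} \<in> cops" for n by (intro cops_sum)
  then show ?thesis
    by (rule closed_sequentially[OF cops_closed _ P(2)[unfolded sums_def]])
qed

text \<open>An operator that intertwines the variables intertwines all words in them, and then the values of
every power series. All transfer between different Hilbert spaces rests on this.\<close>

lemma fh_sums_intertwine:
  fixes A :: "'n list \<Rightarrow> ('e::chilbert_space \<Rightarrow>\<^sub>L 'g::chilbert_space)" and q :: "'k::chilbert_space \<Rightarrow>\<^sub>L 'h::chilbert_space"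
  assumes A: "range A \<subseteq> cops" and X: "range X1 \<subseteq> cops" "range X2 \<subseteq> cops" and q: "q \<in> cops"
    and inter: "\<And>i. X2 i o\<^sub>L q = q o\<^sub>L X1 i"
    and T: "fh_sums A X1 T1" "fh_sums A X2 T2"
  shows "T2 o\<^sub>L (q \<otimes>\<^sub>o id_blinfun) = (q \<otimes>\<^sub>o id_blinfun) o\<^sub>L T1"
proof -
  obtain P1 where P1: "\<And>k. has_sot_sum (\<lambda>\<alpha>. word_op X1 \<alpha> \<otimes>\<^sub>o A \<alpha>) {\<alpha>. length \<alpha> = k} (P1 k)" "P1 sums T1"
    by (rule fh_sumsE[OF T(1)]) (rule that; assumption)
  obtain P2 where P2: "\<And>k. has_sot_sum (\<lambda>\<alpha>. word_op X2 \<alpha> \<otimes>\<^sub>o A \<alpha>) {\<alpha>. length \<alpha> = k} (P2 k)" "P2 sums T2"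
    by (rule fh_sumsE[OF T(2)]) (rule that; assumption)
  have Ac: "A \<alpha> \<in> cops" for \<alpha> using A by auto
  have words: "(word_op X2 \<alpha> \<otimes>\<^sub>o A \<alpha>) o\<^sub>L (q \<otimes>\<^sub>o id_blinfun) = (q \<otimes>\<^sub>o id_blinfun) o\<^sub>L (word_op X1 \<alpha> \<otimes>\<^sub>o A \<alpha>)" for \<alpha>
  proof -
    have [simp]: "A \<alpha> o\<^sub>L id_blinfun = A \<alpha>" "id_blinfun o\<^sub>L A \<alpha> = A \<alpha>" by (auto intro: blinfun_eqI)
    show ?thesis by (simp add: tensor_op_compose word_op_cops X q Ac word_op_intertwine[OF inter])
  qed
  have P: "P2 k o\<^sub>L (q \<otimes>\<^sub>o id_blinfun) = (q \<otimes>\<^sub>o id_blinfun) o\<^sub>L P1 k" for k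
  proof (rule blinfun_eqI, rule has_sum_unique)
    fix v
    let ?u = "(q \<otimes>\<^sub>o (id_blinfun :: 'e \<Rightarrow>\<^sub>L 'e)) v"
    show "((\<lambda>\<alpha>. (word_op X2 \<alpha> \<otimes>\<^sub>o A \<alpha>) ?u) has_sum (P2 k o\<^sub>L (q \<otimes>\<^sub>o id_blinfun)) v) {\<alpha>. length \<alpha> = k}"
      using P2(1)[of k] unfolding has_sot_sum_def by simp
    have "((\<lambda>\<alpha>. (q \<otimes>\<^sub>o id_blinfun) ((word_op X1 \<alpha> \<otimes>\<^sub>o A \<alpha>) v)) has_sum (q \<otimes>\<^sub>o id_blinfun) (P1 k v)) {\<alpha>. length \<alpha> = k}"
      using P1(1)[of k] unfolding has_sot_sum_def
      by (intro has_sum_bounded_linear[OF blinfun.bounded_linear_right]) blast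
    moreover have "(word_op X2 \<alpha> \<otimes>\<^sub>o A \<alpha>) ?u = (q \<otimes>\<^sub>o id_blinfun) ((word_op X1 \<alpha> \<otimes>\<^sub>o A \<alpha>) v)" for \<alpha>
      using arg_cong[OF words[of \<alpha>], of "\<lambda>S. blinfun_apply S v"] by simp
    ultimately show "((\<lambda>\<alpha>. (word_op X2 \<alpha> \<otimes>\<^sub>o A \<alpha>) ?u) has_sum ((q \<otimes>\<^sub>o id_blinfun) o\<^sub>L P1 k) v) {\<alpha>. length \<alpha> = k}"
      by simp
  qed
  have "(\<lambda>k. P2 k o\<^sub>L (q \<otimes>\<^sub>o id_blinfun)) sums (T2 o\<^sub>L (q \<otimes>\<^sub>o id_blinfun))"
    by (rule bounded_linear.sums[OF bounded_bilinear.bounded_linear_left[OF bounded_bilinear_blinfun_compose] P2(2)])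
  moreover have "(\<lambda>k. (q \<otimes>\<^sub>o id_blinfun) o\<^sub>L P1 k) sums ((q \<otimes>\<^sub>o id_blinfun) o\<^sub>L T1)"
    by (rule bounded_linear.sums[OF bounded_bilinear.bounded_linear_right[OF bounded_bilinear_blinfun_compose] P1(2)])
  ultimately show ?thesis unfolding P by (rule sums_unique2)
qed

text \<open>The series at \<open>X1\<close> is term by term the compression of the series at \<open>X2\<close> by \<open>q\<close>, so it inherits convergence.\<close>

lemma fh_sums_compress:
  fixes A :: "'n list \<Rightarrow> ('e::chilbert_space \<Rightarrow>\<^sub>L 'g::chilbert_space)" and q :: "'k::chilbert_space \<Rightarrow>\<^sub>L 'h::chilbert_space"
  assumes A: "range A \<subseteq> cops" and X: "range X1 \<subseteq> cops" "range X2 \<subseteq> cops"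
    and q: "q \<in> cops" "isometry_op q"
    and inter: "\<And>i. X2 i o\<^sub>L q = q o\<^sub>L X1 i"
    and T: "fh_sums A X2 T2"
  shows "fh_sums A X1 ((adj q \<otimes>\<^sub>o id_blinfun) o\<^sub>L T2 o\<^sub>L (q \<otimes>\<^sub>o id_blinfun))"
proof -
  obtain P where P: "\<And>k. has_sot_sum (\<lambda>\<alpha>. word_op X2 \<alpha> \<otimes>\<^sub>o A \<alpha>) {\<alpha>. length \<alpha> = k} (P k)" "P sums T2"
    by (rule fh_sumsE[OF T]) (rule that; assumption)
  have Ac: "A \<alpha> \<in> cops" for \<alpha> using A by auto
  have words: "(adj q \<otimes>\<^sub>o id_blinfun) o\<^sub>L (word_op X2 \<alpha> \<otimes>\<^sub>o A \<alpha>) o\<^sub>L (q \<otimes>\<^sub>o id_blinfun) = word_op X1 \<alpha> \<otimes>\<^sub>o A \<alpha>" for \<alpha>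
  proof -
    have [simp]: "A \<alpha> o\<^sub>L id_blinfun = A \<alpha>" "id_blinfun o\<^sub>L A \<alpha> = A \<alpha>" by (auto intro: blinfun_eqI)
    have "adj q o\<^sub>L word_op X2 \<alpha> o\<^sub>L q = adj q o\<^sub>L (q o\<^sub>L word_op X1 \<alpha>)"
      unfolding word_op_intertwine[OF inter, symmetric] by (rule blinfun_eqI) simp
    also have "\<dots> = word_op X1 \<alpha>" by (rule blinfun_eqI) (simp add: adj_isometry q)
    finally show ?thesis by (simp add: tensor_op_compose word_op_cops X q Ac cops_compose)
  qed
  show ?thesis
    unfolding fh_sums_def
  proof (intro exI conjI allI)
    show "(\<lambda>k. (adj q \<otimes>\<^sub>o id_blinfun) o\<^sub>L P k o\<^sub>L (q \<otimes>\<^sub>o id_blinfun)) sums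
        ((adj q \<otimes>\<^sub>o id_blinfun) o\<^sub>L T2 o\<^sub>L (q \<otimes>\<^sub>o id_blinfun))"
      by (rule bounded_linear.sums[OF bounded_bilinear.bounded_linear_left[OF bounded_bilinear_blinfun_compose]
            bounded_linear.sums[OF bounded_bilinear.bounded_linear_right[OF bounded_bilinear_blinfun_compose] P(2)]])
    fix k
    show "has_sot_sum (\<lambda>\<alpha>. word_op X1 \<alpha> \<otimes>\<^sub>o A \<alpha>) {\<alpha>. length \<alpha> = k}
      ((adj q \<otimes>\<^sub>o id_blinfun) o\<^sub>L P k o\<^sub>L (q \<otimes>\<^sub>o id_blinfun))"
      unfolding has_sot_sum_def words[symmetric] blinfun_apply_blinfun_compose
      using P(1)[of k] unfolding has_sot_sum_def
      by (intro allI has_sum_bounded_linear[OF blinfun.bounded_linear_right]) blast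
  qed
qed

section \<open>From the ball to the Fock space\<close>

lemma ray_exists: "\<exists>T. T \<in> cops \<and> (\<forall>z. blinfun_apply T z = z *\<^sub>C x)"
  by (rule clinear_blinfun_exists[of _ "norm x"])
    (auto simp: scaleC_add_left norm_scaleC scaleC_scaleC scaleC_complex_def)

text \<open>The vector \<open>x\<close> viewed as an operator on the scalars, so that orthonormal vectors become an
orthonormal family of isometries.\<close>

definition ray :: "'a::chilbert_space \<Rightarrow> (complex \<Rightarrow>\<^sub>L 'a)" where
  "ray x = (SOME T. T \<in> cops \<and> (\<forall>z. blinfun_apply T z = z *\<^sub>C x))"

lemma ray_cops [simp]: "ray x \<in> cops" and ray_apply [simp]: "ray x z = z *\<^sub>C x"
  using someI_ex[OF ray_exists[of x]] by (auto simp: ray_def)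

lemma isom_family_ray:
  assumes "\<And>i k. i \<in> I \<Longrightarrow> k \<in> I \<Longrightarrow> cinner (b i) (b k) = (if i = k then 1 else 0)"
  shows "isom_family I (\<lambda>i. ray (b i))"
  using assms by (simp add: isom_family_def cinner_add_simps cinner_complex_def)

text \<open>The orthonormal basis of the Fock space is countable, and an orthonormal basis of an
infinite-dimensional space contains a countably infinite set.\<close>

lemma fock_embeds:
  assumes "\<nexists>B::'h::chilbert_space set. finite B \<and> cspan B = UNIV"
  shows "\<exists>W :: 'n::countable fock \<Rightarrow>\<^sub>L 'h::chilbert_space. W \<in> cops \<and> isometry_op W"
proof -
  let ?B = "some_onb :: 'h set"
  have "infinite ?B"
  proof
    assume fin: "finite ?B"
    have "x \<in> cspan ?B" for x
    proof -
      have "x = (\<Sum>b\<in>?B. cinner b x *\<^sub>C b)"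
        using onb_expansion[OF some_onb, of x] fin has_sum_finite has_sum_unique by blast
      also have "\<dots> \<in> cspan ?B"
        by (intro complex_vector.span_sum complex_vector.span_scale complex_vector.span_base)
      finally show ?thesis .
    qed
    then show False using assms fin by blast
  qed
  then obtain f :: "nat \<Rightarrow> 'h" where f: "inj f" "range f \<subseteq> ?B"
    using infinite_countable_subset by blast
  define b where "b w = f (to_nat (w :: 'n list))" for w
  have fB: "f k \<in> ?B" for k using f(2) by blast
  have b: "cinner (b u) (b w) = (if u = w then 1 else 0)" for u w
    using orthonormal_some_onb[unfolded orthonormal_def, rule_format, OF fB fB]
    by (simp add: b_def inj_eq[OF f(1)])
  have "isom_family (UNIV :: 'n list set) (\<lambda>w. ray (fock_basis w))"
    by (rule isom_family_ray) (rule cinner_fock_basis_basis)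
  moreover have "isom_family (UNIV :: 'n list set) (\<lambda>w. ray (b w))"
    by (rule isom_family_ray) (rule b)
  ultimately obtain W :: "'n fock \<Rightarrow>\<^sub>L 'h" where W: "W \<in> cops"
    "\<And>w z. w \<in> UNIV \<Longrightarrow> W (ray (fock_basis w) z) = ray (b w) (id_blinfun z)"
    by (rule isom_family_transport[OF _ _ cops_id]) (rule that; assumption)
  have Wb: "W (fock_basis w) = b w" for w using W(2)[of w 1] by simp
  have "adj W (W (fock_basis w)) = fock_basis w" for w
    by (rule l2_eqI)
      (simp flip: cinner_fock_basis add: cinner_adj_right W(1) Wb b cinner_fock_basis_basis)
  then have "adj W o\<^sub>L W = id_blinfun"
    by (intro blinfun_eq_on_dense[OF _ _ _ fock_basis_total]) (auto simp: W cops_compose)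
  then have "adj W (W x) = x" for x by (metis blinfun_apply_blinfun_compose blinfun_apply_id_blinfun)
  then have "(norm (W x))\<^sup>2 = (norm x)\<^sup>2" for x
    unfolding norm_sq_cinner by (metis cinner_adj_right W(1))
  then have "isometry_op W" by (simp add: isometry_op_def)
  then show ?thesis using W(1) by blast
qed

lemma fh_coeff: "free_holomorphic F \<Longrightarrow> fh_expansion F (fh_coeff F)"
  using someI_ex[of "fh_expansion F"] by (simp add: free_holomorphic_def fh_coeff_def)

lemma fh_coeff_cops: "free_holomorphic F \<Longrightarrow> range (fh_coeff F) \<subseteq> cops"
  using fh_coeff[of F] by (simp add: fh_expansion_def)

lemma fh_coeff_sums: "free_holomorphic F \<Longrightarrow> X \<in> row_ball \<Longrightarrow> fh_sums (fh_coeff F) X (F X)"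
  using fh_coeff[of F] by (simp add: fh_expansion_def)

text \<open>The ball of an infinite-dimensional space contains a copy of \<open>r S\<close>, namely \<open>W r S W\<^sup>*\<close>.\<close>

lemma fock_model:
  assumes H: "\<nexists>B::'h::chilbert_space set. finite B \<and> cspan B = UNIV" and r: "0 \<le> r" "r < 1"
  obtains X :: "'n::countable \<Rightarrow> ('h::chilbert_space \<Rightarrow>\<^sub>L 'h)" and W :: "'n::countable fock \<Rightarrow>\<^sub>L 'h::chilbert_space"
  where "X \<in> row_ball" "W \<in> cops" "isometry_op W" "\<And>i. X i o\<^sub>L W = W o\<^sub>L (r *\<^sub>R creation i)"
proof -
  obtain W :: "'n fock \<Rightarrow>\<^sub>L 'h" where W: "W \<in> cops" "isometry_op W" using fock_embeds[OF H] by blast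
  show ?thesis
  proof (rule that[OF row_ball_conj[OF creation_row_ball[OF r] W] W])
    show "(W o\<^sub>L (r *\<^sub>R creation i) o\<^sub>L adj W) o\<^sub>L W = W o\<^sub>L (r *\<^sub>R creation i)" for i :: 'n
      by (rule blinfun_eqI) (simp add: adj_isometry W)
  qed
qed

lemma scaled_creation_cops: "range (\<lambda>i. r *\<^sub>R creation i) \<subseteq> cops"
  by (auto intro: cops_scaleR)

lemma row_ball_cops: "X \<in> row_ball \<Longrightarrow> range X \<subseteq> cops"
  by (simp add: row_ball_def)

lemma fh_eval_eqI: "fh_sums (fh_coeff F) X T \<Longrightarrow> fh_eval F X = T"
  unfolding fh_eval_def using fh_sums_unique by blast

lemma norm_tensor_id_le:
  fixes q :: "'k::chilbert_space \<Rightarrow>\<^sub>L 'h::chilbert_space"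
  assumes "q \<in> cops" "isometry_op q"
  shows "norm (q \<otimes>\<^sub>o (id_blinfun :: 'b::chilbert_space \<Rightarrow>\<^sub>L 'b)) \<le> 1"
    "norm (adj q \<otimes>\<^sub>o (id_blinfun :: 'b::chilbert_space \<Rightarrow>\<^sub>L 'b)) \<le> 1"
proof -
  have "norm q \<le> 1" using assms(2) by (intro norm_blinfun_bound) (auto simp: isometry_op_def)
  then have "norm q * norm (id_blinfun :: 'b \<Rightarrow>\<^sub>L 'b) \<le> 1 * 1"
    by (intro mult_mono norm_blinfun_id_le) auto
  then show "norm (q \<otimes>\<^sub>o (id_blinfun :: 'b \<Rightarrow>\<^sub>L 'b)) \<le> 1" "norm (adj q \<otimes>\<^sub>o (id_blinfun :: 'b \<Rightarrow>\<^sub>L 'b)) \<le> 1"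
    using norm_tensor_op_le[of q "id_blinfun :: 'b \<Rightarrow>\<^sub>L 'b"]
      norm_tensor_op_le[of "adj q" "id_blinfun :: 'b \<Rightarrow>\<^sub>L 'b"]
    by (simp_all add: norm_adj assms(1))
qed

section \<open>A square root of the defect operator\<close>

text \<open>The square root is \<open>D = I - Y\<close>, where \<open>Y = (Q + Y\<^sup>2) / 2\<close>: then \<open>(I - Y)\<^sup>2 = I - 2 Y + Y\<^sup>2 = I - Q\<close>. On the self-adjoint
operators of norm at most \<open>c = 1 - sqrt (1 - \<parallel>Q\<parallel>)\<close>, the smaller solution of the scalar equation, the
right-hand side is a contraction with constant \<open>c < 1\<close>, so Banach's fixed point theorem applies.\<close>

lemma sqrt_one_minus_exists:
  fixes Q :: "'a::chilbert_space \<Rightarrow>\<^sub>L 'a"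
  assumes Q: "Q \<in> cops" "\<And>x y. cinner x (Q y) = cnj (cinner y (Q x))" "norm Q < 1"
  shows "\<exists>D::'a \<Rightarrow>\<^sub>L 'a. D \<in> cops \<and> (\<forall>x y. cinner x (D y) = cinner (D x) y) \<and> D o\<^sub>L D = id_blinfun - Q"
proof -
  define c where "c = 1 - sqrt (1 - norm Q)"
  have "sqrt (1 - norm Q) * sqrt (1 - norm Q) = 1 - norm Q" using Q(3) by simp
  then have c: "0 \<le> c" "c < 1" "(norm Q + c * c) / 2 = c"
    using Q(3) by (simp_all add: c_def field_simps)
  define M where "M = {Y::'a \<Rightarrow>\<^sub>L 'a. Y \<in> cops \<and> (\<forall>x y. cinner x (Y y) = cnj (cinner y (Y x)))} \<inter> cball 0 c"
  have MD: "Y \<in> cops" "cinner x (Y y) = cnj (cinner y (Y x))" "norm Y \<le> c" if "Y \<in> M" for Y x y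
  proof -
    have "Y \<in> cops \<and> (\<forall>x y. cinner x (Y y) = cnj (cinner y (Y x))) \<and> Y \<in> cball 0 c"
      using that unfolding M_def by blast
    then show "Y \<in> cops" "cinner x (Y y) = cnj (cinner y (Y x))" "norm Y \<le> c"
      using mem_cball_0 by blast+
  qed
  let ?f = "\<lambda>Y::'a \<Rightarrow>\<^sub>L 'a. (1/2) *\<^sub>R (Q + (Y o\<^sub>L Y))"
  have bl: "bounded_linear (\<lambda>Y::'a \<Rightarrow>\<^sub>L 'a. cinner x (Y y))" for x y
    by (intro bounded_linear_compose[OF bounded_linear_cinner_right] blinfun.bounded_linear_left)
  have "\<exists>!Y. Y \<in> M \<and> ?f Y = Y"
  proof (rule Banach_fix[OF _ _ c(1,2)])
    have "closed {Y::'a \<Rightarrow>\<^sub>L 'a. \<forall>x y. cinner x (Y y) = cnj (cinner y (Y x))}"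
      by (intro closed_Collect_all closed_Collect_eq linear_continuous_on continuous_on_cnj bl)
    then show "complete M"
      unfolding complete_eq_closed M_def Collect_conj_eq using cops_closed by (intro closed_Int closed_cball) auto
    have "0 \<in> M" using c(1) by (simp add: M_def cinner_simps)
    then show "M \<noteq> {}" by blast
    show "?f ` M \<subseteq> M"
    proof (rule image_subsetI)
      fix Y assume "Y \<in> M"
      note Y = MD[OF this]
      have sym: "cinner x (Y (Y y)) = cnj (cinner y (Y (Y x)))" for x y
        using Y(2)[of x "Y y"] Y(2)[of y "Y x"] cinner_commute[of "Y y" "Y x"] by simp
      have "norm (?f Y) \<le> (norm Q + norm (Y o\<^sub>L Y)) / 2"
        using norm_triangle_ineq[of Q "Y o\<^sub>L Y"] by simp
      also have "\<dots> \<le> (norm Q + c * c) / 2"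
        using norm_blinfun_compose[of Y Y] mult_mono[OF Y(3) Y(3) c(1)] by simp
      finally have n: "norm (?f Y) \<le> c" using c(3) by simp
      have h: "cinner x ((?f Y) y) = cnj (cinner y ((?f Y) x))" for x y
        using Q(2)[of x y] sym[of x y]
        by (simp add: blinfun.scaleR_left blinfun.add_left cinner_add_simps)
      have "?f Y \<in> cops" by (intro cops_scaleR cops_add cops_compose Q Y)
      then show "?f Y \<in> M" unfolding M_def using h n mem_cball_0 by blast
    qed
    show "dist (?f Y) (?f Z) \<le> c * dist Y Z" if "Y \<in> M" "Z \<in> M" for Y Z
    proof -
      have n: "norm Y \<le> c" "norm Z \<le> c" using that MD(3) by blast+
      have "?f Y - ?f Z = (1/2) *\<^sub>R ((Y o\<^sub>L (Y - Z)) + ((Y - Z) o\<^sub>L Z))"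
        by (rule blinfun_eqI) (simp add: blinfun.bilinear_simps algebra_simps)
      then have "dist (?f Y) (?f Z) \<le> (norm (Y o\<^sub>L (Y - Z)) + norm ((Y - Z) o\<^sub>L Z)) / 2"
        using norm_triangle_ineq[of "Y o\<^sub>L (Y - Z)" "(Y - Z) o\<^sub>L Z"] by (simp add: dist_norm)
      also have "\<dots> \<le> (c * norm (Y - Z) + norm (Y - Z) * c) / 2"
        using order_trans[OF norm_blinfun_compose mult_right_mono[OF n(1)], of "Y - Z"]
          order_trans[OF norm_blinfun_compose mult_left_mono[OF n(2)], of "Y - Z"]
        by (simp add: mult.commute[of "norm (Y - Z)" c])
      finally show ?thesis by (simp add: dist_norm)
    qed
  qed
  then obtain Y where Y: "Y \<in> M" "?f Y = Y" by blast
  have Yx: "2 *\<^sub>R Y x = Q x + Y (Y x)" for x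
    using arg_cong[OF Y(2), of "\<lambda>S. 2 *\<^sub>R blinfun_apply S x"]
    by (simp add: blinfun.scaleR_left blinfun.add_left)
  let ?D = "id_blinfun - Y"
  have "?D o\<^sub>L ?D = id_blinfun - Q"
    using Yx by (intro blinfun_eqI) (simp add: blinfun.bilinear_simps algebra_simps scaleR_2)
  moreover have "cinner x (?D y) = cinner (?D x) y" for x y
  proof -
    have "cinner x (Y y) = cnj (cinner y (Y x))" by (rule MD(2)[OF Y(1)])
    then show ?thesis by (simp add: blinfun.diff_left cinner_simps flip: cinner_commute)
  qed
  moreover have "?D \<in> cops" by (rule cops_diff[OF cops_id MD(1)[OF Y(1)]])
  ultimately show ?thesis by blast
qed

section \<open>The Poisson kernel of a strict row contraction\<close>

type_synonym ('n, 'e, 'g) fock_op = "('n fock, 'e) htensor \<Rightarrow>\<^sub>L ('n fock, 'g) htensor"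

text \<open>For \<open>Q = \<Sum>\<^sub>i X\<^sub>i X\<^sub>i\<^sup>*\<close> the defect operator is \<open>D = (I - Q)\<^bsup>1/2\<^esup>\<close>, and \<open>a = \<langle>h, Q h\<rangle>\<close>.\<close>

lemma defect_operator:
  fixes X :: "'n \<Rightarrow> ('k::chilbert_space \<Rightarrow>\<^sub>L 'k)"
  assumes X: "X \<in> row_ball"
  obtains D :: "'k \<Rightarrow>\<^sub>L 'k" and q :: real where "D \<in> cops" "0 \<le> q" "q < 1"
    "\<And>h. \<exists>a. ((\<lambda>i. (norm (adj (X i) h))\<^sup>2) has_sum a) UNIV \<and> a \<le> q * (norm h)\<^sup>2 \<and>
      (norm (D h))\<^sup>2 = (norm h)\<^sup>2 - a"
proof -
  obtain Q :: "'k \<Rightarrow>\<^sub>L 'k" where Q: "range X \<subseteq> cops" "\<And>h. ((\<lambda>i. X i (adj (X i) h)) has_sum Q h) UNIV" "norm Q < 1"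
    by (rule row_ballD[OF X]) (rule that; assumption)
  have Xc: "X i \<in> cops" for i using Q(1) by auto
  have Qc: "Q \<in> cops"
    by (rule cops_has_sum[where T="\<lambda>i. X i o\<^sub>L adj (X i)" and A=UNIV])
      (simp_all add: Q(2) cops_compose Xc)
  have form: "((\<lambda>i. cinner (adj (X i) x) (adj (X i) y)) has_sum cinner x (Q y)) UNIV" for x y
    using has_sum_cinner_right[OF Q(2)[of y], of x] by (simp add: cinner_adj_left Xc)
  have sym: "cinner x (Q y) = cnj (cinner y (Q x))" for x y
  proof (rule has_sum_unique[OF form])
    have "((\<lambda>i. cnj (cinner (adj (X i) y) (adj (X i) x))) has_sum cnj (cinner y (Q x))) UNIV"
      by (simp add: form)
    then show "((\<lambda>i. cinner (adj (X i) x) (adj (X i) y)) has_sum cnj (cinner y (Q x))) UNIV"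
      by (simp flip: cinner_commute)
  qed
  obtain D where D: "D \<in> cops" "\<And>x y. cinner x (D y) = cinner (D x) y" "D o\<^sub>L D = id_blinfun - Q"
    using sqrt_one_minus_exists[OF Qc sym Q(3)] by blast
  show ?thesis
  proof (rule that[OF D(1) _ Q(3)])
    fix h
    have "((\<lambda>i. (norm (adj (X i) h))\<^sup>2) has_sum Re (cinner h (Q h))) UNIV"
      using has_sum_Re[OF form[of h h]] by (simp add: norm_sq_cinner)
    moreover have "Re (cinner h (Q h)) \<le> norm Q * (norm h)\<^sup>2"
    proof -
      have "Re (cinner h (Q h)) \<le> norm h * norm (Q h)" by (rule Re_cinner_le)
      also have "\<dots> \<le> norm h * (norm Q * norm h)" by (intro mult_left_mono norm_blinfun) simp
      finally show ?thesis by (simp add: power2_eq_square mult_ac)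
    qed
    moreover have "(norm (D h))\<^sup>2 = (norm h)\<^sup>2 - Re (cinner h (Q h))"
    proof -
      have "D (D h) = h - Q h"
        using arg_cong[OF D(3), of "\<lambda>S. blinfun_apply S h"] by (simp add: blinfun.diff_left)
      then show ?thesis unfolding norm_sq_cinner by (simp add: cinner_simps flip: D(2))
    qed
    ultimately show "\<exists>a. ((\<lambda>i. (norm (adj (X i) h))\<^sup>2) has_sum a) UNIV \<and> a \<le> norm Q * (norm h)\<^sup>2 \<and>
      (norm (D h))\<^sup>2 = (norm h)\<^sup>2 - a" by blast
  qed simp
qed

text \<open>Since \<open>\<parallel>D h\<parallel>\<^sup>2 = \<parallel>h\<parallel>\<^sup>2 - \<Sum>\<^sub>i \<parallel>X\<^sub>i\<^sup>* h\<parallel>\<^sup>2\<close>, the sum of \<open>\<parallel>D X\<^sub>w\<^sup>* h\<parallel>\<^sup>2\<close> over the words shorter than \<open>N\<close> telescopes. What is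
left over is \<open>s = \<Sum> \<parallel>X\<^sub>w\<^sup>* h\<parallel>\<^sup>2\<close> over the words of length \<open>N\<close>, which decays geometrically because the row
contraction is strict. The induction splits off the first letter.\<close>

lemma defect_telescope:
  fixes D :: "'k::chilbert_space \<Rightarrow>\<^sub>L 'k" and X :: "'n \<Rightarrow> ('k::chilbert_space \<Rightarrow>\<^sub>L 'k)"
  assumes X: "range X \<subseteq> cops" and D: "D \<in> cops" and q: "0 \<le> q"
    and defect: "\<And>h. \<exists>a. ((\<lambda>i. (norm (adj (X i) h))\<^sup>2) has_sum a) UNIV \<and> a \<le> q * (norm h)\<^sup>2 \<and>
      (norm (D h))\<^sup>2 = (norm h)\<^sup>2 - a"
  shows "\<exists>s\<ge>0. s \<le> q ^ N * (norm h)\<^sup>2 \<and>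
    ((\<lambda>w. (norm (D (adj (word_op X w) h)))\<^sup>2) has_sum ((norm h)\<^sup>2 - s)) {w. length w < N}"
proof (induction N arbitrary: h)
  case 0
  show ?case by (intro exI[of _ "(norm h)\<^sup>2"]) simp
next
  case (Suc N)
  let ?g = "\<lambda>w h. (norm (D (adj (word_op X w) h)))\<^sup>2" and ?h = "\<lambda>i. adj (X i) h"
  have Xc: "X i \<in> cops" for i using X by auto
  obtain a where a: "((\<lambda>i. (norm (?h i))\<^sup>2) has_sum a) UNIV" "a \<le> q * (norm h)\<^sup>2"
    "(norm (D h))\<^sup>2 = (norm h)\<^sup>2 - a"
    using defect[of h] by blast
  have "\<forall>i. \<exists>s\<ge>0. s \<le> q ^ N * (norm (?h i))\<^sup>2 \<and>
      ((\<lambda>w. ?g w (?h i)) has_sum ((norm (?h i))\<^sup>2 - s)) {w. length w < N}"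
    by (rule allI) (rule Suc.IH)
  from choice[OF this] obtain s where s: "\<forall>i. 0 \<le> s i \<and> s i \<le> q ^ N * (norm (?h i))\<^sup>2 \<and>
      ((\<lambda>w. ?g w (?h i)) has_sum ((norm (?h i))\<^sup>2 - s i)) {w. length w < N}"
    by (rule exE)
  have up: "((\<lambda>i. q ^ N * (norm (?h i))\<^sup>2) has_sum q ^ N * a) UNIV"
    by (rule has_sum_cmult_right[OF a(1)])
  have "s summable_on UNIV"
    by (rule summable_on_comparison_test[OF has_sum_imp_summable[OF up]]) (use s in simp_all)
  then obtain t where t: "(s has_sum t) UNIV" by (auto simp: summable_on_def)
  have "t \<le> q ^ N * a" by (rule has_sum_mono[OF t up]) (use s in simp)
  also have "\<dots> \<le> q ^ Suc N * (norm h)\<^sup>2"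
    using mult_left_mono[OF a(2), of "q ^ N"] q by (simp add: mult_ac)
  finally have t_le: "t \<le> q ^ Suc N * (norm h)\<^sup>2" .
  have t0: "0 \<le> t" by (rule has_sum_nonneg[OF t]) (use s in simp)
  have "((\<lambda>i. (norm (?h i))\<^sup>2 + - s i) has_sum (a + - t)) UNIV"
    by (intro has_sum_add a has_sum_uminusI t)
  then have rows: "((\<lambda>i. (norm (?h i))\<^sup>2 - s i) has_sum (a - t)) UNIV" by simp
  have "((\<lambda>(i, w). ?g w (?h i)) has_sum (a - t)) (UNIV \<times> {w. length w < N})"
  proof (rule has_sum_SigmaI[OF _ rows])
    show "((\<lambda>w. case (i, w) of (i, w) \<Rightarrow> ?g w (?h i)) has_sum ((norm (?h i))\<^sup>2 - s i)) {w. length w < N}" for i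
      using s by simp
    then show "(\<lambda>(i, w). ?g w (?h i)) summable_on UNIV \<times> {w. length w < N}"
      by (rule summable_on_SigmaI[OF _ has_sum_imp_summable[OF rows]]) auto
  qed
  then have "(((\<lambda>w. ?g w h) \<circ> (\<lambda>(i, w). i # w)) has_sum (a - t)) (UNIV \<times> {w. length w < N})"
    by (simp add: o_def case_prod_unfold adj_compose Xc word_op_cops X)
  then have "((\<lambda>w. ?g w h) has_sum (a - t)) ((\<lambda>(i, w). i # w) ` (UNIV \<times> {w. length w < N}))"
    by (subst has_sum_reindex) (auto simp: inj_on_def)
  then have "((\<lambda>w. ?g w h) has_sum (?g [] h + (a - t)))
      (insert [] ((\<lambda>(i, w). i # w) ` (UNIV \<times> {w. length w < N})))"
    by (intro has_sum_insert) auto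
  moreover have "insert [] ((\<lambda>(i, w). i # w) ` ((UNIV :: 'n set) \<times> {w. length w < N})) = {w. length w < Suc N}"
  proof (intro equalityI subsetI)
    fix w :: "'n list" assume "w \<in> {w. length w < Suc N}"
    then show "w \<in> insert [] ((\<lambda>(i, w). i # w) ` (UNIV \<times> {w. length w < N}))"
      by (cases w) auto
  qed auto
  moreover have "?g [] h + (a - t) = (norm h)\<^sup>2 - t" using a(3) by (simp add: adj_id)
  ultimately have "((\<lambda>w. ?g w h) has_sum ((norm h)\<^sup>2 - t)) {w. length w < Suc N}" by metis
  then show ?case using t0 t_le by blast
qed

text \<open>The Poisson kernel is the isometry \<open>h \<mapsto> \<Sum>\<^sub>w e\<^sub>w \<otimes> D X\<^sub>w\<^sup>* h\<close> into the tensor product of the Fock space with the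
given space. Its slice at a basis vector \<open>d\<close> of the second factor is \<open>p\<^sub>d h = \<Sum>\<^sub>w \<langle>d, D X\<^sub>w\<^sup>* h\<rangle> e\<^sub>w\<close>. Working with
the slices avoids threefold tensor products. They satisfy \<open>p\<^sub>d X\<^sub>i\<^sup>* = S\<^sub>i\<^sup>* p\<^sub>d\<close>, since
\<open>D X\<^sub>w\<^sup>* X\<^sub>i\<^sup>* = D X\<^sub>i\<^sub>w\<^sup>*\<close>.\<close>

lemma poisson_kernel:
  fixes X :: "'n \<Rightarrow> ('k::chilbert_space \<Rightarrow>\<^sub>L 'k)"
  assumes X: "X \<in> row_ball"
  obtains p :: "'k \<Rightarrow> ('k \<Rightarrow>\<^sub>L 'n fock)"
    where "\<And>d. d \<in> some_onb \<Longrightarrow> p d \<in> cops"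
      "\<And>d i. d \<in> some_onb \<Longrightarrow> X i o\<^sub>L adj (p d) = adj (p d) o\<^sub>L creation i"
      "\<And>h. ((\<lambda>d. (norm (p d h))\<^sup>2) has_sum (norm h)\<^sup>2) some_onb"
proof -
  obtain D :: "'k \<Rightarrow>\<^sub>L 'k" and q :: real where D: "D \<in> cops" and q: "0 \<le> q" "q < 1" and defect:
    "\<And>h. \<exists>a. ((\<lambda>i. (norm (adj (X i) h))\<^sup>2) has_sum a) UNIV \<and> a \<le> q * (norm h)\<^sup>2 \<and>
      (norm (D h))\<^sup>2 = (norm h)\<^sup>2 - a"
    by (rule defect_operator[OF X]) (rule that; assumption)
  have Xc: "range X \<subseteq> cops" using X by (rule row_ball_cops)
  then have Xi: "X i \<in> cops" for i by auto
  have wc: "word_op X w \<in> cops" for w by (rule word_op_cops[OF Xc])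
  let ?v = "\<lambda>w h. D (adj (word_op X w) h)"
  have total: "((\<lambda>w. (norm (?v w h))\<^sup>2) has_sum (norm h)\<^sup>2) UNIV" for h
  proof -
    have "\<forall>N. \<exists>s\<ge>0. s \<le> q ^ N * (norm h)\<^sup>2 \<and>
        ((\<lambda>w. (norm (?v w h))\<^sup>2) has_sum ((norm h)\<^sup>2 - s)) {w. length w < N}"
      by (rule allI) (rule defect_telescope[OF Xc D q(1) defect])
    from choice[OF this] obtain s where s': "\<forall>N. 0 \<le> s N \<and> s N \<le> q ^ N * (norm h)\<^sup>2 \<and>
        ((\<lambda>w. (norm (?v w h))\<^sup>2) has_sum ((norm h)\<^sup>2 - s N)) {w. length w < N}"
      by (rule exE)
    have s: "0 \<le> s N" "s N \<le> q ^ N * (norm h)\<^sup>2"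
      "((\<lambda>w. (norm (?v w h))\<^sup>2) has_sum ((norm h)\<^sup>2 - s N)) {w. length w < N}" for N
      using s' by simp_all
    have bound: "(\<Sum>w\<in>J. (norm (?v w h))\<^sup>2) \<le> (norm h)\<^sup>2" if J: "finite J" for J :: "'n list set"
    proof -
      obtain N where N: "\<And>w. w \<in> J \<Longrightarrow> length w < N"
        using finite_nat_set_iff_bounded[THEN iffD1, OF finite_imageI[OF J, of length]] by blast
      have "(\<Sum>w\<in>J. (norm (?v w h))\<^sup>2) \<le> (norm h)\<^sup>2 - s N"
        by (rule finite_sum_le_has_sum[OF s(3)]) (use N J in auto)
      then show ?thesis using s(1)[of N] by linarith
    qed
    have "(\<lambda>w. (norm (?v w h))\<^sup>2) summable_on UNIV"
      by (intro nonneg_bdd_above_summable_on bdd_aboveI2[where M="(norm h)\<^sup>2"]) (auto intro: bound)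
    then obtain S where S: "((\<lambda>w. (norm (?v w h))\<^sup>2) has_sum S) UNIV" by (auto simp: summable_on_def)
    have "S \<le> (norm h)\<^sup>2" by (rule has_sum_le_finite_sums[OF S]) (rule bound)
    moreover have "(norm h)\<^sup>2 \<le> S"
    proof (rule tendsto_upperbound)
      have "(\<lambda>N. (norm h)\<^sup>2 - q ^ N * (norm h)\<^sup>2) \<longlonglongrightarrow> (norm h)\<^sup>2 - 0 * (norm h)\<^sup>2"
        using q by (intro tendsto_intros LIMSEQ_realpow_zero)
      then show "(\<lambda>N. (norm h)\<^sup>2 - q ^ N * (norm h)\<^sup>2) \<longlonglongrightarrow> (norm h)\<^sup>2" by simp
      have "(norm h)\<^sup>2 - s N \<le> S" for N by (rule has_sum_mono'[OF s(3) S]) auto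
      then show "\<forall>\<^sub>F N in sequentially. (norm h)\<^sup>2 - q ^ N * (norm h)\<^sup>2 \<le> S"
        using s(2) by (intro always_eventually allI) (smt (verit))
    qed simp
    ultimately show ?thesis using S by simp
  qed
  have dn: "(cmod (cinner d x))\<^sup>2 \<le> (norm x)\<^sup>2" if "d \<in> some_onb" for d x :: 'k
  proof -
    have "(norm d)\<^sup>2 = 1"
      unfolding norm_sq_cinner
      using orthonormal_some_onb[unfolded orthonormal_def, rule_format, OF that that] by simp
    then have "norm d = 1" using norm_ge_zero[of d] by (auto simp: power2_eq_1_iff)
    then show ?thesis using cmod_cinner_le[of d x] by (simp add: power_mono)
  qed
  have coords: "(\<lambda>w. (norm (cinner d (?v w h)))\<^sup>2) summable_on UNIV" if "d \<in> some_onb" for d h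
    by (rule summable_on_comparison_test[OF has_sum_imp_summable[OF total[of h]]]) (use dn that in auto)
  have "\<exists>T::'k \<Rightarrow>\<^sub>L 'n fock. T \<in> cops \<and> (\<forall>h w. l2_nth (T h) w = cinner d (?v w h))"
    if d: "d \<in> some_onb" for d
  proof -
    let ?f = "\<lambda>h. Abs_l2 (\<lambda>w. cinner d (?v w h))"
    have nth: "l2_nth (?f h) w = cinner d (?v w h)" for h w
      using coords[OF d] by (simp add: Abs_l2_inverse)
    have "norm (?f h) \<le> 1 * norm h" for h
    proof (rule power2_le_imp_le)
      have "(norm (?f h))\<^sup>2 = (\<Sum>\<^sub>\<infinity>w. (norm (cinner d (?v w h)))\<^sup>2)" by (simp add: norm_l2_sq nth)
      also have "\<dots> \<le> (\<Sum>\<^sub>\<infinity>w. (norm (?v w h))\<^sup>2)"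
        by (intro infsum_mono coords d has_sum_imp_summable[OF total] dn)
      also have "\<dots> = (norm h)\<^sup>2" by (rule infsumI[OF total])
      finally show "(norm (?f h))\<^sup>2 \<le> (1 * norm h)\<^sup>2" by simp
    qed simp
    moreover have "?f (x + y) = ?f x + ?f y" for x y
      by (rule l2_eqI, unfold plus_l2.rep_eq nth) (simp add: blinfun.add_right cinner_add_simps)
    moreover have "?f (c *\<^sub>C x) = c *\<^sub>C ?f x" for c x
      by (rule l2_eqI, unfold scaleC_l2.rep_eq nth)
        (simp add: scaleC_complex_def copsD D wc cinner_add_simps)
    ultimately obtain T :: "'k \<Rightarrow>\<^sub>L 'n fock" where "T \<in> cops" "\<And>h. T h = ?f h"
      using clinear_blinfun_exists[of ?f 1] by blast
    then show ?thesis using nth by auto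
  qed
  then have "\<forall>d\<in>some_onb. \<exists>T::'k \<Rightarrow>\<^sub>L 'n fock. T \<in> cops \<and> (\<forall>h w. l2_nth (T h) w = cinner d (?v w h))"
    by (rule ballI)
  from bchoice[OF this] obtain p :: "'k \<Rightarrow> ('k \<Rightarrow>\<^sub>L 'n fock)" where
    p': "\<forall>d\<in>some_onb. p d \<in> cops \<and> (\<forall>h w. l2_nth (p d h) w = cinner d (?v w h))"
    by (rule exE)
  have p: "p d \<in> cops" "l2_nth (p d h) w = cinner d (?v w h)" if "d \<in> some_onb" for d h w
    using p' that by simp_all
  show ?thesis
  proof (rule that[OF p(1)])
    fix d i assume d: "d \<in> (some_onb :: 'k set)"
    show "X i o\<^sub>L adj (p d) = adj (p d) o\<^sub>L creation i"
    proof (rule blinfun_eq_on_dense[OF _ _ _ fock_basis_total])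
      fix \<phi> :: "'n fock" assume "\<phi> \<in> range fock_basis"
      then obtain w where w: "\<phi> = fock_basis w" by blast
      have "cinner x (X i (adj (p d) (fock_basis w))) = cinner x (adj (p d) (fock_basis (i # w)))" for x
      proof -
        have "cinner x (X i (adj (p d) (fock_basis w))) = cinner (p d (adj (X i) x)) (fock_basis w)"
          by (simp add: cinner_adj_right p d flip: cinner_adj_left[OF Xi])
        also have "\<dots> = cinner (p d x) (fock_basis (i # w))"
          by (simp add: cinner_commute[of _ "fock_basis _"] cinner_fock_basis p d adj_compose Xi wc)
        also have "\<dots> = cinner x (adj (p d) (fock_basis (i # w)))"
          by (simp add: cinner_adj_right p d)
        finally show ?thesis .
      qed
      then show "(X i o\<^sub>L adj (p d)) \<phi> = (adj (p d) o\<^sub>L creation i) \<phi>"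
        unfolding w by (simp add: creation_fock_basis) (rule cinner_ext)
    qed (auto intro: cops_compose simp: Xi p d)
  next
    fix h
    show "((\<lambda>d. (norm (p d h))\<^sup>2) has_sum (norm h)\<^sup>2) some_onb"
    proof (rule has_sum_swap_nonneg[OF _ total[of h]])
      fix w
      have "((\<lambda>d. Re (cnj (cinner d (?v w h)) * cinner d (?v w h))) has_sum Re (cinner (?v w h) (?v w h))) some_onb"
        by (rule has_sum_Re[OF parseval[OF some_onb]])
      moreover have "Re (cnj z * z) = (cmod z)\<^sup>2" for z by (simp add: cmod_def power2_eq_square)
      ultimately show "((\<lambda>d. (cmod (cinner d (?v w h)))\<^sup>2) has_sum (norm (?v w h))\<^sup>2) some_onb"
        by (simp add: norm_sq_cinner)
    next
      fix d assume d: "d \<in> (some_onb :: 'k set)"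
      show "((\<lambda>w. (cmod (cinner d (?v w h)))\<^sup>2) has_sum (norm (p d h))\<^sup>2) UNIV"
        unfolding norm_l2_sq using has_sum_infsum[OF l2_summable[of "p d h"]] by (simp add: p(2)[OF d])
    qed simp
  qed
qed

text \<open>The adjoint of the hypothesis for \<open>q = p\<^sub>d\<^sup>*\<close> is \<open>(p\<^sub>d \<otimes> I) Z\<^sup>* = T\<^sup>* (p\<^sub>d \<otimes> I)\<close>. As \<open>\<parallel>v\<parallel>\<^sup>2 = \<Sum>\<^sub>d \<parallel>(p\<^sub>d \<otimes> I) v\<parallel>\<^sup>2\<close>, this
gives \<open>\<parallel>Z\<^sup>* y\<parallel>\<^sup>2 \<le> \<parallel>T\<parallel>\<^sup>2 \<parallel>y\<parallel>\<^sup>2\<close>. The hypothesis is left abstract because \<open>T\<close> is used both as the value of a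
series at \<open>r S\<close> and as a boundary value, which need not be the value of a norm convergent series.\<close>

lemma von_neumann_inequality:
  fixes X :: "'n \<Rightarrow> ('k::chilbert_space \<Rightarrow>\<^sub>L 'k)"
    and Z :: "('k, 'e::chilbert_space) htensor \<Rightarrow>\<^sub>L ('k, 'g::chilbert_space) htensor"
    and T :: "('n, 'e, 'g) fock_op"
  assumes X: "X \<in> row_ball" and ZT: "Z \<in> cops" "T \<in> cops"
    and inter: "\<And>q :: 'n fock \<Rightarrow>\<^sub>L 'k. q \<in> cops \<Longrightarrow> (\<And>i. X i o\<^sub>L q = q o\<^sub>L creation i) \<Longrightarrow>
      Z o\<^sub>L (q \<otimes>\<^sub>o id_blinfun) = (q \<otimes>\<^sub>o id_blinfun) o\<^sub>L T"
  shows "norm Z \<le> norm T"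
proof -
  obtain p :: "'k \<Rightarrow> ('k \<Rightarrow>\<^sub>L 'n fock)"
    where pc: "\<And>d. d \<in> some_onb \<Longrightarrow> p d \<in> cops"
      and pX: "\<And>d i. d \<in> some_onb \<Longrightarrow> X i o\<^sub>L adj (p d) = adj (p d) o\<^sub>L creation i"
      and pn: "\<And>h. ((\<lambda>d. (norm (p d h))\<^sup>2) has_sum (norm h)\<^sup>2) some_onb"
    by (rule poisson_kernel[OF X]) (rule that; assumption)
  have eq: "(p d \<otimes>\<^sub>o id_blinfun) (adj Z y) = adj T ((p d \<otimes>\<^sub>o id_blinfun) y)" if d: "d \<in> some_onb" for d y
  proof -
    have "adj (Z o\<^sub>L (adj (p d) \<otimes>\<^sub>o id_blinfun)) = adj ((adj (p d) \<otimes>\<^sub>o id_blinfun) o\<^sub>L T)"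
      using inter[OF adj_cops[OF pc[OF d]] pX[OF d]] by simp
    then have "(p d \<otimes>\<^sub>o id_blinfun) o\<^sub>L adj Z = adj T o\<^sub>L (p d \<otimes>\<^sub>o id_blinfun)"
      by (simp add: adj_compose ZT tensor_op_cops adj_tensor_op adj_adj adj_id pc d)
    from arg_cong[OF this, of "\<lambda>S. blinfun_apply S y"] show ?thesis by simp
  qed
  have "norm (adj Z) \<le> norm T"
  proof (rule norm_blinfun_bound)
    fix y
    have "(norm (adj Z y))\<^sup>2 \<le> (norm T)\<^sup>2 * (norm y)\<^sup>2"
    proof (rule has_sum_mono)
      show "((\<lambda>d. (norm ((p d \<otimes>\<^sub>o id_blinfun) (adj Z y)))\<^sup>2) has_sum (norm (adj Z y))\<^sup>2) some_onb"
        by (rule norm_sq_tensor_partition[OF pc pn])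
      show "((\<lambda>d. (norm T)\<^sup>2 * (norm ((p d \<otimes>\<^sub>o id_blinfun) y))\<^sup>2) has_sum (norm T)\<^sup>2 * (norm y)\<^sup>2) some_onb"
        by (intro has_sum_cmult_right norm_sq_tensor_partition[OF pc pn])
      fix d assume d: "d \<in> (some_onb :: 'k set)"
      have "norm (adj T ((p d \<otimes>\<^sub>o id_blinfun) y)) \<le> norm T * norm ((p d \<otimes>\<^sub>o id_blinfun) y)"
        using norm_blinfun[of "adj T"] by (simp add: norm_adj ZT)
      then show "(norm ((p d \<otimes>\<^sub>o id_blinfun) (adj Z y)))\<^sup>2 \<le> (norm T)\<^sup>2 * (norm ((p d \<otimes>\<^sub>o id_blinfun) y))\<^sup>2"
        unfolding eq[OF d] power_mult_distrib[symmetric] by (intro power_mono) auto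
    qed
    then have "(norm (adj Z y))\<^sup>2 \<le> (norm T * norm y)\<^sup>2" by (simp add: power_mult_distrib)
    then show "norm (adj Z y) \<le> norm T * norm y" by (rule power2_le_imp_le) simp
  qed simp
  then show ?thesis by (simp add: norm_adj ZT)
qed

lemma von_neumann_series:
  assumes X: "X \<in> row_ball" and A: "range A \<subseteq> cops"
    and T: "fh_sums A (\<lambda>i. r *\<^sub>R creation i) T" and Z: "fh_sums A (\<lambda>i. r *\<^sub>R X i) Z"
  shows "norm Z \<le> norm T"
proof (rule von_neumann_inequality[OF X])
  have rX: "range (\<lambda>i. r *\<^sub>R X i) \<subseteq> cops" using row_ball_cops[OF X] by (auto intro: cops_scaleR)
  show "Z \<in> cops" by (rule fh_sums_cops[OF Z A rX])
  show "T \<in> cops" by (rule fh_sums_cops[OF T A scaled_creation_cops])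
  fix q assume q: "q \<in> cops" and eq: "\<And>i. X i o\<^sub>L q = q o\<^sub>L creation i"
  have "(r *\<^sub>R X i) o\<^sub>L q = q o\<^sub>L (r *\<^sub>R creation i)" for i
  proof (rule blinfun_eqI)
    show "((r *\<^sub>R X i) o\<^sub>L q) x = (q o\<^sub>L (r *\<^sub>R creation i)) x" for x
      using arg_cong[OF eq[of i], of "\<lambda>S. blinfun_apply S x"]
      by (simp add: blinfun.scaleR_left blinfun.scaleR_right)
  qed
  then show "Z o\<^sub>L (q \<otimes>\<^sub>o id_blinfun) = (q \<otimes>\<^sub>o id_blinfun) o\<^sub>L T"
    by (rule fh_sums_intertwine[OF A scaled_creation_cops rX q _ T Z])
qed

section \<open>Boundary values on the Fock space\<close>

abbreviation fock_value :: "('n, 'h::chilbert_space, 'e::chilbert_space, 'g::chilbert_space) ball_map \<Rightarrow> real \<Rightarrow> ('n, 'e, 'g) fock_op" where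
  "fock_value F r \<equiv> fh_eval F (\<lambda>i. r *\<^sub>R creation i)"

lemma fh_eval_fock:
  fixes F :: "('n::countable, 'h::chilbert_space, 'e::chilbert_space, 'g::chilbert_space) ball_map"
  assumes H: "\<nexists>B::'h set. finite B \<and> cspan B = UNIV" and F: "free_holomorphic F" and r: "0 \<le> r" "r < 1"
  shows "fh_sums (fh_coeff F) (\<lambda>i. r *\<^sub>R creation i) (fock_value F r)"
    and "(\<And>X. X \<in> row_ball \<Longrightarrow> norm (F X) \<le> K) \<Longrightarrow> norm (fock_value F r) \<le> K"
proof -
  obtain X :: "'n \<Rightarrow> ('h \<Rightarrow>\<^sub>L 'h)" and W :: "'n fock \<Rightarrow>\<^sub>L 'h"
    where X: "X \<in> row_ball" and W: "W \<in> cops" "isometry_op W"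
      and inter: "\<And>i. X i o\<^sub>L W = W o\<^sub>L (r *\<^sub>R creation i)"
    by (rule fock_model[OF H r]) (rule that; assumption)
  let ?T = "(adj W \<otimes>\<^sub>o id_blinfun) o\<^sub>L F X o\<^sub>L (W \<otimes>\<^sub>o id_blinfun)"
  have *: "fh_sums (fh_coeff F) (\<lambda>i. r *\<^sub>R creation i) ?T"
    by (rule fh_sums_compress[OF fh_coeff_cops[OF F] scaled_creation_cops row_ball_cops[OF X] W inter
          fh_coeff_sums[OF F X]])
  note eval = fh_eval_eqI[OF *]
  show "fh_sums (fh_coeff F) (\<lambda>i. r *\<^sub>R creation i) (fock_value F r)"
    unfolding eval by (rule *)
  assume K: "\<And>X. X \<in> row_ball \<Longrightarrow> norm (F X) \<le> K"
  then have K0: "0 \<le> K" using X norm_ge_zero order_trans by blast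
  have "norm ?T \<le> norm ((adj W \<otimes>\<^sub>o id_blinfun) o\<^sub>L F X) * norm (W \<otimes>\<^sub>o (id_blinfun :: 'e \<Rightarrow>\<^sub>L 'e))"
    by (rule norm_blinfun_compose)
  also have "\<dots> \<le> (norm (adj W \<otimes>\<^sub>o (id_blinfun :: 'g \<Rightarrow>\<^sub>L 'g)) * norm (F X)) * norm (W \<otimes>\<^sub>o (id_blinfun :: 'e \<Rightarrow>\<^sub>L 'e))"
    by (intro mult_right_mono norm_blinfun_compose) simp
  also have "\<dots> \<le> (1 * K) * 1"
    using K0 by (intro mult_mono norm_tensor_id_le W K[OF X]) auto
  finally show "norm (fock_value F r) \<le> K" unfolding eval by simp
qed

lemma fh_eval_fock_mult:
  fixes F :: "('n::countable, 'h::chilbert_space, 'e::chilbert_space, 'g::chilbert_space) ball_map"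
    and \<Theta> :: "('n, 'h, 'y::chilbert_space, 'g) ball_map"
    and G :: "('n, 'h, 'e, 'y) ball_map"
  assumes H: "\<nexists>B::'h set. finite B \<and> cspan B = UNIV"
    and fh: "free_holomorphic F" "free_holomorphic \<Theta>" "free_holomorphic G" and r: "0 \<le> r" "r < 1"
    and mult: "\<forall>X\<in>row_ball. F X = \<Theta> X o\<^sub>L G X"
  shows "fock_value F r =
    fock_value \<Theta> r o\<^sub>L fock_value G r"
proof -
  obtain X :: "'n \<Rightarrow> ('h \<Rightarrow>\<^sub>L 'h)" and W :: "'n fock \<Rightarrow>\<^sub>L 'h"
    where X: "X \<in> row_ball" and W: "W \<in> cops" "isometry_op W"
      and inter: "\<And>i. X i o\<^sub>L W = W o\<^sub>L (r *\<^sub>R creation i)"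
    by (rule fock_model[OF H r]) (rule that; assumption)
  let ?F = "fock_value F r"
  let ?\<Theta> = "fock_value \<Theta> r"
  let ?G = "fock_value G r"
  note eqs = fh_sums_intertwine[OF fh_coeff_cops scaled_creation_cops row_ball_cops[OF X] W(1) inter
      fh_eval_fock(1)[OF H _ r] fh_coeff_sums[OF _ X]]
  have inj: "(adj W \<otimes>\<^sub>o (id_blinfun :: 'g \<Rightarrow>\<^sub>L 'g)) o\<^sub>L (W \<otimes>\<^sub>o id_blinfun) = id_blinfun"
  proof -
    have "adj W o\<^sub>L W = id_blinfun" by (rule blinfun_eqI) (simp add: adj_isometry W)
    moreover have "id_blinfun o\<^sub>L id_blinfun = (id_blinfun :: 'g \<Rightarrow>\<^sub>L 'g)" by (rule blinfun_eqI) simp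
    ultimately show ?thesis by (simp add: tensor_op_compose W tensor_op_id)
  qed
  show ?thesis
  proof (rule blinfun_eqI)
    fix v
    have "(W \<otimes>\<^sub>o id_blinfun) (?F v) = F X ((W \<otimes>\<^sub>o id_blinfun) v)"
      using arg_cong[OF eqs[OF fh(1) fh(1) fh(1)], of "\<lambda>S. blinfun_apply S v"] by simp
    also have "\<dots> = \<Theta> X (G X ((W \<otimes>\<^sub>o id_blinfun) v))" using mult X by simp
    also have "G X ((W \<otimes>\<^sub>o id_blinfun) v) = (W \<otimes>\<^sub>o id_blinfun) (?G v)"
      using arg_cong[OF eqs[OF fh(3) fh(3) fh(3)], of "\<lambda>S. blinfun_apply S v"] by simp
    also have "\<Theta> X \<dots> = (W \<otimes>\<^sub>o id_blinfun) (?\<Theta> (?G v))"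
      using arg_cong[OF eqs[OF fh(2) fh(2) fh(2)], of "\<lambda>S. blinfun_apply S (?G v)"] by simp
    finally have "(adj W \<otimes>\<^sub>o id_blinfun) ((W \<otimes>\<^sub>o id_blinfun) (?F v))
      = (adj W \<otimes>\<^sub>o id_blinfun) ((W \<otimes>\<^sub>o id_blinfun) (?\<Theta> (?G v)))" by simp
    then show "?F v = (?\<Theta> o\<^sub>L ?G) v"
      using arg_cong[OF inj, of "\<lambda>S. blinfun_apply S (?F v)"]
        arg_cong[OF inj, of "\<lambda>S. blinfun_apply S (?\<Theta> (?G v))"] by simp
  qed
qed

text \<open>\<open>H k = \<Sum>\<^bsub>|\<alpha>| = k\<^esub> S\<^sub>\<alpha> \<otimes> A\<^sub>\<alpha>\<close>, formed at \<open>S\<close> itself: each homogeneous part exists there, even though the whole series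
need not converge, and the value at \<open>r S\<close> is the power series \<open>\<Sum>\<^sub>k r\<^sup>k H k\<close>.\<close>

definition hom_parts :: "('n list \<Rightarrow> ('e::chilbert_space \<Rightarrow>\<^sub>L 'g::chilbert_space)) \<Rightarrow>
    (nat \<Rightarrow> (('n, 'e, 'g) fock_op)) \<Rightarrow> bool" where
  "hom_parts A H \<longleftrightarrow> (\<forall>k. has_sot_sum (\<lambda>\<alpha>. word_op creation \<alpha> \<otimes>\<^sub>o A \<alpha>) {\<alpha>. length \<alpha> = k} (H k))"

lemma word_op_creation_cops [simp]: "word_op creation \<alpha> \<in> cops"
  by (rule word_op_cops) auto

lemma has_sot_sum_scaled:
  assumes A: "range A \<subseteq> cops"
    and "has_sot_sum (\<lambda>\<alpha>. word_op creation \<alpha> \<otimes>\<^sub>o A \<alpha>) {\<alpha>. length \<alpha> = k} P"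
  shows "has_sot_sum (\<lambda>\<alpha>. word_op (\<lambda>i. r *\<^sub>R creation i) \<alpha> \<otimes>\<^sub>o A \<alpha>) {\<alpha>. length \<alpha> = k} (r ^ k *\<^sub>R P)"
  unfolding has_sot_sum_def
proof
  fix v
  have Ac: "A \<alpha> \<in> cops" for \<alpha> using A by auto
  have "((\<lambda>\<alpha>. r ^ k *\<^sub>R (word_op creation \<alpha> \<otimes>\<^sub>o A \<alpha>) v) has_sum r ^ k *\<^sub>R P v) {\<alpha>. length \<alpha> = k}"
    using assms(2) unfolding has_sot_sum_def
    by (intro has_sum_bounded_linear[OF bounded_linear_scaleR_right]) blast
  then show "((\<lambda>\<alpha>. (word_op (\<lambda>i. r *\<^sub>R creation i) \<alpha> \<otimes>\<^sub>o A \<alpha>) v) has_sum (r ^ k *\<^sub>R P) v) {\<alpha>. length \<alpha> = k}"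
    unfolding blinfun.scaleR_left
    by (rule has_sum_cong[THEN iffD1, rotated])
      (simp add: word_op_scaleR tensor_op_scaleR_left Ac blinfun.scaleR_left)
qed

lemma has_sot_sum_unique: "has_sot_sum f I S \<Longrightarrow> has_sot_sum f I T \<Longrightarrow> S = T"
  unfolding has_sot_sum_def by (rule blinfun_eqI) (rule has_sum_unique; blast)

lemma hom_parts_sums:
  assumes A: "range A \<subseteq> cops" and H: "hom_parts A H" and T: "fh_sums A (\<lambda>i. r *\<^sub>R creation i) T"
  shows "(\<lambda>k. r ^ k *\<^sub>R H k) sums T"
proof -
  obtain P where P: "\<And>k. has_sot_sum (\<lambda>\<alpha>. word_op (\<lambda>i. r *\<^sub>R creation i) \<alpha> \<otimes>\<^sub>o A \<alpha>) {\<alpha>. length \<alpha> = k} (P k)"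
    and "P sums T"
    by (rule fh_sumsE[OF T]) (rule that; assumption)
  have "P k = r ^ k *\<^sub>R H k" for k
    using H unfolding hom_parts_def by (intro has_sot_sum_unique[OF P] has_sot_sum_scaled[OF A]) blast
  then have "P = (\<lambda>k. r ^ k *\<^sub>R H k)" by (rule ext)
  then show ?thesis using \<open>P sums T\<close> by simp
qed

lemma hom_parts_exist:
  assumes A: "range A \<subseteq> cops" and T: "fh_sums A (\<lambda>i. r *\<^sub>R creation i) T" and r: "0 < r"
  shows "\<exists>H. hom_parts A H"
proof -
  obtain P where P: "\<And>k. has_sot_sum (\<lambda>\<alpha>. word_op (\<lambda>i. r *\<^sub>R creation i) \<alpha> \<otimes>\<^sub>o A \<alpha>) {\<alpha>. length \<alpha> = k} (P k)"
    and "P sums T"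
    by (rule fh_sumsE[OF T]) (rule that; assumption)
  have Ac: "A \<alpha> \<in> cops" for \<alpha> using A by auto
  have "has_sot_sum (\<lambda>\<alpha>. word_op creation \<alpha> \<otimes>\<^sub>o A \<alpha>) {\<alpha>. length \<alpha> = k} (inverse (r ^ k) *\<^sub>R P k)" for k
    unfolding has_sot_sum_def
  proof
    fix v
    have "((\<lambda>\<alpha>. inverse (r ^ k) *\<^sub>R (word_op (\<lambda>i. r *\<^sub>R creation i) \<alpha> \<otimes>\<^sub>o A \<alpha>) v) has_sum
        inverse (r ^ k) *\<^sub>R P k v) {\<alpha>. length \<alpha> = k}"
      using P[of k] unfolding has_sot_sum_def
      by (intro has_sum_bounded_linear[OF bounded_linear_scaleR_right]) blast
    then show "((\<lambda>\<alpha>. (word_op creation \<alpha> \<otimes>\<^sub>o A \<alpha>) v) has_sum (inverse (r ^ k) *\<^sub>R P k) v) {\<alpha>. length \<alpha> = k}"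
      unfolding blinfun.scaleR_left
      by (rule has_sum_cong[THEN iffD1, rotated])
        (use r in \<open>simp add: word_op_scaleR tensor_op_scaleR_left Ac blinfun.scaleR_left\<close>)
  qed
  then have "hom_parts A (\<lambda>k. inverse (r ^ k) *\<^sub>R P k)" unfolding hom_parts_def by (rule allI)
  then show ?thesis by (intro exI[of _ "\<lambda>k. inverse (r ^ k) *\<^sub>R P k"])
qed

lemma power_series_at_left:
  fixes P :: "nat \<Rightarrow> 'a::banach"
  assumes "summable (\<lambda>k. norm (P k))"
  shows "((\<lambda>r::real. \<Sum>k. r ^ k *\<^sub>R P k) \<longlongrightarrow> (\<Sum>k. P k)) (at_left 1)"
proof -
  have "uniform_limit {0..1::real} (\<lambda>n r. \<Sum>k<n. r ^ k *\<^sub>R P k) (\<lambda>r. \<Sum>k. r ^ k *\<^sub>R P k) sequentially"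
    by (rule Weierstrass_m_test[OF _ assms]) (auto intro!: mult_left_le_one_le power_le_one)
  then have "continuous_on {0..1::real} (\<lambda>r. \<Sum>k. r ^ k *\<^sub>R P k)"
    by (intro uniform_limit_theorem) (auto intro!: always_eventually continuous_intros)
  then have "((\<lambda>r::real. \<Sum>k. r ^ k *\<^sub>R P k) \<longlongrightarrow> (\<Sum>k. 1 ^ k *\<^sub>R P k)) (at 1 within {0..1})"
    unfolding continuous_on_def by (rule bspec) simp
  then show ?thesis by (simp add: at_within_Icc_at_left)
qed

text \<open>Convergence at some \<open>t S\<close> with \<open>s < t < 1\<close> makes the power series at \<open>s\<close> absolutely convergent.\<close>

lemma fock_series_continuous:
  fixes A :: "'n list \<Rightarrow> ('e::chilbert_space \<Rightarrow>\<^sub>L 'g::chilbert_space)"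
  assumes A: "range A \<subseteq> cops"
    and f: "\<And>r. 0 \<le> r \<Longrightarrow> r < 1 \<Longrightarrow> fh_sums A (\<lambda>i. r *\<^sub>R creation i) (f r)"
    and s: "0 \<le> s" "s < 1"
  shows "((\<lambda>r. f (r * s)) \<longlongrightarrow> f s) (at_left 1)"
proof -
  obtain H where H: "hom_parts A H" using hom_parts_exist[OF A f[of "1/2"]] by auto
  define t where "t = (1 + s) / 2"
  have t: "0 < t" "t < 1" "s < t" using s by (auto simp: t_def)
  have "summable (\<lambda>k. t ^ k *\<^sub>R H k)"
    using hom_parts_sums[OF A H f[of t]] t by (simp add: sums_iff)
  then obtain M where M: "\<And>k. norm (t ^ k *\<^sub>R H k) \<le> M"
    using summable_imp_bounded unfolding bounded_iff by blast
  have abs: "summable (\<lambda>k. norm (s ^ k *\<^sub>R H k))"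
  proof (rule summable_comparison_test'[of "\<lambda>k. M * (s / t) ^ k" 0])
    show "summable (\<lambda>k. M * (s / t) ^ k)"
      using s t by (intro summable_mult summable_geometric) simp
    fix k
    have "norm (s ^ k *\<^sub>R H k) = (s / t) ^ k * norm (t ^ k *\<^sub>R H k)"
      using s t by (simp add: power_divide)
    also have "\<dots> \<le> (s / t) ^ k * M" using s t by (intro mult_left_mono M) simp
    finally show "norm (norm (s ^ k *\<^sub>R H k)) \<le> M * (s / t) ^ k" by (simp add: mult.commute)
  qed
  have val: "f r = (\<Sum>k. r ^ k *\<^sub>R H k)" if "0 \<le> r" "r < 1" for r
    using hom_parts_sums[OF A H f[OF that]] by (simp add: sums_iff)
  have "((\<lambda>r::real. \<Sum>k. r ^ k *\<^sub>R (s ^ k *\<^sub>R H k)) \<longlongrightarrow> f s) (at_left 1)"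
    using power_series_at_left[OF abs] by (simp add: val s)
  moreover have "\<forall>\<^sub>F r::real in at_left 1. (\<Sum>k. r ^ k *\<^sub>R (s ^ k *\<^sub>R H k)) = f (r * s)"
    using eventually_at_left_real[of 0 "1::real", OF zero_less_one]
  proof eventually_elim
    case (elim r)
    have "r * s < 1" using elim s mult_strict_mono[of r 1 s 1] by (cases "s = 0") auto
    then show ?case using elim s by (simp add: val power_mult_distrib)
  qed
  ultimately show ?thesis by (rule Lim_transform_eventually)
qed

text \<open>If \<open>q\<close> intertwines \<open>s S\<close> with \<open>S\<close>, then it intertwines \<open>r s S\<close> with \<open>r S\<close>, so the values at these points are
related by \<open>q \<otimes> I\<close>. Letting \<open>r\<close> tend to 1, in norm on the first side and strongly on the second, gives
the hypothesis of the von Neumann inequality with the boundary value \<open>T\<close>.\<close>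

lemma fock_series_norm_le_boundary:
  fixes A :: "'n list \<Rightarrow> ('e::chilbert_space \<Rightarrow>\<^sub>L 'g::chilbert_space)"
    and T :: "('n, 'e, 'g) fock_op"
  assumes A: "range A \<subseteq> cops"
    and f: "\<And>r. 0 \<le> r \<Longrightarrow> r < 1 \<Longrightarrow> fh_sums A (\<lambda>i. r *\<^sub>R creation i) (f r)"
    and T: "T \<in> cops" and lim: "\<And>v. ((\<lambda>r. f r v) \<longlongrightarrow> T v) (at_left 1)"
    and s: "0 \<le> s" "s < 1"
  shows "norm (f s) \<le> norm T"
proof (rule von_neumann_inequality[OF creation_row_ball[OF s] _ T])
  show "f s \<in> cops" by (rule fh_sums_cops[OF f[OF s] A scaled_creation_cops])
  fix q :: "'n fock \<Rightarrow>\<^sub>L 'n fock"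
  assume q: "q \<in> cops" and inter: "\<And>i. (s *\<^sub>R creation i) o\<^sub>L q = q o\<^sub>L creation i"
  have inter_r: "((r * s) *\<^sub>R creation i) o\<^sub>L q = q o\<^sub>L (r *\<^sub>R creation i)" for r i
  proof (rule blinfun_eqI)
    show "(((r * s) *\<^sub>R creation i) o\<^sub>L q) x = (q o\<^sub>L (r *\<^sub>R creation i)) x" for x
      using arg_cong[OF inter[of i], of "\<lambda>S. r *\<^sub>R blinfun_apply S x"]
      by (simp add: blinfun.scaleR_left blinfun.scaleR_right)
  qed
  have eq: "f (r * s) ((q \<otimes>\<^sub>o id_blinfun) v) = (q \<otimes>\<^sub>o id_blinfun) (f r v)" if r: "0 < r" "r < 1" for r v
  proof -
    have rs: "0 \<le> r * s" "r * s < 1" using r s mult_strict_mono[of r 1 s 1] by (cases "s = 0"; simp)+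
    have "f (r * s) o\<^sub>L (q \<otimes>\<^sub>o id_blinfun) = (q \<otimes>\<^sub>o id_blinfun) o\<^sub>L f r"
      by (rule fh_sums_intertwine[OF A scaled_creation_cops scaled_creation_cops q inter_r f f])
        (use r rs in auto)
    from arg_cong[OF this, of "\<lambda>S. blinfun_apply S v"] show ?thesis by simp
  qed
  show "f s o\<^sub>L (q \<otimes>\<^sub>o id_blinfun) = (q \<otimes>\<^sub>o id_blinfun) o\<^sub>L T"
  proof (rule blinfun_eqI)
    fix v
    let ?v = "(q \<otimes>\<^sub>o (id_blinfun :: 'e \<Rightarrow>\<^sub>L 'e)) v"
    have "((\<lambda>r. f (r * s) ?v) \<longlongrightarrow> f s ?v) (at_left 1)"
      by (intro blinfun.tendsto fock_series_continuous[OF A f s] tendsto_const)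
    moreover have "((\<lambda>r. f (r * s) ?v) \<longlongrightarrow> (q \<otimes>\<^sub>o id_blinfun) (T v)) (at_left 1)"
    proof (rule Lim_transform_eventually)
      show "((\<lambda>r. (q \<otimes>\<^sub>o id_blinfun) (f r v)) \<longlongrightarrow> (q \<otimes>\<^sub>o id_blinfun) (T v)) (at_left 1)"
        by (intro blinfun.tendsto tendsto_const lim)
      show "\<forall>\<^sub>F r::real in at_left 1. (q \<otimes>\<^sub>o id_blinfun) (f r v) = f (r * s) ?v"
        using eventually_at_left_real[of 0 "1::real", OF zero_less_one]
        by eventually_elim (simp add: eq)
    qed
    ultimately show "(f s o\<^sub>L (q \<otimes>\<^sub>o id_blinfun)) v = ((q \<otimes>\<^sub>o id_blinfun) o\<^sub>L T) v"
      using tendsto_unique[OF trivial_limit_at_left_real] by simp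
  qed
qed

section \<open>The disc algebra and operator polynomials\<close>

definition fock_polys :: "(('n, 'e::chilbert_space, 'g::chilbert_space) fock_op) set" where
  "fock_polys = cspan {word_op creation \<alpha> \<otimes>\<^sub>o b |\<alpha> b. b \<in> cops}"

definition fock_poly :: "'n list set \<Rightarrow> ('n list \<Rightarrow> ('e::chilbert_space \<Rightarrow>\<^sub>L 'g::chilbert_space))
    \<Rightarrow> (('n, 'e, 'g) fock_op)" where
  "fock_poly J D = (\<Sum>\<alpha>\<in>J. word_op creation \<alpha> \<otimes>\<^sub>o D \<alpha>)"

lemma word_op_append: "word_op X (\<alpha> @ \<beta>) = word_op X \<alpha> o\<^sub>L word_op X \<beta>"
  by (induction \<alpha>) (auto intro: blinfun_eqI)

text \<open>The closed span of the words is a closed algebra that contains the generators.\<close>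

lemma disc_algebra_subset: "(disc_algebra :: ('n fock \<Rightarrow>\<^sub>L 'n fock) set) \<subseteq> closure (cspan (range (word_op creation)))"
proof -
  let ?S = "cspan (range (word_op (creation :: 'n \<Rightarrow> _)))"
  have scale: "(c *\<^sub>C S) o\<^sub>L T = c *\<^sub>C (S o\<^sub>L T)" for c and S T :: "'n fock \<Rightarrow>\<^sub>L 'n fock"
    by (rule blinfun_eqI) (simp add: scaleC_blinfun.rep_eq)
  have scale': "word_op creation \<alpha> o\<^sub>L (c *\<^sub>C T) = c *\<^sub>C (word_op creation \<alpha> o\<^sub>L T)"
    for \<alpha> c and T :: "'n fock \<Rightarrow>\<^sub>L 'n fock"
    by (rule blinfun_eqI) (simp add: scaleC_blinfun.rep_eq copsD)
  have words: "word_op creation \<alpha> o\<^sub>L T \<in> ?S" if "T \<in> ?S" for \<alpha> and T :: "'n fock \<Rightarrow>\<^sub>L 'n fock"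
    using that
  proof (induction rule: complex_vector.span_induct_alt)
    case base
    have "word_op creation \<alpha> o\<^sub>L (0 :: 'n fock \<Rightarrow>\<^sub>L 'n fock) = 0" by (rule blinfun_eqI) (simp add: blinfun.zero_right)
    then show ?case by (simp add: complex_vector.span_zero)
  next
    case (step c x y)
    then obtain \<beta> where "x = word_op creation \<beta>" by blast
    then have "word_op creation \<alpha> o\<^sub>L (c *\<^sub>C x + y) = c *\<^sub>C word_op creation (\<alpha> @ \<beta>) + (word_op creation \<alpha> o\<^sub>L y)"
      by (simp add: word_op_append bounded_bilinear.add_right[OF bounded_bilinear_blinfun_compose] scale')
    then show ?case
      using step.IH by (metis complex_vector.span_add complex_vector.span_base complex_vector.span_scale rangeI)
  qed
  have mult: "S o\<^sub>L T \<in> ?S" if "S \<in> ?S" "T \<in> ?S" for S T :: "'n fock \<Rightarrow>\<^sub>L 'n fock"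
    using that(1)
  proof (induction rule: complex_vector.span_induct_alt)
    case base
    have "(0 :: 'n fock \<Rightarrow>\<^sub>L 'n fock) o\<^sub>L T = 0" by (rule blinfun_eqI) simp
    then show ?case by (simp add: complex_vector.span_zero)
  next
    case (step c x y)
    then obtain \<beta> where "x = word_op creation \<beta>" by blast
    then have "(c *\<^sub>C x + y) o\<^sub>L T = c *\<^sub>C (word_op creation \<beta> o\<^sub>L T) + (y o\<^sub>L T)"
      by (simp add: bounded_bilinear.add_left[OF bounded_bilinear_blinfun_compose] scale)
    then show ?case
      using step.IH words[OF that(2)] by (metis complex_vector.span_add complex_vector.span_scale)
  qed
  have "closed_algebra (closure ?S)"
    unfolding closed_algebra_def
  proof (intro conjI ballI closed_closure)
    show "complex_vector.subspace (closure ?S)" by (rule subspace_closure_cspan)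
    fix x y assume "x \<in> closure ?S" "y \<in> closure ?S"
    then obtain f g where fg: "\<forall>n. f n \<in> ?S" "f \<longlonglongrightarrow> x" "\<forall>n. g n \<in> ?S" "g \<longlonglongrightarrow> y"
      unfolding closure_sequential by blast
    have "(\<lambda>n. f n o\<^sub>L g n) \<longlonglongrightarrow> (x o\<^sub>L y)"
      by (rule bounded_bilinear.tendsto[OF bounded_bilinear_blinfun_compose fg(2,4)])
    then show "x o\<^sub>L y \<in> closure ?S"
      unfolding closure_sequential using fg by (intro exI[of _ "\<lambda>n. f n o\<^sub>L g n"]) (simp add: mult)
  qed
  moreover have "insert id_blinfun (range creation) \<subseteq> closure ?S"
  proof -
    have "word_op creation [] \<in> ?S" "word_op creation [i] \<in> ?S" for i
      by (intro complex_vector.span_base rangeI)+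
    moreover have "word_op creation [i] = creation i" for i :: 'n by (rule blinfun_eqI) simp
    ultimately have "insert id_blinfun (range creation) \<subseteq> ?S" by auto
    then show ?thesis using closure_subset by blast
  qed
  ultimately show ?thesis unfolding disc_algebra_def by (intro hull_minimal)
qed

lemma word_op_disc_algebra: "word_op creation (\<alpha> :: 'n list) \<in> disc_algebra"
proof -
  have gen: "insert id_blinfun (range creation) \<subseteq> (disc_algebra :: ('n fock \<Rightarrow>\<^sub>L 'n fock) set)"
    unfolding disc_algebra_def by (rule hull_subset)
  have "closed_algebra (disc_algebra :: ('n fock \<Rightarrow>\<^sub>L 'n fock) set)"
    unfolding disc_algebra_def
    by (rule hull_in) (auto simp: closed_algebra_def complex_vector.subspace_def)
  then have mult: "S o\<^sub>L T \<in> disc_algebra" if "S \<in> disc_algebra" "T \<in> disc_algebra" for S T :: "'n fock \<Rightarrow>\<^sub>L 'n fock"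
    using that by (simp add: closed_algebra_def)
  show ?thesis
  proof (induction \<alpha>)
    case (Cons i \<alpha>)
    moreover have "creation i \<in> disc_algebra" using gen by blast
    ultimately show ?case by (simp add: mult)
  qed (use gen in auto)
qed


lemma disc_algebra_cops: "disc_algebra \<subseteq> cops"
proof -
  have "cspan (range (word_op creation)) \<subseteq> cops"
    by (rule complex_vector.span_minimal) (auto simp: cops_subspace)
  then have "closure (cspan (range (word_op creation))) \<subseteq> cops"
    using cops_closed by (rule closure_minimal)
  then show ?thesis using disc_algebra_subset by blast
qed

text \<open>As \<open>a \<mapsto> a \<otimes> b\<close> is continuous in norm, elements of the disc algebra may be replaced by polynomials in the
creation operators.\<close>

lemma spatial_tensor_disc_algebra:
  "disc_algebra \<otimes>\<^sub>m\<^sub>i\<^sub>n cops = closure (fock_polys :: (('n, 'e::chilbert_space, 'g::chilbert_space) fock_op) set)"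
proof
  have "a \<otimes>\<^sub>o b \<in> closure (fock_polys :: (('n, 'e, 'g) fock_op) set)"
    if a: "a \<in> disc_algebra" and b: "b \<in> cops" for a and b :: "'e \<Rightarrow>\<^sub>L 'g"
  proof -
    have pol: "x \<in> cops \<and> x \<otimes>\<^sub>o b \<in> fock_polys" if "x \<in> cspan (range (word_op creation))" for x :: "'n fock \<Rightarrow>\<^sub>L 'n fock"
      using that
    proof (induction rule: complex_vector.span_induct_alt)
      case base
      show ?case by (simp add: tensor_op_zero_left b fock_polys_def complex_vector.span_zero)
    next
      case (step c x y)
      then obtain \<beta> where x: "x = word_op creation \<beta>" by blast
      have "(c *\<^sub>C x + y) \<otimes>\<^sub>o b = c *\<^sub>C (x \<otimes>\<^sub>o b) + y \<otimes>\<^sub>o b"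
        using step.IH x by (simp add: tensor_op_add_left tensor_op_scaleC_left cops_scaleC b)
      moreover have "x \<otimes>\<^sub>o b \<in> fock_polys"
        unfolding fock_polys_def x using b by (intro complex_vector.span_base) blast
      ultimately have "(c *\<^sub>C x + y) \<otimes>\<^sub>o b \<in> fock_polys"
        using step.IH unfolding fock_polys_def
        by (simp add: complex_vector.span_add complex_vector.span_scale)
      then show ?case using step.IH x by (simp add: cops_add cops_scaleC)
    qed
    have "a \<in> closure (cspan (range (word_op creation)))" using a disc_algebra_subset by blast
    then obtain f where f': "\<forall>n. f n \<in> cspan (range (word_op creation))" and f: "f \<longlonglongrightarrow> a"
      unfolding closure_sequential by blast
    have ac: "a \<in> cops" using a disc_algebra_cops by blast
    have "(\<lambda>n. f n \<otimes>\<^sub>o b) \<longlonglongrightarrow> a \<otimes>\<^sub>o b"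
    proof (rule LIM_zero_cancel, rule Lim_null_comparison)
      have "norm (f n \<otimes>\<^sub>o b - a \<otimes>\<^sub>o b) \<le> norm (f n - a) * norm b" for n
        using norm_tensor_op_le[of "f n - a" b] pol[OF f'[rule_format, of n]] ac b
        by (simp add: tensor_op_diff_left cops_diff)
      then show "\<forall>\<^sub>F n in sequentially. norm (f n \<otimes>\<^sub>o b - a \<otimes>\<^sub>o b) \<le> norm (f n - a) * norm b" by simp
      have "(\<lambda>n. norm (f n - a) * norm b) \<longlonglongrightarrow> 0 * norm b"
        using f by (intro tendsto_mult tendsto_const tendsto_norm_zero LIM_zero)
      then show "(\<lambda>n. norm (f n - a) * norm b) \<longlonglongrightarrow> 0" by simp
    qed
    then show ?thesis unfolding closure_sequential using pol f' by (intro exI[of _ "\<lambda>n. f n \<otimes>\<^sub>o b"]) simp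
  qed
  then have "{a \<otimes>\<^sub>o b |a b. a \<in> disc_algebra \<and> b \<in> cops} \<subseteq> closure (fock_polys :: (('n, 'e, 'g) fock_op) set)"
    by blast
  then show "disc_algebra \<otimes>\<^sub>m\<^sub>i\<^sub>n cops \<subseteq> closure (fock_polys :: (('n, 'e, 'g) fock_op) set)"
    unfolding spatial_tensor_def fock_polys_def by (rule closure_cspan_minimal)
  have "{word_op creation \<alpha> \<otimes>\<^sub>o b |\<alpha> b. b \<in> cops} \<subseteq>
      {a \<otimes>\<^sub>o b |a b. a \<in> disc_algebra \<and> (b :: 'e \<Rightarrow>\<^sub>L 'g) \<in> cops}"
    using word_op_disc_algebra by blast
  then show "closure (fock_polys :: (('n, 'e, 'g) fock_op) set) \<subseteq> disc_algebra \<otimes>\<^sub>m\<^sub>i\<^sub>n cops"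
    unfolding spatial_tensor_def fock_polys_def by (intro closure_mono complex_vector.span_mono)
qed

lemma fock_polys_cops: "fock_polys \<subseteq> cops"
  unfolding fock_polys_def
  by (rule complex_vector.span_minimal) (auto simp: cops_subspace intro: tensor_op_cops)

lemma closure_fock_polys_cops: "closure fock_polys \<subseteq> cops"
  by (rule closure_minimal[OF fock_polys_cops cops_closed])

text \<open>Collecting the terms of a linear combination word by word. Extending the coefficients by \<open>0\<close> makes
the polynomial a power series, to which the lemmas on values at \<open>r S\<close> apply.\<close>

lemma fock_polysE:
  fixes T :: "('n, 'e::chilbert_space, 'g::chilbert_space) fock_op"
  assumes "T \<in> fock_polys"
  obtains J D where "finite J" "range D \<subseteq> cops" "\<And>\<alpha>. \<alpha> \<notin> J \<Longrightarrow> D \<alpha> = 0" "T = fock_poly J D"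
proof -
  define good where "good T J D \<longleftrightarrow> finite J \<and> range D \<subseteq> cops \<and> (\<forall>\<alpha>. \<alpha> \<notin> J \<longrightarrow> D \<alpha> = 0) \<and> T = fock_poly J D"
    for T :: "('n, 'e, 'g) fock_op" and J D
  have "\<exists>J D. good T J D"
    using assms unfolding fock_polys_def
  proof (induction rule: complex_vector.span_induct_alt)
    case base
    have "good 0 {} (\<lambda>_. 0)" by (auto simp: good_def fock_poly_def)
    then show ?case by blast
  next
    case (step c x y)
    obtain \<beta> b where x: "x = word_op creation \<beta> \<otimes>\<^sub>o b" and b: "b \<in> cops" using step.hyps by blast
    obtain J D where "good y J D" using step.IH by blast
    then have J: "finite J" and Dc: "D \<alpha> \<in> cops" and D0: "\<alpha> \<notin> J \<Longrightarrow> D \<alpha> = 0" and y: "y = fock_poly J D" for \<alpha>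
      by (auto simp: good_def)
    let ?D = "D(\<beta> := c *\<^sub>C b + D \<beta>)"
    have y': "y = fock_poly (insert \<beta> J) D"
      using J D0 unfolding y fock_poly_def by (simp add: sum.insert_if tensor_op_zero_right)
    have "fock_poly (insert \<beta> J) ?D =
        (\<Sum>\<alpha>\<in>insert \<beta> J. (if \<alpha> = \<beta> then c *\<^sub>C x else 0) + word_op creation \<alpha> \<otimes>\<^sub>o D \<alpha>)"
      unfolding fock_poly_def
      by (intro sum.cong) (auto simp: x tensor_op_add_right tensor_op_scaleC_right cops_scaleC b Dc)
    also have "\<dots> = c *\<^sub>C x + y" unfolding y' fock_poly_def using J by (simp add: sum.distrib)
    finally have "good (c *\<^sub>C x + y) (insert \<beta> J) ?D"
      using J D0 Dc b by (auto simp: good_def cops_add cops_scaleC)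
    then show ?case by blast
  qed
  then obtain J D where "good T J D" by blast
  then show ?thesis using that unfolding good_def by blast
qed

lemma fock_poly_in_polys: "range D \<subseteq> cops \<Longrightarrow> fock_poly J D \<in> fock_polys"
  unfolding fock_poly_def fock_polys_def
  by (intro complex_vector.span_sum complex_vector.span_base) blast

lemma fh_sums_poly:
  assumes J: "finite J" and D: "range D \<subseteq> cops" "\<And>\<alpha>. \<alpha> \<notin> J \<Longrightarrow> D \<alpha> = 0"
  shows "fh_sums D (\<lambda>i. r *\<^sub>R creation i) (\<Sum>\<alpha>\<in>J. r ^ length \<alpha> *\<^sub>R (word_op creation \<alpha> \<otimes>\<^sub>o D \<alpha>))"
  unfolding fh_sums_def
proof (intro exI conjI allI)
  let ?h = "\<lambda>\<alpha>. r ^ length \<alpha> *\<^sub>R (word_op creation \<alpha> \<otimes>\<^sub>o D \<alpha>)"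
  have Dc: "D \<alpha> \<in> cops" for \<alpha> using D(1) by auto
  have h: "word_op (\<lambda>i. r *\<^sub>R creation i) \<alpha> \<otimes>\<^sub>o D \<alpha> = ?h \<alpha>" for \<alpha>
    by (simp add: word_op_scaleR tensor_op_scaleR_left Dc)
  show "has_sot_sum (\<lambda>\<alpha>. word_op (\<lambda>i. r *\<^sub>R creation i) \<alpha> \<otimes>\<^sub>o D \<alpha>) {\<alpha>. length \<alpha> = k} (\<Sum>\<alpha>\<in>{\<alpha>\<in>J. length \<alpha> = k}. ?h \<alpha>)" for k
    unfolding has_sot_sum_def h
    by (intro allI has_sum_finite_neutralI[of "{\<alpha>\<in>J. length \<alpha> = k}"])
      (use J D(2) in \<open>auto simp: blinfun_sum_left tensor_op_zero_right\<close>)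
  have "(\<lambda>k. \<Sum>\<alpha>\<in>{\<alpha>\<in>J. length \<alpha> = k}. ?h \<alpha>) sums (\<Sum>k\<in>length ` J. \<Sum>\<alpha>\<in>{\<alpha>\<in>J. length \<alpha> = k}. ?h \<alpha>)"
    by (rule sums_finite) (use J in \<open>auto intro!: sum.neutral\<close>)
  also have "(\<Sum>k\<in>length ` J. \<Sum>\<alpha>\<in>{\<alpha>\<in>J. length \<alpha> = k}. ?h \<alpha>) = sum ?h J"
    by (rule sum.group) (use J in auto)
  finally show "(\<lambda>k. \<Sum>\<alpha>\<in>{\<alpha>\<in>J. length \<alpha> = k}. ?h \<alpha>) sums sum ?h J" .
qed

lemma fh_sums_diff:
  assumes AB: "range A \<subseteq> cops" "range B \<subseteq> cops" and X: "range X \<subseteq> cops"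
    and S: "fh_sums A X S" and T: "fh_sums B X T"
  shows "fh_sums (\<lambda>\<alpha>. A \<alpha> - B \<alpha>) X (S - T)"
proof -
  obtain P where P: "\<And>k. has_sot_sum (\<lambda>\<alpha>. word_op X \<alpha> \<otimes>\<^sub>o A \<alpha>) {\<alpha>. length \<alpha> = k} (P k)" "P sums S"
    by (rule fh_sumsE[OF S]) (rule that; assumption)
  obtain R where R: "\<And>k. has_sot_sum (\<lambda>\<alpha>. word_op X \<alpha> \<otimes>\<^sub>o B \<alpha>) {\<alpha>. length \<alpha> = k} (R k)" "R sums T"
    by (rule fh_sumsE[OF T]) (rule that; assumption)
  have c: "A \<alpha> \<in> cops" "B \<alpha> \<in> cops" for \<alpha> using AB by auto
  show ?thesis
    unfolding fh_sums_def
  proof (intro exI conjI allI)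
    show "(\<lambda>k. P k - R k) sums (S - T)" by (rule sums_diff[OF P(2) R(2)])
    show "has_sot_sum (\<lambda>\<alpha>. word_op X \<alpha> \<otimes>\<^sub>o (A \<alpha> - B \<alpha>)) {\<alpha>. length \<alpha> = k} (P k - R k)" for k
      unfolding has_sot_sum_def
    proof
      fix v
      have "((\<lambda>\<alpha>. (word_op X \<alpha> \<otimes>\<^sub>o A \<alpha>) v + - (word_op X \<alpha> \<otimes>\<^sub>o B \<alpha>) v) has_sum (P k v + - R k v)) {\<alpha>. length \<alpha> = k}"
        by (rule has_sum_add[OF P(1)[unfolded has_sot_sum_def, rule_format]
              has_sum_bounded_linear[OF bounded_linear_minus[OF bounded_linear_ident]
                R(1)[unfolded has_sot_sum_def, rule_format]]])
      then show "((\<lambda>\<alpha>. (word_op X \<alpha> \<otimes>\<^sub>o (A \<alpha> - B \<alpha>)) v) has_sum (P k - R k) v) {\<alpha>. length \<alpha> = k}"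
        by (simp add: tensor_op_diff_right word_op_cops X c blinfun.diff_left)
    qed
  qed
qed

text \<open>For a polynomial \<open>U\<close> close to \<open>T\<close>, with values \<open>g r\<close> at \<open>r S\<close>, the bound by the boundary value gives
\<open>\<parallel>f r - g r\<parallel> \<le> \<parallel>T - U\<parallel>\<close> uniformly in \<open>r\<close>, while \<open>g r\<close> tends to \<open>U\<close> in norm. So the strong convergence
of \<open>f r\<close> to \<open>T\<close> improves to norm convergence.\<close>

lemma boundary_norm_limit:
  fixes A :: "'n list \<Rightarrow> ('e::chilbert_space \<Rightarrow>\<^sub>L 'g::chilbert_space)"
    and T :: "('n, 'e, 'g) fock_op"
  assumes A: "range A \<subseteq> cops"
    and f: "\<And>r. 0 \<le> r \<Longrightarrow> r < 1 \<Longrightarrow> fh_sums A (\<lambda>i. r *\<^sub>R creation i) (f r)"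
    and T: "T \<in> closure fock_polys" and lim: "\<And>v. ((\<lambda>r. f r v) \<longlongrightarrow> T v) (at_left 1)"
  shows "(f \<longlongrightarrow> T) (at_left 1)"
proof (rule tendstoI)
  fix e :: real assume e: "0 < e"
  then obtain U where U: "U \<in> fock_polys" "dist U T < e / 3"
    using T closure_approachable[of T fock_polys] by (meson divide_pos_pos zero_less_numeral)
  obtain J D where J: "finite J" and D: "range D \<subseteq> cops" "\<And>\<alpha>. \<alpha> \<notin> J \<Longrightarrow> D \<alpha> = 0" and UJ: "U = fock_poly J D"
    by (rule fock_polysE[OF U(1)]) (rule that; assumption)
  define g where "g r = (\<Sum>\<alpha>\<in>J. r ^ length \<alpha> *\<^sub>R (word_op creation \<alpha> \<otimes>\<^sub>o D \<alpha>))" for r :: real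
  have g: "fh_sums D (\<lambda>i. r *\<^sub>R creation i) (g r)" for r
    unfolding g_def by (rule fh_sums_poly[OF J D])
  have "(g \<longlongrightarrow> g 1) (at_left 1)"
    unfolding g_def by (intro tendsto_intros)
  then have g_lim: "(g \<longlongrightarrow> U) (at_left 1)" by (simp add: g_def UJ fock_poly_def)
  have bound: "norm (f s - g s) \<le> norm (T - U)" if s: "0 \<le> s" "s < 1" for s
  proof (rule fock_series_norm_le_boundary[OF _ _ _ _ s])
    show "range (\<lambda>\<alpha>. A \<alpha> - D \<alpha>) \<subseteq> cops" using A D(1) by (auto intro!: cops_diff)
    show "fh_sums (\<lambda>\<alpha>. A \<alpha> - D \<alpha>) (\<lambda>i. r *\<^sub>R creation i) (f r - g r)" if "0 \<le> r" "r < 1" for r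
      by (rule fh_sums_diff[OF A D(1) scaled_creation_cops f[OF that] g])
    show "T - U \<in> cops" using T U(1) closure_fock_polys_cops fock_polys_cops by (intro cops_diff) blast+
    show "((\<lambda>r. (f r - g r) v) \<longlongrightarrow> (T - U) v) (at_left 1)" for v
      unfolding blinfun.diff_left by (intro tendsto_diff lim blinfun.tendsto g_lim tendsto_const)
  qed
  have "\<forall>\<^sub>F r in at_left 1. dist (g r) U < e / 3" using g_lim e by (intro tendstoD) auto
  then show "\<forall>\<^sub>F r in at_left 1. dist (f r) T < e"
    using eventually_at_left_real[of 0 "1::real", OF zero_less_one]
  proof eventually_elim
    case (elim r)
    have "dist (f r) T \<le> dist (f r) (g r) + dist (g r) U + dist U T"
      by (meson add_mono_thms_linordered_semiring(3) dist_triangle dist_triangle_le order_trans)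
    also have "dist (f r) (g r) \<le> dist U T" using bound[of r] elim by (simp add: dist_norm norm_minus_commute)
    finally show ?case using elim U(2) by linarith
  qed
qed

section \<open>Homogeneous parts and their columns\<close>

lemma isom_family_fock_coordinates:
  "isom_family UNIV (\<lambda>w. tensor_left (fock_basis w))"
  by (auto simp: isom_family_def cinner_tensor cinner_fock_basis_basis)

abbreviation fock_coord :: "'n list \<Rightarrow> (('n fock, 'e::chilbert_space) htensor \<Rightarrow>\<^sub>L 'e)" where
  "fock_coord w \<equiv> adj (tensor_left (fock_basis w))"

lemma fock_coordinates_expansion:
  fixes t :: "('n fock, 'e::chilbert_space) htensor"
  shows "((\<lambda>w. fock_basis w \<otimes> fock_coord w t) has_sum t) UNIV"
    "((\<lambda>w. (norm (fock_coord w t))\<^sup>2) has_sum (norm t)\<^sup>2) UNIV"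
proof -
  have "closure (cspan (\<Union>w. range (blinfun_apply (tensor_left (fock_basis w))))) = (UNIV :: ('n fock, 'e) htensor set)"
    using tensor_left_total[OF fock_basis_onb] by (simp only: image_image)
  then have t: "t \<in> closure (cspan (\<Union>w. range (blinfun_apply (tensor_left (fock_basis w)))))" by (simp only: UNIV_I)
  show "((\<lambda>w. fock_basis w \<otimes> fock_coord w t) has_sum t) UNIV"
    "((\<lambda>w. (norm (fock_coord w t))\<^sup>2) has_sum (norm t)\<^sup>2) UNIV"
    using isom_family_expansion[OF isom_family_fock_coordinates t] by simp_all
qed

lemma adj_coordinate_tensor:
  "fock_coord u (fock_basis w \<otimes> y) = (if u = w then y else 0)"
  using isom_familyD(4)[OF isom_family_fock_coordinates UNIV_I UNIV_I, of u w y] by simp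

lemma homogeneous_on_basis:
  assumes A: "range A \<subseteq> cops"
    and R: "has_sot_sum (\<lambda>\<alpha>. word_op creation \<alpha> \<otimes>\<^sub>o A \<alpha>) {\<alpha>. length \<alpha> = k} R"
  shows "((\<lambda>\<alpha>. fock_basis (\<alpha> @ w) \<otimes> A \<alpha> y) has_sum R (fock_basis w \<otimes> y)) {\<alpha>. length \<alpha> = k}"
proof -
  have "A \<alpha> \<in> cops" for \<alpha> using A by auto
  then have "(word_op creation \<alpha> \<otimes>\<^sub>o A \<alpha>) (fock_basis w \<otimes> y) = fock_basis (\<alpha> @ w) \<otimes> A \<alpha> y" for \<alpha>
    by (simp add: tensor_op_apply word_op_creation)
  then show ?thesis using R[unfolded has_sot_sum_def, rule_format, of "fock_basis w \<otimes> y"] by simp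
qed

lemma homogeneous_norm_on_basis:
  assumes A: "range A \<subseteq> cops"
    and R: "has_sot_sum (\<lambda>\<alpha>. word_op creation \<alpha> \<otimes>\<^sub>o A \<alpha>) {\<alpha>. length \<alpha> = k} R"
  shows "((\<lambda>\<alpha>. (norm (A \<alpha> y))\<^sup>2) has_sum (norm (R (fock_basis w \<otimes> y)))\<^sup>2) {\<alpha>. length \<alpha> = k}"
proof -
  have "((\<lambda>\<alpha>. (norm (fock_basis (\<alpha> @ w) \<otimes> A \<alpha> y))\<^sup>2) has_sum (norm (R (fock_basis w \<otimes> y)))\<^sup>2) {\<alpha>. length \<alpha> = k}"
    by (rule has_sum_norm_sq_orthogonal[OF _ homogeneous_on_basis[OF A R]])
      (simp add: inner_eq_Re_cinner cinner_tensor cinner_fock_basis_basis)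
  then show ?thesis by (simp add: norm_tensor norm_fock_basis)
qed

text \<open>A homogeneous operator maps \<open>e\<^sub>w \<otimes> y\<close> to \<open>\<Sum>\<^sub>\<alpha> e\<^sub>\<alpha>\<^sub>w \<otimes> A\<^sub>\<alpha> y\<close>. The norm of this vector does not depend on \<open>w\<close>, and the images
for different \<open>w\<close> are orthogonal because words \<open>\<alpha>\<close>, \<open>\<beta>\<close> of the same length with \<open>\<alpha> u = \<beta> w\<close> force \<open>u = w\<close>. Hence the
operator is bounded by its action on the vacuum column \<open>w = []\<close>.\<close>

lemma norm_homogeneous_le_column:
  fixes A :: "'n list \<Rightarrow> ('e::chilbert_space \<Rightarrow>\<^sub>L 'g::chilbert_space)"
    and R :: "('n, 'e, 'g) fock_op"
  assumes A: "range A \<subseteq> cops"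
    and R: "has_sot_sum (\<lambda>\<alpha>. word_op creation \<alpha> \<otimes>\<^sub>o A \<alpha>) {\<alpha>. length \<alpha> = k} R"
    and M: "0 \<le> M" "\<And>y. norm (R (fock_basis [] \<otimes> y)) \<le> M * norm y"
  shows "norm R \<le> M"
proof (rule norm_blinfun_bound[OF M(1)])
  fix x :: "('n fock, 'e) htensor"
  let ?x = "\<lambda>w. fock_coord w x"
  have zero: "cinner (R (fock_basis u \<otimes> y)) (R (fock_basis w \<otimes> z)) = 0" if "u \<noteq> w" for u w y z
  proof (rule has_sum_unique)
    show "((\<lambda>\<alpha>. cinner (fock_basis (\<alpha> @ u) \<otimes> A \<alpha> y) (R (fock_basis w \<otimes> z))) has_sum
        cinner (R (fock_basis u \<otimes> y)) (R (fock_basis w \<otimes> z))) {\<alpha>. length \<alpha> = k}"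
      by (rule has_sum_cinner_left[OF homogeneous_on_basis[OF A R]])
    have "cinner (fock_basis (\<alpha> @ u) \<otimes> A \<alpha> y) (R (fock_basis w \<otimes> z)) = 0" if "length \<alpha> = k" for \<alpha>
    proof (rule has_sum_unique)
      show "((\<lambda>\<beta>. cinner (fock_basis (\<alpha> @ u) \<otimes> A \<alpha> y) (fock_basis (\<beta> @ w) \<otimes> A \<beta> z)) has_sum
          cinner (fock_basis (\<alpha> @ u) \<otimes> A \<alpha> y) (R (fock_basis w \<otimes> z))) {\<beta>. length \<beta> = k}"
        by (rule has_sum_cinner_right[OF homogeneous_on_basis[OF A R]])
      show "((\<lambda>\<beta>. cinner (fock_basis (\<alpha> @ u) \<otimes> A \<alpha> y) (fock_basis (\<beta> @ w) \<otimes> A \<beta> z)) has_sum 0) {\<beta>. length \<beta> = k}"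
        by (rule has_sum_0) (use \<open>u \<noteq> w\<close> that in \<open>auto simp: cinner_tensor cinner_fock_basis_basis\<close>)
    qed
    then show "((\<lambda>\<alpha>. cinner (fock_basis (\<alpha> @ u) \<otimes> A \<alpha> y) (R (fock_basis w \<otimes> z))) has_sum 0) {\<alpha>. length \<alpha> = k}"
      by (intro has_sum_0) simp
  qed
  have same: "(norm (R (fock_basis w \<otimes> y)))\<^sup>2 = (norm (R (fock_basis [] \<otimes> y)))\<^sup>2" for w y
    by (rule has_sum_unique[OF homogeneous_norm_on_basis[OF A R] homogeneous_norm_on_basis[OF A R]])
  have "((\<lambda>w. R (fock_basis w \<otimes> ?x w)) has_sum R x) UNIV"
    by (rule has_sum_bounded_linear[OF blinfun.bounded_linear_right fock_coordinates_expansion(1)])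
  then have "((\<lambda>w. (norm (R (fock_basis w \<otimes> ?x w)))\<^sup>2) has_sum (norm (R x))\<^sup>2) UNIV"
    by (rule has_sum_norm_sq_orthogonal[rotated]) (simp add: inner_eq_Re_cinner zero)
  moreover have "((\<lambda>w. M\<^sup>2 * (norm (?x w))\<^sup>2) has_sum M\<^sup>2 * (norm x)\<^sup>2) UNIV"
    by (rule has_sum_cmult_right[OF fock_coordinates_expansion(2)])
  ultimately have "(norm (R x))\<^sup>2 \<le> M\<^sup>2 * (norm x)\<^sup>2"
  proof (rule has_sum_mono)
    show "(norm (R (fock_basis w \<otimes> ?x w)))\<^sup>2 \<le> M\<^sup>2 * (norm (?x w))\<^sup>2" for w
      using power_mono[OF M(2)[of "?x w"], of 2] by (simp add: same[of w] power_mult_distrib)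
  qed
  then have "(norm (R x))\<^sup>2 \<le> (M * norm x)\<^sup>2" by (simp add: power_mult_distrib)
  then show "norm (R x) \<le> M * norm x" by (rule power2_le_imp_le) (simp add: M(1))
qed

text \<open>The vacuum column of the boundary value lists the coefficients of the series: in that column, only the
homogeneous part of degree \<open>|\<gamma>|\<close> contributes to the coordinate \<open>\<gamma>\<close>.\<close>

lemma coordinate_boundary:
  fixes A :: "'n list \<Rightarrow> ('e::chilbert_space \<Rightarrow>\<^sub>L 'g::chilbert_space)"
    and T :: "('n, 'e, 'g) fock_op"
  assumes A: "range A \<subseteq> cops" and H: "hom_parts A H"
    and f: "\<And>r. 0 \<le> r \<Longrightarrow> r < 1 \<Longrightarrow> fh_sums A (\<lambda>i. r *\<^sub>R creation i) (f r)"
    and lim: "(f \<longlongrightarrow> T) (at_left 1)"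
  shows "fock_coord \<gamma> (T (fock_basis [] \<otimes> y)) = A \<gamma> y"
proof -
  let ?c = "\<lambda>S :: ('n, 'e, 'g) fock_op.
    fock_coord \<gamma> (S (fock_basis [] \<otimes> y))"
  have bl: "bounded_linear ?c"
    by (rule bounded_linear_compose[OF blinfun.bounded_linear_right blinfun.bounded_linear_left])
  have part: "?c (H k) = (if length \<gamma> = k then A \<gamma> y else 0)" for k
  proof (rule has_sum_unique)
    have "((\<lambda>\<alpha>. fock_basis (\<alpha> @ []) \<otimes> A \<alpha> y) has_sum H k (fock_basis [] \<otimes> y)) {\<alpha>. length \<alpha> = k}"
      using H unfolding hom_parts_def by (intro homogeneous_on_basis[OF A]) (rule spec)
    from has_sum_bounded_linear[OF blinfun.bounded_linear_right this, of "fock_coord \<gamma>"]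
    show "((\<lambda>\<alpha>. if \<gamma> = \<alpha> then A \<alpha> y else 0) has_sum ?c (H k)) {\<alpha>. length \<alpha> = k}"
      by (simp add: adj_coordinate_tensor)
    show "((\<lambda>\<alpha>. if \<gamma> = \<alpha> then A \<alpha> y else 0) has_sum (if length \<gamma> = k then A \<gamma> y else 0)) {\<alpha>. length \<alpha> = k}"
      by (cases "length \<gamma> = k")
        (auto intro!: has_sum_finite_neutralI[of "{\<gamma>}"] has_sum_0 split: if_splits)
  qed
  have "?c (f r) = r ^ length \<gamma> *\<^sub>R A \<gamma> y" if r: "0 \<le> r" "r < 1" for r
  proof (rule sums_unique2)
    show "(\<lambda>k. ?c (r ^ k *\<^sub>R H k)) sums ?c (f r)"
      by (rule bounded_linear.sums[OF bl hom_parts_sums[OF A H f[OF r]]])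
    have "?c (r ^ k *\<^sub>R H k) = (if k = length \<gamma> then r ^ k *\<^sub>R A \<gamma> y else 0)" for k
      using part[of k] by (simp add: blinfun.scaleR_left blinfun.scaleR_right)
    then show "(\<lambda>k. ?c (r ^ k *\<^sub>R H k)) sums (r ^ length \<gamma> *\<^sub>R A \<gamma> y)"
      using sums_single[of "length \<gamma>" "\<lambda>k. r ^ k *\<^sub>R A \<gamma> y"] by simp
  qed
  then have "\<forall>\<^sub>F r in at_left (1::real). ?c (f r) = r ^ length \<gamma> *\<^sub>R A \<gamma> y"
    using eventually_at_left_real[of 0 "1::real", OF zero_less_one]
    by (auto elim!: eventually_mono)
  moreover have "((\<lambda>r::real. r ^ length \<gamma> *\<^sub>R A \<gamma> y) \<longlongrightarrow> 1 ^ length \<gamma> *\<^sub>R A \<gamma> y) (at_left 1)"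
    by (intro tendsto_intros)
  moreover have "((\<lambda>r. ?c (f r)) \<longlongrightarrow> ?c T) (at_left 1)"
    by (rule bounded_linear.tendsto[OF bl lim])
  ultimately show ?thesis
    using tendsto_unique[OF trivial_limit_at_left_real] Lim_transform_eventually by fastforce
qed

text \<open>\<open>S\<^sub>\<beta>\<^sup>* e\<^sub>\<alpha>\<close> is \<open>e\<^sub>\<gamma>\<close> if \<open>\<alpha> = \<beta> \<gamma>\<close>, and \<open>0\<close> otherwise. So the column is supported on the suffixes of the words that
occur in \<open>D\<close>.\<close>

lemma poly_adj_poly_finite_column:
  fixes C :: "('n, 'y::chilbert_space, 'g::chilbert_space) fock_op"
    and D :: "('n, 'e::chilbert_space, 'g) fock_op"
  assumes C: "C \<in> fock_polys" and D: "D \<in> fock_polys"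
  shows "\<exists>J. finite J \<and> (\<forall>\<gamma> y. \<gamma> \<notin> J \<longrightarrow> fock_coord \<gamma> (adj C (D (fock_basis [] \<otimes> y))) = 0)"
proof -
  obtain JC c where JC: "finite JC" and c: "range c \<subseteq> cops" "\<And>\<alpha>. \<alpha> \<notin> JC \<Longrightarrow> c \<alpha> = 0" "C = fock_poly JC c"
    by (rule fock_polysE[OF C]) (rule that; assumption)
  obtain JD d where JD: "finite JD" and d: "range d \<subseteq> cops" "\<And>\<alpha>. \<alpha> \<notin> JD \<Longrightarrow> d \<alpha> = 0" "D = fock_poly JD d"
    by (rule fock_polysE[OF D]) (rule that; assumption)
  have cc: "c \<alpha> \<in> cops" and dc: "d \<alpha> \<in> cops" for \<alpha> using c(1) d(1) by auto
  have Cc: "C \<in> cops" using C fock_polys_cops by blast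
  define J where "J = (\<Union>\<alpha>\<in>JD. (\<lambda>k. drop k \<alpha>) ` {..length \<alpha>})"
  have J: "\<gamma> \<in> J" if "\<beta> @ \<gamma> \<in> JD" for \<beta> \<gamma>
    unfolding J_def using that by (intro UN_I[of "\<beta> @ \<gamma>"] image_eqI[of _ _ "length \<beta>"]) auto
  have "fock_coord \<gamma> (adj C (D (fock_basis [] \<otimes> y))) = 0" if "\<gamma> \<notin> J" for \<gamma> y
  proof (rule cinner_ext)
    fix z
    have "cinner z (fock_coord \<gamma> (adj C (D (fock_basis [] \<otimes> y))))
      = cinner (C (fock_basis \<gamma> \<otimes> z)) (D (fock_basis [] \<otimes> y))"
      by (simp add: cinner_adj_right Cc)
    also have "\<dots> = (\<Sum>\<alpha>\<in>JD. \<Sum>\<beta>\<in>JC. cinner (fock_basis (\<beta> @ \<gamma>) \<otimes> c \<beta> z) (fock_basis \<alpha> \<otimes> d \<alpha> y))"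
      unfolding c(3) d(3) fock_poly_def
      by (simp add: blinfun_sum_left cinner_sum_left cinner_simps(5) tensor_op_apply cc dc word_op_creation)
    also have "\<dots> = 0"
    proof (intro sum.neutral ballI)
      fix \<beta> \<alpha> assume "\<alpha> \<in> JD"
      then have "\<beta> @ \<gamma> \<noteq> \<alpha>" using J[of \<beta> \<gamma>] \<open>\<gamma> \<notin> J\<close> by blast
      then show "cinner (fock_basis (\<beta> @ \<gamma>) \<otimes> c \<beta> z) (fock_basis \<alpha> \<otimes> d \<alpha> y) = 0"
        by (simp add: cinner_tensor cinner_fock_basis_basis)
    qed
    finally show "cinner z (fock_coord \<gamma> (adj C (D (fock_basis [] \<otimes> y)))) = cinner z 0"
      by (simp add: cinner_simps)
  qed
  moreover have "finite J" unfolding J_def using JD by auto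
  ultimately show ?thesis by blast
qed

text \<open>The polynomial \<open>U\<close> of degree \<open>k\<close> takes its coefficients from the vacuum column of \<open>V\<close>. Then \<open>H k - U\<close> is
homogeneous, and its vacuum column consists of the coordinates of degree \<open>k\<close> of the column of \<open>T - V\<close>;
hence \<open>\<parallel>H k - U\<parallel> \<le> \<parallel>T - V\<parallel>\<close>. Comparing vacuum columns filters out the terms of negative degree that an
operator \<open>V = C\<^sup>* D\<close> has in general, without an analytic projection, which is unbounded in norm.\<close>

lemma homogeneous_part_in_closure_polys:
  fixes B :: "'n list \<Rightarrow> ('e::chilbert_space \<Rightarrow>\<^sub>L 'y::chilbert_space)"
    and T :: "('n, 'e, 'y) fock_op"
  assumes B: "range B \<subseteq> cops" and H: "hom_parts B H"
    and coord: "\<And>\<gamma> y. fock_coord \<gamma> (T (fock_basis [] \<otimes> y)) = B \<gamma> y"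
    and approx: "\<And>e. 0 < e \<Longrightarrow> \<exists>V J. V \<in> cops \<and> norm (T - V) < e \<and> finite J \<and>
      (\<forall>\<gamma> y. \<gamma> \<notin> J \<longrightarrow> fock_coord \<gamma> (V (fock_basis [] \<otimes> y)) = 0)"
  shows "H k \<in> closure fock_polys"
  unfolding closure_approachable
proof (intro allI impI)
  fix e :: real assume "0 < e"
  then obtain V J where V: "V \<in> cops" "norm (T - V) < e" and J: "finite J"
    and V0: "\<And>\<gamma> y. \<gamma> \<notin> J \<Longrightarrow> fock_coord \<gamma> (V (fock_basis [] \<otimes> y)) = 0"
    using approx by blast
  define E where "E \<gamma> = fock_coord \<gamma> o\<^sub>L V o\<^sub>L tensor_left (fock_basis [])" for \<gamma>
  have Ec: "E \<gamma> \<in> cops" for \<gamma> unfolding E_def by (intro cops_compose adj_cops V) simp_all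
  have E: "E \<gamma> y = fock_coord \<gamma> (V (fock_basis [] \<otimes> y))" for \<gamma> y by (simp add: E_def)
  have E0: "E \<gamma> = 0" if "\<gamma> \<notin> J" for \<gamma> by (rule blinfun_eqI) (simp add: E V0 that)
  have Bc: "B \<gamma> \<in> cops" for \<gamma> using B by auto
  define U where "U = fock_poly {\<gamma>\<in>J. length \<gamma> = k} E"
  have R: "has_sot_sum (\<lambda>\<alpha>. word_op creation \<alpha> \<otimes>\<^sub>o (B \<alpha> - E \<alpha>)) {\<alpha>. length \<alpha> = k} (H k - U)"
    unfolding has_sot_sum_def
  proof
    fix v
    have Hs: "((\<lambda>\<alpha>. (word_op creation \<alpha> \<otimes>\<^sub>o B \<alpha>) v) has_sum H k v) {\<alpha>. length \<alpha> = k}"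
      using H unfolding hom_parts_def has_sot_sum_def by blast
    have Us: "((\<lambda>\<alpha>. (word_op creation \<alpha> \<otimes>\<^sub>o E \<alpha>) v) has_sum U v) {\<alpha>. length \<alpha> = k}"
      unfolding U_def fock_poly_def
      by (rule has_sum_finite_neutralI[of "{\<gamma>\<in>J. length \<gamma> = k}"])
        (use J E0 in \<open>auto simp: blinfun_sum_left tensor_op_zero_right\<close>)
    have "((\<lambda>\<alpha>. (word_op creation \<alpha> \<otimes>\<^sub>o B \<alpha>) v + - (word_op creation \<alpha> \<otimes>\<^sub>o E \<alpha>) v) has_sum (H k v + - U v)) {\<alpha>. length \<alpha> = k}"
      by (rule has_sum_add[OF Hs has_sum_bounded_linear[OF bounded_linear_minus[OF bounded_linear_ident] Us]])
    then show "((\<lambda>\<alpha>. (word_op creation \<alpha> \<otimes>\<^sub>o (B \<alpha> - E \<alpha>)) v) has_sum (H k - U) v) {\<alpha>. length \<alpha> = k}"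
      by (simp add: tensor_op_diff_right Bc Ec blinfun.diff_left)
  qed
  have BE: "range (\<lambda>\<alpha>. B \<alpha> - E \<alpha>) \<subseteq> cops" using Bc Ec by (auto intro: cops_diff)
  have "norm (H k - U) \<le> norm (T - V)"
  proof (rule norm_homogeneous_le_column[OF BE R])
    fix y
    let ?z = "(T - V) (fock_basis [] \<otimes> y)"
    have "(B \<gamma> - E \<gamma>) y = fock_coord \<gamma> ?z" for \<gamma>
      by (simp add: blinfun.diff_left blinfun.diff_right E coord)
    then have "((\<lambda>\<gamma>. (norm (fock_coord \<gamma> ?z))\<^sup>2) has_sum (norm ((H k - U) (fock_basis [] \<otimes> y)))\<^sup>2) {\<alpha>. length \<alpha> = k}"
      using homogeneous_norm_on_basis[OF BE R, of y "[]"] by simp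
    then have "(norm ((H k - U) (fock_basis [] \<otimes> y)))\<^sup>2 \<le> (norm ?z)\<^sup>2"
      by (rule has_sum_mono'[OF _ fock_coordinates_expansion(2)]) auto
    then have "norm ((H k - U) (fock_basis [] \<otimes> y)) \<le> norm ?z" by (rule power2_le_imp_le) simp
    also have "\<dots> \<le> norm (T - V) * norm ((fock_basis [] :: 'n fock) \<otimes> y)" by (rule norm_blinfun)
    finally show "norm ((H k - U) (fock_basis [] \<otimes> y)) \<le> norm (T - V) * norm y"
      by (simp add: norm_tensor norm_fock_basis)
  qed simp
  then have "dist U (H k) < e" using V(2) by (simp add: dist_norm norm_minus_commute)
  moreover have "U \<in> fock_polys" unfolding U_def using Ec by (intro fock_poly_in_polys) auto
  ultimately show "\<exists>U\<in>fock_polys. dist U (H k) < e" by blast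
qed

text \<open>All homogeneous parts are limits of polynomials, therefore so are the values at \<open>r S\<close>, which are norm
convergent sums of multiples of them, and the norm limit of these values.\<close>

lemma boundary_quotient_in_closure_polys:
  fixes B :: "'n list \<Rightarrow> ('e::chilbert_space \<Rightarrow>\<^sub>L 'y::chilbert_space)"
    and C :: "('n, 'y, 'g::chilbert_space) fock_op"
    and D :: "('n, 'e, 'g) fock_op"
  assumes B: "range B \<subseteq> cops"
    and f: "\<And>r. 0 \<le> r \<Longrightarrow> r < 1 \<Longrightarrow> fh_sums B (\<lambda>i. r *\<^sub>R creation i) (f r)"
    and C: "C \<in> closure fock_polys" and D: "D \<in> closure fock_polys"
    and lim: "(f \<longlongrightarrow> adj C o\<^sub>L D) (at_left 1)"
  shows "adj C o\<^sub>L D \<in> closure fock_polys"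
proof -
  obtain H where H: "hom_parts B H" using hom_parts_exist[OF B f[of "1/2"]] by auto
  obtain c where c: "\<forall>n. c n \<in> fock_polys" "c \<longlonglongrightarrow> C" using C unfolding closure_sequential by blast
  obtain d where d: "\<forall>n. d n \<in> fock_polys" "d \<longlonglongrightarrow> D" using D unfolding closure_sequential by blast
  have Cc: "C \<in> cops" using C closure_fock_polys_cops by blast
  have cc: "c n \<in> cops" for n using c(1) fock_polys_cops by blast
  have dc: "d n \<in> cops" for n using d(1) fock_polys_cops by blast
  have "(\<lambda>n. adj (c n)) \<longlonglongrightarrow> adj C"
  proof (rule LIM_zero_cancel, rule tendsto_norm_zero_cancel)
    have "norm (adj (c n) - adj C) = norm (c n - C)" for n
      using norm_adj[OF cops_diff[OF cc Cc]] by (simp add: adj_diff cc Cc)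
    then show "(\<lambda>n. norm (adj (c n) - adj C)) \<longlonglongrightarrow> 0"
      using c(2) by (simp add: tendsto_norm_zero LIM_zero)
  qed
  then have cd: "(\<lambda>n. adj (c n) o\<^sub>L d n) \<longlonglongrightarrow> (adj C o\<^sub>L D)"
    by (rule bounded_bilinear.tendsto[OF bounded_bilinear_blinfun_compose _ d(2)])
  have part: "H k \<in> closure fock_polys" for k
  proof (rule homogeneous_part_in_closure_polys[OF B H coordinate_boundary[OF B H f lim]])
    fix e :: real assume "0 < e"
    then obtain n where "dist (adj (c n) o\<^sub>L d n) (adj C o\<^sub>L D) < e"
      using LIMSEQ_D[OF cd] unfolding dist_norm by blast
    then have "norm ((adj C o\<^sub>L D) - (adj (c n) o\<^sub>L d n)) < e" by (simp add: dist_norm norm_minus_commute)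
    moreover have "adj (c n) o\<^sub>L d n \<in> cops" by (intro cops_compose adj_cops cc dc)
    moreover have "\<exists>J. finite J \<and> (\<forall>\<gamma> y. \<gamma> \<notin> J \<longrightarrow>
        fock_coord \<gamma> ((adj (c n) o\<^sub>L d n) (fock_basis [] \<otimes> y)) = 0)"
      using poly_adj_poly_finite_column[of "c n" "d n"] c(1) d(1) by simp
    ultimately show "\<exists>V J. V \<in> cops \<and> norm ((adj C o\<^sub>L D) - V) < e \<and> finite J \<and>
      (\<forall>\<gamma> y. \<gamma> \<notin> J \<longrightarrow> fock_coord \<gamma> (V (fock_basis [] \<otimes> y)) = 0)"
      by blast
  qed
  have sub: "complex_vector.subspace (closure (fock_polys :: (('n, 'e, 'y) fock_op) set))"
    unfolding fock_polys_def by (rule subspace_closure_cspan)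
  have "f r \<in> closure fock_polys" if r: "0 \<le> r" "r < 1" for r
  proof (rule closed_sequentially[OF closed_closure])
    show "(\<lambda>n. \<Sum>k<n. r ^ k *\<^sub>R H k) \<longlonglongrightarrow> f r"
      using hom_parts_sums[OF B H f[OF r]] by (simp add: sums_def)
    have "r ^ k *\<^sub>R H k \<in> closure fock_polys" for k
      using complex_vector.subspace_scale[OF sub part[of k], of "complex_of_real (r ^ k)"]
      by (simp only: scaleC_of_real)
    then show "(\<Sum>k<n. r ^ k *\<^sub>R H k) \<in> closure fock_polys" for n
      by (intro complex_vector.subspace_sum[OF sub])
  qed
  then have "\<forall>\<^sub>F r in at_left (1::real). f r \<in> closure fock_polys"
    using eventually_at_left_real[of 0 "1::real", OF zero_less_one] by (auto elim!: eventually_mono)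
  then show ?thesis
    by (rule Lim_in_closed_set[OF closed_closure _ trivial_limit_at_left_real lim])
qed

section \<open>The factorization theorem\<close>

lemma row_ball_dilate:
  fixes X :: "'n \<Rightarrow> ('h::chilbert_space \<Rightarrow>\<^sub>L 'h)"
  assumes X: "X \<in> row_ball"
  shows "\<exists>r0<1. 0 \<le> r0 \<and> (\<forall>r>r0. (\<lambda>i. (1 / r) *\<^sub>R X i) \<in> row_ball)"
proof -
  obtain Q :: "'h \<Rightarrow>\<^sub>L 'h" where Q: "range X \<subseteq> cops" "\<And>h. ((\<lambda>i. X i (adj (X i) h)) has_sum Q h) UNIV" "norm Q < 1"
    by (rule row_ballD[OF X]) (rule that; assumption)
  have Xc: "X i \<in> cops" for i using Q(1) by auto
  have "(\<lambda>i. (1 / r) *\<^sub>R X i) \<in> row_ball" if r: "sqrt (norm Q) < r" for r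
  proof (rule row_ballI)
    have r0: "0 < r" by (rule order_le_less_trans[OF real_sqrt_ge_zero[OF norm_ge_zero] r])
    have "norm Q < r\<^sup>2" using power_strict_mono[OF r, of 2] by simp
    then show "norm ((1 / r\<^sup>2) *\<^sub>R Q) < 1" using r0 by simp
    show "range (\<lambda>i. (1 / r) *\<^sub>R X i) \<subseteq> cops" using Xc by (auto intro: cops_scaleR)
    show "((\<lambda>i. ((1 / r) *\<^sub>R X i) (adj ((1 / r) *\<^sub>R X i) h)) has_sum ((1 / r\<^sup>2) *\<^sub>R Q) h) UNIV" for h
      using has_sum_bounded_linear[OF bounded_linear_scaleR_right Q(2)[of h], of "1 / r\<^sup>2"]
      by (simp add: adj_scaleR Xc blinfun.scaleR_left blinfun.scaleR_right power2_eq_square)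
  qed
  then show ?thesis using Q(3) by (intro exI[of _ "sqrt (norm Q)"]) auto
qed

text \<open>A point \<open>X\<close> of the ball is \<open>r (X / r)\<close> with \<open>X / r\<close> still in the ball if \<open>r\<close> is close to 1, so the von
Neumann inequality bounds \<open>G(X)\<close> by the value of \<open>G\<close> at \<open>r S\<close> for all such \<open>r\<close>.\<close>

lemma norm_ball_le_boundary:
  fixes G :: "('n::countable, 'h::chilbert_space, 'e::chilbert_space, 'y::chilbert_space) ball_map"
    and T :: "('n, 'e, 'y) fock_op"
  assumes H: "\<nexists>B::'h set. finite B \<and> cspan B = UNIV" and G: "free_holomorphic G"
    and lim: "((\<lambda>r. fock_value G r) \<longlongrightarrow> T) (at_left 1)"
    and X: "X \<in> row_ball"
  shows "norm (G X) \<le> norm T"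
proof -
  obtain r0 where r0: "r0 < 1" "0 \<le> r0" "\<And>r. r0 < r \<Longrightarrow> (\<lambda>i. (1 / r) *\<^sub>R X i) \<in> row_ball"
    using row_ball_dilate[OF X] by blast
  have "norm (G X) \<le> norm (fock_value G r)" if r: "r0 < r" "r < 1" for r
  proof (rule von_neumann_series[OF r0(3)[OF r(1)] fh_coeff_cops[OF G]])
    show "fh_sums (fh_coeff G) (\<lambda>i. r *\<^sub>R creation i) (fock_value G r)"
      by (rule fh_eval_fock(1)[OF H G]) (use r r0 in auto)
    have "(\<lambda>i. r *\<^sub>R ((1 / r) *\<^sub>R X i)) = X" using r r0(2) by auto
    then show "fh_sums (fh_coeff G) (\<lambda>i. r *\<^sub>R ((1 / r) *\<^sub>R X i)) (G X)"
      using fh_coeff_sums[OF G X] by simp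
  qed
  then have "\<forall>\<^sub>F r in at_left 1. norm (G X) \<le> norm (fock_value G r)"
    using eventually_at_left_real[OF r0(1)] by (auto elim!: eventually_mono)
  then show ?thesis
    by (rule tendsto_lowerbound[OF tendsto_norm[OF lim] _ trivial_limit_at_left_real])
qed

lemma fh_norm_le_oneD: "fh_norm F \<le> 1 \<Longrightarrow> X \<in> row_ball \<Longrightarrow> norm (F X) \<le> 1"
  unfolding fh_norm_def SUP_le_iff by (auto simp: one_ereal_def)

lemma has_boundary_unique: "has_boundary F S \<Longrightarrow> has_boundary F T \<Longrightarrow> S = T"
  unfolding has_boundary_def
  by (rule blinfun_eqI) (blast intro: tendsto_unique[OF trivial_limit_at_left_real])

theorem proposition4p2:
  fixes F :: "('n::countable, 'h::chilbert_space, 'e::chilbert_space, 'g::chilbert_space) ball_map"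
    and \<Theta> :: "('n, 'h, 'y::chilbert_space, 'g) ball_map"
    and G :: "('n, 'h, 'e, 'y) ball_map"
  assumes H_separable: "\<exists>D::'h set. countable D \<and> closure D = UNIV"
    and H_infinite_dim: "\<nexists>B::'h set. finite B \<and> cspan B = UNIV"
    and F: "free_holomorphic F"
    and \<Theta>: "free_holomorphic \<Theta>"
    and G: "free_holomorphic G"
    and factorization: "\<forall>X\<in>row_ball. F X = \<Theta> X o\<^sub>L G X"
    and F_norm: "fh_norm F \<le> 1"
    and F_boundary: "\<exists>T. has_boundary F T \<and> T \<in> disc_algebra \<otimes>\<^sub>m\<^sub>i\<^sub>n cops"
    and \<Theta>_inner: "inner_fun \<Theta>"
    and \<Theta>_boundary: "\<exists>T. has_boundary \<Theta> T \<and> T \<in> disc_algebra \<otimes>\<^sub>m\<^sub>i\<^sub>n cops"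
  shows "fh_norm G \<le> 1 \<and>
    (\<exists>T. has_boundary G T \<and> T \<in> disc_algebra \<otimes>\<^sub>m\<^sub>i\<^sub>n cops) \<and>
    (\<forall>X\<in>row_ball. op_le (F X o\<^sub>L adj (F X)) (\<Theta> X o\<^sub>L adj (\<Theta> X))) \<and>
    (inner_fun F \<longrightarrow> inner_fun G)"
proof -
  let ?f = "fock_value F"
  let ?\<theta> = "fock_value \<Theta>"
  let ?g = "fock_value G"
  obtain FT where FT: "has_boundary F FT" "FT \<in> closure fock_polys"
    using F_boundary unfolding spatial_tensor_disc_algebra by blast
  obtain \<Theta>T where \<Theta>T: "has_boundary \<Theta> \<Theta>T" "\<Theta>T \<in> closure fock_polys"
    using \<Theta>_boundary unfolding spatial_tensor_disc_algebra by blast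
  have iso: "isometry_op \<Theta>T"
    using \<Theta>_inner has_boundary_unique[OF \<Theta>T(1)] unfolding inner_fun_def by blast
  have FTc: "FT \<in> cops" and \<Theta>Tc: "\<Theta>T \<in> cops"
    using FT(2) \<Theta>T(2) closure_fock_polys_cops by blast+
  have f_lim: "(?f \<longlongrightarrow> FT) (at_left 1)"
    using FT(1) unfolding has_boundary_def
    by (intro boundary_norm_limit[OF fh_coeff_cops[OF F] fh_eval_fock(1)[OF H_infinite_dim F] FT(2)]) auto
  have \<theta>_lim: "(?\<theta> \<longlongrightarrow> \<Theta>T) (at_left 1)"
    using \<Theta>T(1) unfolding has_boundary_def
    by (intro boundary_norm_limit[OF fh_coeff_cops[OF \<Theta>] fh_eval_fock(1)[OF H_infinite_dim \<Theta>] \<Theta>T(2)]) auto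
  have f_le: "norm (?f r) \<le> 1" if "0 \<le> r" "r < 1" for r
    by (rule fh_eval_fock(2)[OF H_infinite_dim F that fh_norm_le_oneD[OF F_norm]])
  have unit_interval: "\<forall>\<^sub>F r in at_left (1::real). r \<in> {0<..<1}"
    by (rule eventually_at_left_real) simp
  have FT_le: "norm FT \<le> 1"
    by (rule tendsto_upperbound[OF tendsto_norm[OF f_lim] _ trivial_limit_at_left_real])
      (use unit_interval in eventually_elim, simp add: f_le)
  \<comment> \<open>The boundary function of G: an isometry is inverted on its range by its adjoint.\<close>
  let ?GT = "adj \<Theta>T o\<^sub>L FT"
  have \<Theta>T_le: "norm \<Theta>T \<le> 1" using iso by (intro norm_blinfun_bound) (auto simp: isometry_op_def)
  have GT_le: "norm ?GT \<le> 1"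
    using norm_blinfun_compose[of "adj \<Theta>T" FT] mult_mono[OF \<Theta>T_le FT_le] norm_adj[OF \<Theta>Tc] by simp

  have g_lim: "(?g \<longlongrightarrow> ?GT) (at_left 1)"
  proof -
    have "((\<lambda>r. norm (?\<theta> r - \<Theta>T)) \<longlongrightarrow> 0) (at_left 1)"
      using \<theta>_lim by (simp add: tendsto_norm_zero LIM_zero)
    then have "\<forall>\<^sub>F r in at_left 1. norm (?\<theta> r - \<Theta>T) < 1 / 2"
      by (rule order_tendstoD) simp
    then have "\<forall>\<^sub>F r in at_left 1. norm ((adj \<Theta>T o\<^sub>L ?f r) - ?g r) \<le> 2 * norm (?\<theta> r - \<Theta>T)"
      using unit_interval
    proof eventually_elim
      case (elim r)
      then have r: "0 \<le> r" "r < 1" by auto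
      have fr: "?f r = ?\<theta> r o\<^sub>L ?g r"
        by (rule fh_eval_fock_mult[OF H_infinite_dim F \<Theta> G r factorization])
      \<comment> \<open>The difference to the isometry takes away at most half of the norm.\<close>
      have gx: "norm (?g r x) \<le> 2 * norm x" for x
      proof -
        have "norm (?g r x) = norm (\<Theta>T (?g r x))" using iso by (simp add: isometry_op_def)
        also have "\<Theta>T (?g r x) = ?f r x - (?\<theta> r - \<Theta>T) (?g r x)" by (simp add: fr blinfun.diff_left)
        also have "norm \<dots> \<le> norm (?f r x) + norm ((?\<theta> r - \<Theta>T) (?g r x))" by (rule norm_triangle_ineq4)
        also have "\<dots> \<le> 1 * norm x + 1 / 2 * norm (?g r x)"
          by (intro add_mono order_trans[OF norm_blinfun] mult_right_mono f_le r less_imp_le[OF elim(1)]) auto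
        finally show ?thesis by simp
      qed
      have "norm ((adj \<Theta>T o\<^sub>L ?f r) - ?g r) \<le> 2 * norm (?\<theta> r - \<Theta>T)"
      proof (rule norm_blinfun_bound)
        fix x
        have "((adj \<Theta>T o\<^sub>L ?f r) - ?g r) x = adj \<Theta>T ((?\<theta> r - \<Theta>T) (?g r x))"
          by (simp add: fr blinfun.diff_left blinfun.diff_right adj_isometry[OF \<Theta>Tc iso])
        also have "norm \<dots> \<le> norm (adj \<Theta>T) * norm ((?\<theta> r - \<Theta>T) (?g r x))" by (rule norm_blinfun)
        also have "\<dots> \<le> 1 * (norm (?\<theta> r - \<Theta>T) * (2 * norm x))"
          by (intro mult_mono order_trans[OF norm_blinfun] gx) (simp_all add: norm_adj \<Theta>Tc \<Theta>T_le)
        finally show "norm (((adj \<Theta>T o\<^sub>L ?f r) - ?g r) x) \<le> 2 * norm (?\<theta> r - \<Theta>T) * norm x" by (simp add: mult_ac)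
      qed simp
      then show ?case .
    qed
    moreover have "((\<lambda>r. 2 * norm (?\<theta> r - \<Theta>T)) \<longlongrightarrow> 0) (at_left 1)"
      using \<theta>_lim by (intro tendsto_mult_right_zero) (simp add: tendsto_norm_zero LIM_zero)
    ultimately have diff0: "((\<lambda>r. (adj \<Theta>T o\<^sub>L ?f r) - ?g r) \<longlongrightarrow> 0) (at_left 1)"
      by (rule Lim_null_comparison)
    have "((\<lambda>r. adj \<Theta>T o\<^sub>L ?f r) \<longlongrightarrow> ?GT) (at_left 1)"
      by (rule bounded_bilinear.tendsto[OF bounded_bilinear_blinfun_compose tendsto_const f_lim])
    from tendsto_diff[OF this diff0] show ?thesis by simp
  qed

  have G_le: "norm (G X) \<le> 1" if "X \<in> row_ball" for X
    using norm_ball_le_boundary[OF H_infinite_dim G g_lim that] GT_le by linarith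
  have G_norm: "fh_norm G \<le> 1"
    unfolding fh_norm_def by (rule SUP_least) (simp add: one_ereal_def G_le)
  have GT_boundary: "has_boundary G ?GT"
    unfolding has_boundary_def by (intro allI blinfun.tendsto g_lim tendsto_const)
  have GT_disc: "?GT \<in> disc_algebra \<otimes>\<^sub>m\<^sub>i\<^sub>n cops"
    unfolding spatial_tensor_disc_algebra
    by (rule boundary_quotient_in_closure_polys[OF fh_coeff_cops[OF G] fh_eval_fock(1)[OF H_infinite_dim G]
          \<Theta>T(2) FT(2) g_lim])

  have order: "op_le (F X o\<^sub>L adj (F X)) (\<Theta> X o\<^sub>L adj (\<Theta> X))" if X: "X \<in> row_ball" for X
    unfolding op_le_def
  proof
    fix x
    have Gc: "G X \<in> cops"
      by (rule fh_sums_cops[OF fh_coeff_sums[OF G X] fh_coeff_cops[OF G] row_ball_cops[OF X]])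
    have \<Theta>c: "\<Theta> X \<in> cops"
      by (rule fh_sums_cops[OF fh_coeff_sums[OF \<Theta> X] fh_coeff_cops[OF \<Theta>] row_ball_cops[OF X]])
    let ?u = "adj (\<Theta> X) x"
    have FX: "F X = \<Theta> X o\<^sub>L G X" using factorization X by blast
    have "cinner x (((\<Theta> X o\<^sub>L adj (\<Theta> X)) - (F X o\<^sub>L adj (F X))) x) = cinner ?u ?u - cinner (adj (G X) ?u) (adj (G X) ?u)"
      by (simp add: FX adj_compose \<Theta>c Gc blinfun.diff_left cinner_simps cinner_adj_left)
    also have "\<dots> = complex_of_real ((norm ?u)\<^sup>2 - (norm (adj (G X) ?u))\<^sup>2)"
      by (simp only: cinner_self of_real_diff)
    also have "\<dots> \<in> \<real>\<^sub>\<ge>\<^sub>0"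
    proof -
      have "norm (adj (G X) ?u) \<le> norm (adj (G X)) * norm ?u" by (rule norm_blinfun)
      also have "\<dots> \<le> 1 * norm ?u" using G_le[OF X] by (intro mult_right_mono) (simp_all add: norm_adj Gc)
      finally have "(norm (adj (G X) ?u))\<^sup>2 \<le> (norm ?u)\<^sup>2" by (intro power_mono) auto
      then show ?thesis by (simp only: nonneg_Reals_of_real_iff diff_ge_0_iff_ge)
    qed
    finally show "cinner x (((\<Theta> X o\<^sub>L adj (\<Theta> X)) - (F X o\<^sub>L adj (F X))) x) \<in> \<real>\<^sub>\<ge>\<^sub>0" .
  qed

  have inner: "inner_fun G" if F_inner: "inner_fun F"
  proof -
    have isoF: "isometry_op FT"
      using F_inner has_boundary_unique[OF FT(1)] unfolding inner_fun_def by blast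
    have F_eq: "\<Theta>T o\<^sub>L ?GT = FT"
    proof (rule tendsto_unique[OF trivial_limit_at_left_real])
      show "(?f \<longlongrightarrow> FT) (at_left 1)" by (rule f_lim)
      show "(?f \<longlongrightarrow> (\<Theta>T o\<^sub>L ?GT)) (at_left 1)"
      proof (rule Lim_transform_eventually)
        show "((\<lambda>r. ?\<theta> r o\<^sub>L ?g r) \<longlongrightarrow> (\<Theta>T o\<^sub>L ?GT)) (at_left 1)"
          by (rule bounded_bilinear.tendsto[OF bounded_bilinear_blinfun_compose \<theta>_lim g_lim])
        show "\<forall>\<^sub>F r in at_left 1. ?\<theta> r o\<^sub>L ?g r = ?f r"
          using unit_interval
          by eventually_elim (simp add: fh_eval_fock_mult[OF H_infinite_dim F \<Theta> G _ _ factorization])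
      qed
    qed
    have "norm (?GT x) = norm x" for x
    proof -
      have "norm (?GT x) = norm (\<Theta>T (?GT x))" using iso by (simp add: isometry_op_def)
      also have "\<Theta>T (?GT x) = FT x" using arg_cong[OF F_eq, of "\<lambda>S. blinfun_apply S x"] by simp
      also have "norm (FT x) = norm x" using isoF by (simp add: isometry_op_def)
      finally show ?thesis .
    qed
    then have "isometry_op ?GT" by (simp add: isometry_op_def)
    moreover have "fh_bounded G" using G_norm order_le_less_trans by (fastforce simp: fh_bounded_def)
    ultimately show ?thesis using GT_boundary unfolding inner_fun_def by blast
  qed
  show ?thesis using G_norm GT_boundary GT_disc order inner by blast
qed

end
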